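(* Let $G$ be a finite group and let $p$ be a prime. Then $G$ is the (internal) direct product of a $p$-group and a $p'$-group if and only if $$u_{p'}(G)=|G|_{p'}\cdot|G:G'|_{p}.$$
   Context: $\mathrm{Irr}(G)$ denotes the set of complex irreducible characters of the finite group $G$, and $G'$ is the derived (commutator) subgroup of $G$. For a positive integer $n$ and a prime $p$, write $n=n_p\cdot n_{p'}$, where $n_p$ is the largest power of $p$ dividing $n$ and $n_{p'}$ is coprime to $p$. A $p'$-group is a finite group of order coprime to $p$; the trivial group counts both as a $p$-group and as a $p'$-group. The invariant $u_{p'}(G)$ is defined by $$u_{p'}(G)=\sum_{\chi\in\mathrm{Irr}(G),\ p\nmid\chi(1)}\chi(1)^2 .$$ *)

theory Defs
  imports
    Complex_Main
    "HOL-Computational_Algebra.Primes"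
    "HOL-Algebra.Generated_Groups"
    "Jordan_Normal_Form.VS_Connect"
begin

section \<open>Complex representations and irreducible characters\<close>

abbreviation GL :: "nat \<Rightarrow> complex mat monoid" where
  "GL n \<equiv> units_of (ring_mat TYPE(complex) n ())"

text \<open>
  Every finite-dimensional complex representation is isomorphic to a matrix representation, so the
  characters of \<open>G\<close> are exactly the characters of homomorphisms into some \<open>GL n\<close>.
\<close>

definition representation :: "('a, 'b) monoid_scheme \<Rightarrow> nat \<Rightarrow> ('a \<Rightarrow> complex mat) \<Rightarrow> bool" where
  "representation G n \<rho> \<longleftrightarrow> \<rho> \<in> hom G (GL n)"

definition invariant_subspace ::
    "('a, 'b) monoid_scheme \<Rightarrow> nat \<Rightarrow> ('a \<Rightarrow> complex mat) \<Rightarrow> complex vec set \<Rightarrow> bool" where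
  "invariant_subspace G n \<rho> W \<longleftrightarrow>
     VectorSpace.subspace class_ring W (module_vec TYPE(complex) n) \<and>
     (\<forall>g\<in>carrier G. \<forall>w\<in>W. \<rho> g *\<^sub>v w \<in> W)"

definition irreducible_representation ::
    "('a, 'b) monoid_scheme \<Rightarrow> nat \<Rightarrow> ('a \<Rightarrow> complex mat) \<Rightarrow> bool" where
  "irreducible_representation G n \<rho> \<longleftrightarrow>
     representation G n \<rho> \<and> 0 < n \<and>
     (\<forall>W. invariant_subspace G n \<rho> W \<longrightarrow> W = {0\<^sub>v n} \<or> W = carrier_vec n)"

definition mat_trace :: "'a :: comm_monoid_add mat \<Rightarrow> 'a" where
  "mat_trace A = (\<Sum>i<dim_row A. A $$ (i, i))"

text \<open>
  Characters are made extensional (\<open>undefined\<close> off the carrier), so that two of them are equal as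
  HOL functions iff they agree on \<open>G\<close>, and each irreducible character occurs only once in \<open>Irr G\<close>.
\<close>

definition character_of :: "('a, 'b) monoid_scheme \<Rightarrow> ('a \<Rightarrow> complex mat) \<Rightarrow> 'a \<Rightarrow> complex" where
  "character_of G \<rho> = (\<lambda>g\<in>carrier G. mat_trace (\<rho> g))"

definition Irr :: "('a, 'b) monoid_scheme \<Rightarrow> ('a \<Rightarrow> complex) set" where
  "Irr G = {character_of G \<rho> | n \<rho>. irreducible_representation G n \<rho>}"

text \<open>
  The value \<open>\<chi>(1)\<close>, read as a natural number so that divisibility by \<open>p\<close> is meaningful. The lemma
  \<open>Irr_degree\<close> below shows that this loses nothing on \<open>Irr G\<close>.
\<close>

definition char_degree :: "('a, 'b) monoid_scheme \<Rightarrow> ('a \<Rightarrow> complex) \<Rightarrow> nat" where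
  "char_degree G \<chi> = (THE d. \<chi> \<one>\<^bsub>G\<^esub> = of_nat d)"

lemma character_of_one:
  assumes "group G" and "representation G n \<rho>"
  shows "character_of G \<rho> \<one>\<^bsub>G\<^esub> = of_nat n"
proof -
  have "monoid (ring_mat TYPE(complex) n ())"
    using semiring_mat by (rule semiring.axioms(2))
  then have "group (GL n)" by (rule monoid.units_group)
  then have "\<rho> \<one>\<^bsub>G\<^esub> = \<one>\<^bsub>GL n\<^esub>"
    using assms unfolding representation_def by (metis hom_one)
  also have "\<dots> = 1\<^sub>m n"
    by (simp only: units_of_one ring_mat_simps)
  finally have "\<rho> \<one>\<^bsub>G\<^esub> = 1\<^sub>m n" .
  moreover have "\<one>\<^bsub>G\<^esub> \<in> carrier G"
    using assms(1) by (simp add: group.is_monoid)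
  ultimately show ?thesis
    by (simp add: character_of_def mat_trace_def)
qed

lemma Irr_degree:
  assumes "group G" and "\<chi> \<in> Irr G"
  shows "\<chi> \<one>\<^bsub>G\<^esub> = of_nat (char_degree G \<chi>)"
proof -
  obtain n \<rho> where "representation G n \<rho>" and "\<chi> = character_of G \<rho>"
    using assms(2) unfolding Irr_def irreducible_representation_def by auto
  then have "\<chi> \<one>\<^bsub>G\<^esub> = of_nat n"
    using character_of_one[OF assms(1)] by simp
  moreover from this have "char_degree G \<chi> = n"
    unfolding char_degree_def by (intro the_equality) simp_all
  ultimately show ?thesis by (simp only:)
qed

definition u_pprime :: "nat \<Rightarrow> ('a, 'b) monoid_scheme \<Rightarrow> nat" where
  "u_pprime p G = (\<Sum>\<chi> \<in> {\<chi> \<in> Irr G. \<not> p dvd char_degree G \<chi>}. (char_degree G \<chi>)\<^sup>2)"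


section \<open>\<open>p\<close>-parts, indices and direct products\<close>

definition p_part :: "nat \<Rightarrow> nat \<Rightarrow> nat" where
  "p_part p n = p ^ multiplicity p n"

definition pprime_part :: "nat \<Rightarrow> nat \<Rightarrow> nat" where
  "pprime_part p n = n div p_part p n"

definition subgroup_index :: "('a, 'b) monoid_scheme \<Rightarrow> 'a set \<Rightarrow> nat" where
  "subgroup_index G H = card (rcosets\<^bsub>G\<^esub> H)"

definition p_group :: "nat \<Rightarrow> ('a, 'b) monoid_scheme \<Rightarrow> bool" where
  "p_group p G \<longleftrightarrow> group G \<and> finite (carrier G) \<and> (\<exists>k. Coset.order G = p ^ k)"

definition pprime_group :: "nat \<Rightarrow> ('a, 'b) monoid_scheme \<Rightarrow> bool" where
  "pprime_group p G \<longleftrightarrow> group G \<and> finite (carrier G) \<and> coprime (Coset.order G) p"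

definition internal_direct_product :: "('a, 'b) monoid_scheme \<Rightarrow> 'a set \<Rightarrow> 'a set \<Rightarrow> bool" where
  "internal_direct_product G H K \<longleftrightarrow>
     H \<lhd> G \<and> K \<lhd> G \<and> H <#>\<^bsub>G\<^esub> K = carrier G \<and> H \<inter> K = {\<one>\<^bsub>G\<^esub>}"

end

theory Submission
  imports
    Defs
    "Jordan_Normal_Form.Char_Poly"
    "HOL-Algebra.Multiplicative_Group"
    "HOL-Algebra.Sylow"
    "HOL-Number_Theory.Cong"
begin

text \<open>
  Write \<open>|G| = k p\<^sup>c\<close> with \<open>p\<close> not dividing \<open>k\<close>. The linear characters of \<open>p\<close>-power order form a group
  \<open>L\<close> of order \<open>|G : G'|\<^bsub>p\<^esub>\<close>, which acts by multiplication on the irreducible characters of degree prime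
  to \<open>p\<close>. Looking at determinants, this action is free and every orbit contains exactly one character
  whose determinant has order prime to \<open>p\<close>; these form the set \<open>Irr_det p k G\<close>. Therefore
  \<open>u\<^bsub>p'\<^esub>(G) = |G : G'|\<^bsub>p\<^esub> s(G)\<close>, where \<open>s(G)\<close> is the sum of \<open>\<chi>(1)\<^sup>2\<close> over that set
  (\<open>u_pprime_factorisation\<close>), and the equation to be characterised becomes \<open>s(G) = k\<close>.

  The main step compares \<open>G\<close> with a normal subgroup \<open>M\<close> of index \<open>p\<close>. Restriction maps the characters
  of \<open>Irr_det p k G\<close> bijectively to the \<open>G\<close>-invariant members of \<open>Irr_det p k M\<close>
  (\<open>restriction_irreducible\<close>, \<open>restriction_inj\<close>, \<open>extension\<close>). The members that are not invariant fall
  into orbits of length \<open>p\<close>, so \<open>s(G) \<equiv> s(M)\<close> modulo \<open>p\<close>. Repeating this leads to a subgroup \<open>N\<close> of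
  \<open>p\<close>-power index that has no normal subgroup of index \<open>p\<close>. There the condition on determinants is
  void and \<open>s(N) \<equiv> |N|\<close>, so \<open>s(G) \<equiv> |N|\<close> modulo \<open>p\<close> (\<open>descent\<close>). This is the argument of Thompson's
  theorem on groups all of whose nonlinear character degrees are divisible by \<open>p\<close>.

  If \<open>s(G) = k\<close>, then \<open>p\<close> does not divide \<open>|N|\<close>, so \<open>N\<close> is a normal \<open>p\<close>-complement of order \<open>k\<close>. As
  restriction \<open>Irr_det p k G \<rightarrow> Irr N\<close> is injective and the squared degrees on both sides add up to \<open>k\<close>,
  every irreducible character of \<open>N\<close> extends to \<open>G\<close> and is invariant. Characters separate conjugacy
  classes, so every \<open>p\<close>-element of \<open>G\<close> fixes all classes of \<open>N\<close>, hence acts trivially on \<open>N\<close> by a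
  counting argument (\<open>class_preserving_automorphism_trivial\<close>), and a Sylow \<open>p\<close>-subgroup is a direct
  factor. Conversely, if \<open>G = P \<times> Q\<close>, then \<open>N = Q\<close>, all degrees of \<open>Q\<close> are prime to \<open>p\<close> because they
  divide \<open>|Q|\<close>, and extending characters of \<open>Q\<close> trivially over \<open>P\<close> shows \<open>s(G) = |Q| = k\<close>.

  The underlying representation theory is developed with matrices: Schur's lemma and complete
  reducibility, orthogonality, and the principle that a function on \<open>G\<close> annihilated by all
  irreducible representations vanishes. The last one gives the sum of the squared degrees, the
  number of linear characters and the separation of conjugacy classes.
\<close>

section \<open>Sums and traces of complex matrices\<close>

lemma mat_mult_entry:
  assumes "A \<in> carrier_mat n m" "B \<in> carrier_mat m l" "i < n" "j < l"
  shows "(A * B) $$ (i, j) = (\<Sum>k<m. A $$ (i, k) * B $$ (k, j))"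
  using assms by (auto simp: scalar_prod_def lessThan_atLeast0)

lemma mat_vec_entry:
  assumes "A \<in> carrier_mat n m" "v \<in> carrier_vec m" "i < n"
  shows "(A *\<^sub>v v) $ i = (\<Sum>k<m. A $$ (i, k) * v $ k)"
  using assms by (auto simp: scalar_prod_def lessThan_atLeast0)

text \<open>
  The dimensions are explicit because matrices of varying size do not form an additive monoid to
  which the usual \<open>\<Sum>\<close> applies.
\<close>

definition mat_sum :: "nat \<Rightarrow> nat \<Rightarrow> ('i \<Rightarrow> complex mat) \<Rightarrow> 'i set \<Rightarrow> complex mat" where
  "mat_sum n m F A = mat n m (\<lambda>ij. \<Sum>x\<in>A. F x $$ ij)"

lemma mat_sum_carrier [simp, intro]: "mat_sum n m F A \<in> carrier_mat n m"
  by (simp add: mat_sum_def)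

lemma mat_sum_index [simp]:
  "i < n \<Longrightarrow> j < m \<Longrightarrow> mat_sum n m F A $$ (i, j) = (\<Sum>x\<in>A. F x $$ (i, j))"
  by (simp add: mat_sum_def)

lemma mat_sum_dim [simp]: "dim_row (mat_sum n m F A) = n" "dim_col (mat_sum n m F A) = m"
  by (simp_all add: mat_sum_def)

lemma mat_sum_cong:
  assumes "\<And>x. x \<in> A \<Longrightarrow> F x = H x"
  shows "mat_sum n m F A = mat_sum n m H A"
  unfolding mat_sum_def using assms by (intro arg_cong2[where f = "mat n"]) (auto intro!: ext sum.cong)

lemma mat_sum_reindex:
  assumes "bij_betw h A B"
  shows "mat_sum n m (\<lambda>x. F (h x)) A = mat_sum n m F B"
  by (intro eq_matI) (auto simp: sum.reindex_bij_betw[OF assms, of "\<lambda>x. F x $$ (_, _)"])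

lemma mult_mat_sum:
  assumes "X \<in> carrier_mat l n" "\<And>x. x \<in> A \<Longrightarrow> F x \<in> carrier_mat n m"
  shows "X * mat_sum n m F A = mat_sum l m (\<lambda>x. X * F x) A"
proof (intro eq_matI)
  fix i j assume "i < dim_row (mat_sum l m (\<lambda>x. X * F x) A)" "j < dim_col (mat_sum l m (\<lambda>x. X * F x) A)"
  then have ij: "i < l" "j < m" by auto
  have "(X * mat_sum n m F A) $$ (i, j) = (\<Sum>k<n. \<Sum>x\<in>A. X $$ (i, k) * F x $$ (k, j))"
    using assms(1) ij by (subst mat_mult_entry[of _ l n _ m]) (auto simp: sum_distrib_left)
  also have "\<dots> = (\<Sum>x\<in>A. \<Sum>k<n. X $$ (i, k) * F x $$ (k, j))" by (rule sum.swap)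
  also have "\<dots> = (\<Sum>x\<in>A. (X * F x) $$ (i, j))"
    using assms ij by (intro sum.cong refl) (subst mat_mult_entry[of _ l n _ m], auto)
  finally show "(X * mat_sum n m F A) $$ (i, j) = mat_sum l m (\<lambda>x. X * F x) A $$ (i, j)"
    using ij by simp
qed (use assms in auto)

lemma mat_sum_mult:
  assumes "X \<in> carrier_mat m l" "\<And>x. x \<in> A \<Longrightarrow> F x \<in> carrier_mat n m"
  shows "mat_sum n m F A * X = mat_sum n l (\<lambda>x. F x * X) A"
proof (intro eq_matI)
  fix i j assume "i < dim_row (mat_sum n l (\<lambda>x. F x * X) A)" "j < dim_col (mat_sum n l (\<lambda>x. F x * X) A)"
  then have ij: "i < n" "j < l" by auto
  have "(mat_sum n m F A * X) $$ (i, j) = (\<Sum>k<m. \<Sum>x\<in>A. F x $$ (i, k) * X $$ (k, j))"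
    using assms(1) ij by (subst mat_mult_entry[of _ n m _ l]) (auto simp: sum_distrib_right)
  also have "\<dots> = (\<Sum>x\<in>A. \<Sum>k<m. F x $$ (i, k) * X $$ (k, j))" by (rule sum.swap)
  also have "\<dots> = (\<Sum>x\<in>A. (F x * X) $$ (i, j))"
    using assms ij by (intro sum.cong refl) (subst mat_mult_entry[of _ n m _ l], auto)
  finally show "(mat_sum n m F A * X) $$ (i, j) = mat_sum n l (\<lambda>x. F x * X) A $$ (i, j)"
    using ij by simp
qed (use assms in auto)

lemma smult_mat_sum:
  assumes "\<And>x. x \<in> A \<Longrightarrow> F x \<in> carrier_mat n m"
  shows "c \<cdot>\<^sub>m mat_sum n m F A = mat_sum n m (\<lambda>x. c \<cdot>\<^sub>m F x) A"
proof (intro eq_matI)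
  fix i j assume "i < dim_row (mat_sum n m (\<lambda>x. c \<cdot>\<^sub>m F x) A)" "j < dim_col (mat_sum n m (\<lambda>x. c \<cdot>\<^sub>m F x) A)"
  then have ij: "i < n" "j < m" by auto
  have "(\<Sum>x\<in>A. (c \<cdot>\<^sub>m F x) $$ (i, j)) = (\<Sum>x\<in>A. c * F x $$ (i, j))"
    using assms ij by (intro sum.cong refl) (metis carrier_matD index_smult_mat(1))
  then show "(c \<cdot>\<^sub>m mat_sum n m F A) $$ (i, j) = mat_sum n m (\<lambda>x. c \<cdot>\<^sub>m F x) A $$ (i, j)"
    using ij by (simp add: sum_distrib_left)
qed auto

lemma mat_sum_const:
  assumes "X \<in> carrier_mat n m"
  shows "mat_sum n m (\<lambda>x. X) A = of_nat (card A) \<cdot>\<^sub>m X"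
  using assms by (intro eq_matI) auto

lemma mat_trace_sum: "mat_trace (mat_sum n n F A) = (\<Sum>x\<in>A. \<Sum>i<n. F x $$ (i, i))"
  unfolding mat_trace_def by (simp add: sum.swap[of _ A])

lemma mat_trace_mat_sum:
  assumes "\<And>x. x \<in> A \<Longrightarrow> F x \<in> carrier_mat n n"
  shows "mat_trace (mat_sum n n F A) = (\<Sum>x\<in>A. mat_trace (F x))"
  unfolding mat_trace_sum
proof (intro sum.cong refl)
  fix x assume "x \<in> A"
  then have "dim_row (F x) = n" using assms by auto
  then show "(\<Sum>i<n. F x $$ (i, i)) = mat_trace (F x)" unfolding mat_trace_def by simp
qed

lemma mat_trace_smult: "A \<in> carrier_mat n n \<Longrightarrow> mat_trace (c \<cdot>\<^sub>m (A :: complex mat)) = c * mat_trace A"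
  unfolding mat_trace_def by (auto simp: sum_distrib_left intro!: sum.cong)

lemma mat_trace_one [simp]: "mat_trace (1\<^sub>m n :: complex mat) = of_nat n"
  by (simp add: mat_trace_def)

lemma mat_trace_mult_commute:
  assumes "A \<in> carrier_mat n m" "(B :: complex mat) \<in> carrier_mat m n"
  shows "mat_trace (A * B) = mat_trace (B * A)"
proof -
  have "mat_trace (A * B) = (\<Sum>i<n. \<Sum>k<m. A $$ (i, k) * B $$ (k, i))"
    using assms unfolding mat_trace_def by (auto intro!: sum.cong simp: mat_mult_entry[OF assms] simp del: index_mult_mat(1))
  also have "\<dots> = (\<Sum>k<m. \<Sum>i<n. B $$ (k, i) * A $$ (i, k))"
    by (subst sum.swap) (simp add: mult.commute)
  also have "\<dots> = mat_trace (B * A)"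
    using assms unfolding mat_trace_def by (auto intro!: sum.cong simp: mat_mult_entry[OF assms(2,1)] simp del: index_mult_mat(1))
  finally show ?thesis .
qed

lemma smult_eq_one_trace:
  assumes "(A :: complex mat) = c \<cdot>\<^sub>m 1\<^sub>m n"
  shows "mat_trace A = c * of_nat n"
  unfolding assms by (subst mat_trace_smult[of _ n]) auto

lemma smult_smult_mat: "a \<cdot>\<^sub>m (b \<cdot>\<^sub>m (A :: complex mat)) = (a * b) \<cdot>\<^sub>m A"
  by (intro eq_matI) auto

lemma one_smult_mat: "1 \<cdot>\<^sub>m (A :: complex mat) = A"
  by (intro eq_matI) auto

lemma mult_smult_one:
  assumes "(A :: complex mat) \<in> carrier_mat n m"
  shows "A * (c \<cdot>\<^sub>m 1\<^sub>m m) = c \<cdot>\<^sub>m A" "(c \<cdot>\<^sub>m 1\<^sub>m n) * A = c \<cdot>\<^sub>m A"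
  using assms by (simp_all add: mult_smult_distrib[OF assms one_carrier_mat] mult_smult_assoc_mat[OF one_carrier_mat assms])

lemma smult_mat_cancel:
  assumes "c \<noteq> 0" "c \<cdot>\<^sub>m A = c \<cdot>\<^sub>m (B :: complex mat)"
  shows "A = B"
proof -
  have "(1 / c) \<cdot>\<^sub>m (c \<cdot>\<^sub>m A) = (1 / c) \<cdot>\<^sub>m (c \<cdot>\<^sub>m B)" using assms(2) by simp
  then show ?thesis using assms(1) by (simp add: smult_smult_mat one_smult_mat)
qed

lemma pow_mat_carrier [simp, intro]: "A \<in> carrier_mat n n \<Longrightarrow> A ^\<^sub>m k \<in> carrier_mat n n"
  by (metis carrier_matD carrier_matI pow_mat_dim_square)

lemma smult_pow_mat:
  assumes "(A :: complex mat) \<in> carrier_mat n n"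
  shows "(c \<cdot>\<^sub>m A) ^\<^sub>m k = (c ^ k) \<cdot>\<^sub>m (A ^\<^sub>m k)"
proof (induction k)
  case 0
  show ?case using assms by (intro eq_matI) auto
next
  case (Suc k)
  have "(c \<cdot>\<^sub>m A) ^\<^sub>m Suc k = ((c ^ k) \<cdot>\<^sub>m (A ^\<^sub>m k)) * (c \<cdot>\<^sub>m A)" using Suc by simp
  also have "\<dots> = (c ^ k) \<cdot>\<^sub>m ((A ^\<^sub>m k) * (c \<cdot>\<^sub>m A))"
    by (rule mult_smult_assoc_mat[of _ n n _ n]) (use assms in auto)
  also have "(A ^\<^sub>m k) * (c \<cdot>\<^sub>m A) = c \<cdot>\<^sub>m ((A ^\<^sub>m k) * A)"
    by (rule mult_smult_distrib[of _ n n _ n]) (use assms in auto)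
  finally show ?case by (simp add: smult_smult_mat mult.commute)
qed

lemma det_pow_mat:
  assumes "(A :: complex mat) \<in> carrier_mat n n"
  shows "det (A ^\<^sub>m k) = det A ^ k"
  using assms by (induction k) (auto simp: det_mult[of _ n])

lemma pow_mat_add:
  assumes "(A :: complex mat) \<in> carrier_mat n n"
  shows "A ^\<^sub>m (i + j) = A ^\<^sub>m i * A ^\<^sub>m j"
proof (induction j)
  case (Suc j)
  have "A ^\<^sub>m (i + Suc j) = A ^\<^sub>m i * A ^\<^sub>m j * A" using Suc by simp
  also have "\<dots> = A ^\<^sub>m i * (A ^\<^sub>m j * A)"
    by (rule assoc_mult_mat[of _ n n _ n _ n]) (use assms in auto)
  finally show ?case by simp
qed (use assms in auto)

lemma invertible_of_right_inverse:
  assumes "(A :: complex mat) \<in> carrier_mat n n" "B \<in> carrier_mat n n" "A * B = 1\<^sub>m n"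
  shows "B * A = 1\<^sub>m n" "det A \<noteq> 0"
proof -
  show "B * A = 1\<^sub>m n" using mat_mult_left_right_inverse[OF assms] .
  have "det A * det B = 1" using det_mult[OF assms(1,2)] assms(3) by simp
  then show "det A \<noteq> 0" by auto
qed

text \<open>
  Padding the two factors with zeros to square matrices gives an invertible matrix with a zero
  column when \<open>m > n\<close>.
\<close>

lemma right_inverse_dim_le:
  assumes A: "(A :: complex mat) \<in> carrier_mat m n" and B: "B \<in> carrier_mat n m" and AB: "A * B = 1\<^sub>m m"
  shows "m \<le> n"
proof (rule ccontr)
  assume "\<not> m \<le> n"
  then have nm: "n < m" by simp
  define A' where "A' = mat m m (\<lambda>(i, j). if j < n then A $$ (i, j) else 0)"
  define B' where "B' = mat m m (\<lambda>(i, j). if i < n then B $$ (i, j) else 0)"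
  have c: "A' \<in> carrier_mat m m" "B' \<in> carrier_mat m m" by (auto simp: A'_def B'_def)
  have "A' * B' = A * B"
  proof (intro eq_matI)
    fix i j assume "i < dim_row (A * B)" "j < dim_col (A * B)"
    then have ij: "i < m" "j < m" using A B by auto
    have "(A' * B') $$ (i, j) = (\<Sum>k<m. A' $$ (i, k) * B' $$ (k, j))"
      using mat_mult_entry[OF c ij] .
    also have "\<dots> = (\<Sum>k<n. A $$ (i, k) * B $$ (k, j))"
      using nm ij by (intro sum.mono_neutral_cong_right) (auto simp: A'_def B'_def)
    also have "\<dots> = (A * B) $$ (i, j)" using mat_mult_entry[OF A B ij] by simp
    finally show "(A' * B') $$ (i, j) = (A * B) $$ (i, j)" .
  qed (use A B c in auto)
  then have "A' * B' = 1\<^sub>m m" using AB by simp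
  then have "B' * A' = 1\<^sub>m m" using mat_mult_left_right_inverse[OF c] by simp
  then have "(B' * A') $$ (n, n) = 1" using nm by simp
  moreover have "(B' * A') $$ (n, n) = 0"
    using nm by (subst mat_mult_entry[OF c(2,1)]) (auto simp: A'_def B'_def)
  ultimately show False by simp
qed

lemma mat_eq_zero_if_kills_vectors:
  assumes "(A :: complex mat) \<in> carrier_mat n m" "\<And>v. v \<in> carrier_vec m \<Longrightarrow> A *\<^sub>v v = 0\<^sub>v n"
  shows "A = 0\<^sub>m n m"
proof (intro eq_matI)
  fix i j assume "i < dim_row (0\<^sub>m n m :: complex mat)" "j < dim_col (0\<^sub>m n m :: complex mat)"
  then have ij: "i < n" "j < m" by auto
  have "(A *\<^sub>v unit_vec m j) $ i = A $$ (i, j)"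
    using assms(1) ij by (subst mat_vec_entry[of _ n m]) (auto simp: unit_vec_def if_distrib cong: if_cong)
  then show "A $$ (i, j) = 0\<^sub>m n m $$ (i, j)" using assms(2)[of "unit_vec m j"] ij by simp
qed (use assms in auto)

lemma mat_eqI_vec:
  assumes "(A :: complex mat) \<in> carrier_mat n m" "B \<in> carrier_mat n m"
    "\<And>v. v \<in> carrier_vec m \<Longrightarrow> A *\<^sub>v v = B *\<^sub>v v"
  shows "A = B"
proof -
  have "A - B = 0\<^sub>m n m"
    using assms by (intro mat_eq_zero_if_kills_vectors)
      (auto simp: minus_mult_distrib_mat_vec[of _ n m] intro!: eq_vecI)
  then have "\<And>i j. i < n \<Longrightarrow> j < m \<Longrightarrow> (A - B) $$ (i, j) = 0" by simp
  then show ?thesis using assms by (intro eq_matI) auto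
qed

definition linear_subspace :: "nat \<Rightarrow> complex vec set \<Rightarrow> bool" where
  "linear_subspace n W \<longleftrightarrow> W \<subseteq> carrier_vec n \<and> 0\<^sub>v n \<in> W \<and>
     (\<forall>v\<in>W. \<forall>w\<in>W. v + w \<in> W) \<and> (\<forall>c. \<forall>v\<in>W. c \<cdot>\<^sub>v v \<in> W)"

lemma subspace_iff_linear_subspace:
  "VectorSpace.subspace class_ring W (module_vec TYPE(complex) n) \<longleftrightarrow> linear_subspace n W"
  using vec_vs[of n, where 'a = complex]
  unfolding VectorSpace.subspace_def submodule_def linear_subspace_def vectorspace_def
  by (auto simp: module_vec_simps)

text \<open>
  Choose an injective \<open>B\<close> with columns in \<open>W\<close> and the largest possible number of columns, together
  with a left inverse. If its image missed a vector of \<open>W\<close>, then \<open>B\<close> could be enlarged by one column.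
  Representing subspaces in this way keeps subrepresentations within matrix representations.
\<close>

lemma linear_subspace_image:
  assumes W: "linear_subspace n W"
  obtains d B C where "B \<in> carrier_mat n d" "C \<in> carrier_mat d n" "C * B = 1\<^sub>m d"
    "W = (\<lambda>v. B *\<^sub>v v) ` carrier_vec d"
proof -
  define good where "good d \<longleftrightarrow> (\<exists>B C. B \<in> carrier_mat n d \<and> C \<in> carrier_mat d n \<and>
     C * B = 1\<^sub>m d \<and> (\<lambda>v. B *\<^sub>v v) ` carrier_vec d \<subseteq> W)" for d
  have Wc: "W \<subseteq> carrier_vec n" and W0: "0\<^sub>v n \<in> W" and Wadd: "\<And>v w. v \<in> W \<Longrightarrow> w \<in> W \<Longrightarrow> v + w \<in> W"
    and Ws: "\<And>c v. v \<in> W \<Longrightarrow> c \<cdot>\<^sub>v v \<in> W"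
    using W unfolding linear_subspace_def by auto
  have "good 0"
    unfolding good_def
  proof (intro exI conjI)
    show "0\<^sub>m n 0 \<in> carrier_mat n 0" "0\<^sub>m 0 n \<in> carrier_mat 0 n" by auto
    show "0\<^sub>m 0 n * 0\<^sub>m n 0 = (1\<^sub>m 0 :: complex mat)" by (intro eq_matI) auto
    have "0\<^sub>m n 0 *\<^sub>v v = 0\<^sub>v n" if "v \<in> carrier_vec 0" for v :: "complex vec"
      using that by (intro eq_vecI) (auto simp: scalar_prod_def)
    then show "(\<lambda>v. 0\<^sub>m n 0 *\<^sub>v v) ` carrier_vec 0 \<subseteq> W" using W0 by auto
  qed
  moreover have bound: "d \<le> n" if "good d" for d
    using that right_inverse_dim_le unfolding good_def by blast
  ultimately obtain d where d: "good d" "\<And>e. good e \<Longrightarrow> e \<le> d"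
    using ex_has_greatest_nat[of good 0 "\<lambda>d. d" "Suc n"] le_imp_less_Suc by blast
  then obtain B C where B: "B \<in> carrier_mat n d" and C: "C \<in> carrier_mat d n" and CB: "C * B = 1\<^sub>m d"
    and BW: "(\<lambda>v. B *\<^sub>v v) ` carrier_vec d \<subseteq> W"
    unfolding good_def by blast
  have "W \<subseteq> (\<lambda>v. B *\<^sub>v v) ` carrier_vec d"
  proof (rule ccontr)
    assume "\<not> ?thesis"
    then obtain w where w: "w \<in> W" "w \<notin> (\<lambda>v. B *\<^sub>v v) ` carrier_vec d" by blast
    then have wc: "w \<in> carrier_vec n" using Wc by blast
    define u where "u = w + (-1) \<cdot>\<^sub>v (B *\<^sub>v (C *\<^sub>v w))"
    have Cw: "C *\<^sub>v w \<in> carrier_vec d" using C wc by auto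
    have BCw: "B *\<^sub>v (C *\<^sub>v w) \<in> carrier_vec n" using B Cw by auto
    have uW: "u \<in> W" unfolding u_def using w(1) BW Cw by (auto intro!: Wadd Ws)
    have uc: "u \<in> carrier_vec n" using uW Wc by blast
    have "u \<noteq> 0\<^sub>v n"
    proof
      assume 0: "u = 0\<^sub>v n"
      have "w = B *\<^sub>v (C *\<^sub>v w)"
      proof (intro eq_vecI)
        fix i assume "i < dim_vec (B *\<^sub>v (C *\<^sub>v w))"
        then have i: "i < n" using B by auto
        have "u $ i = 0" using 0 i by simp
        then show "w $ i = (B *\<^sub>v (C *\<^sub>v w)) $ i" using i wc BCw B unfolding u_def by simp
      qed (use wc B in auto)
      then show False using w(2) Cw by blast
    qed
    then obtain i where i: "i < n" "u $ i \<noteq> 0"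
      using uc by (metis carrier_vecD dim_vec eq_vecI index_zero_vec(1) index_zero_vec(2))
    have Cu: "C *\<^sub>v u = 0\<^sub>v d"
    proof -
      have "C *\<^sub>v u = C *\<^sub>v w + C *\<^sub>v ((-1) \<cdot>\<^sub>v (B *\<^sub>v (C *\<^sub>v w)))"
        unfolding u_def using C wc BCw by (intro mult_add_distrib_mat_vec) auto
      also have "C *\<^sub>v ((-1) \<cdot>\<^sub>v (B *\<^sub>v (C *\<^sub>v w))) = (-1) \<cdot>\<^sub>v (C *\<^sub>v (B *\<^sub>v (C *\<^sub>v w)))"
        using C BCw by (rule mult_mat_vec)
      also have "C *\<^sub>v (B *\<^sub>v (C *\<^sub>v w)) = (C * B) *\<^sub>v (C *\<^sub>v w)"
        using C B Cw by (metis assoc_mult_mat_vec)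
      also have "\<dots> = C *\<^sub>v w" using CB Cw by simp
      finally show ?thesis using Cw C by (intro eq_vecI) auto
    qed
    \<comment> \<open>The new row extracts the \<open>i\<close>-th coordinate, normalised at \<open>u\<close> and corrected to vanish on
      the image of \<open>B\<close>.\<close>
    define r where "r j = (B * C) $$ (i, j)" for j
    define c where "c j = ((if i = j then 1 else 0) - r j) / u $ i" for j
    have cdef: "c j * z = ((if i = j then z else 0) - r j * z) / u $ i" for j z
      unfolding c_def by (simp add: field_simps)
    have BC: "B * C \<in> carrier_mat n n" using B C by auto
    have cu: "(\<Sum>j<n. c j * u $ j) = 1"
    proof -
      have "(\<Sum>j<n. r j * u $ j) = ((B * C) *\<^sub>v u) $ i"
        unfolding r_def using mat_vec_entry[OF BC uc i(1)] by simp
      also have "(B * C) *\<^sub>v u = B *\<^sub>v (C *\<^sub>v u)" using B C uc by (rule assoc_mult_mat_vec)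
      also have "\<dots> = 0\<^sub>v n" using B unfolding Cu by (intro eq_vecI) (auto simp: scalar_prod_def)
      finally have "(\<Sum>j<n. r j * u $ j) = 0" using i by simp
      then have "(\<Sum>j<n. (if i = j then u $ j else 0) - r j * u $ j) = u $ i"
        using i by (simp add: sum_subtractf)
      then show ?thesis using i by (simp add: cdef flip: sum_divide_distrib)
    qed
    have cB: "(\<Sum>j<n. c j * B $$ (j, l)) = 0" if l: "l < d" for l
    proof -
      have "(\<Sum>j<n. r j * B $$ (j, l)) = ((B * C) * B) $$ (i, l)"
        unfolding r_def using mat_mult_entry[OF BC B i(1) l] by simp
      also have "(B * C) * B = B * (C * B)" using B C B by (rule assoc_mult_mat)
      also have "\<dots> = B" using CB B by simp
      finally have "(\<Sum>j<n. (if i = j then B $$ (j, l) else 0) - r j * B $$ (j, l)) = 0"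
        using i by (simp add: sum_subtractf)
      then show ?thesis by (simp add: cdef flip: sum_divide_distrib)
    qed
    define B' where "B' = mat n (Suc d) (\<lambda>(a, b). if b < d then B $$ (a, b) else u $ a)"
    define C' where "C' = mat (Suc d) n (\<lambda>(a, b). if a < d then C $$ (a, b) else c b)"
    have B': "B' \<in> carrier_mat n (Suc d)" and C': "C' \<in> carrier_mat (Suc d) n"
      by (auto simp: B'_def C'_def)
    have "C' * B' = 1\<^sub>m (Suc d)"
    proof (intro eq_matI)
      fix a b assume "a < dim_row (1\<^sub>m (Suc d) :: complex mat)" "b < dim_col (1\<^sub>m (Suc d) :: complex mat)"
      then have ab: "a < Suc d" "b < Suc d" by auto
      have *: "(C' * B') $$ (a, b) = (\<Sum>j<n. C' $$ (a, j) * B' $$ (j, b))"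
        using mat_mult_entry[OF C' B' ab] .
      consider "a < d" "b < d" | "a < d" "b = d" | "a = d" "b < d" | "a = d" "b = d"
        using ab by linarith
      then show "(C' * B') $$ (a, b) = 1\<^sub>m (Suc d) $$ (a, b)"
      proof cases
        case 1
        have "(C' * B') $$ (a, b) = (C * B) $$ (a, b)"
          unfolding * mat_mult_entry[OF C B 1] using 1 by (intro sum.cong) (auto simp: B'_def C'_def)
        then show ?thesis using CB 1 by simp
      next
        case 2
        have "(C' * B') $$ (a, b) = (C *\<^sub>v u) $ a"
          unfolding * mat_vec_entry[OF C uc 2(1)] using 2 by (intro sum.cong) (auto simp: B'_def C'_def)
        then show ?thesis using Cu 2 by simp
      next
        case 3
        have "(C' * B') $$ (a, b) = (\<Sum>j<n. c j * B $$ (j, b))"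
          unfolding * using 3 by (intro sum.cong) (auto simp: B'_def C'_def)
        then show ?thesis using cB 3 by simp
      next
        case 4
        have "(C' * B') $$ (a, b) = (\<Sum>j<n. c j * u $ j)"
          unfolding * using 4 by (intro sum.cong) (auto simp: B'_def C'_def)
        then show ?thesis using cu 4 by simp
      qed
    qed (auto simp: B'_def C'_def)
    moreover have "(\<lambda>v. B' *\<^sub>v v) ` carrier_vec (Suc d) \<subseteq> W"
    proof (intro image_subsetI)
      fix v :: "complex vec" assume v: "v \<in> carrier_vec (Suc d)"
      define v' where "v' = vec d (\<lambda>a. v $ a)"
      have v': "v' \<in> carrier_vec d" by (simp add: v'_def)
      have Bv: "B *\<^sub>v v' \<in> W" using BW v' by blast
      have "B' *\<^sub>v v = B *\<^sub>v v' + (v $ d) \<cdot>\<^sub>v u"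
      proof (intro eq_vecI)
        fix a assume "a < dim_vec (B *\<^sub>v v' + (v $ d) \<cdot>\<^sub>v u)"
        then have a: "a < n" using uc by auto
        have "(B' *\<^sub>v v) $ a = (\<Sum>k<d. B $$ (a, k) * v $ k) + u $ a * v $ d"
          using a by (subst mat_vec_entry[OF B' v a]) (auto simp: B'_def)
        also have "(\<Sum>k<d. B $$ (a, k) * v $ k) = (B *\<^sub>v v') $ a"
          unfolding mat_vec_entry[OF B v' a] by (auto simp: v'_def)
        finally show "(B' *\<^sub>v v) $ a = (B *\<^sub>v v' + (v $ d) \<cdot>\<^sub>v u) $ a"
          using a uc B v' by (simp add: mult.commute)
      qed (use B' uc in auto)
      then show "B' *\<^sub>v v \<in> W" using Wadd Ws Bv uW by simp
    qed
    ultimately have "good (Suc d)" unfolding good_def using B' C' by blast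
    then show False using d(2) by fastforce
  qed
  then show ?thesis using that B C CB BW by blast
qed


section \<open>Schur's lemma and complete reducibility\<close>

lemma smult_one_mult_vec:
  assumes "v \<in> carrier_vec n"
  shows "(c \<cdot>\<^sub>m 1\<^sub>m n) *\<^sub>v v = c \<cdot>\<^sub>v (v :: complex vec)"
proof (intro eq_vecI)
  fix i assume "i < dim_vec (c \<cdot>\<^sub>v v)"
  then have i: "i < n" using assms by simp
  have "(\<Sum>k<n. (c \<cdot>\<^sub>m 1\<^sub>m n) $$ (i, k) * v $ k) = (\<Sum>k<n. if i = k then c * v $ i else 0)"
    using i by (intro sum.cong) auto
  then show "((c \<cdot>\<^sub>m 1\<^sub>m n) *\<^sub>v v) $ i = (c \<cdot>\<^sub>v v) $ i"
    using i assms by (subst mat_vec_entry[of _ n n]) auto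
qed (use assms in auto)

lemma representation_iff:
  fixes G (structure)
  assumes "group G"
  shows "representation G n \<rho> \<longleftrightarrow> (\<forall>g\<in>carrier G. \<rho> g \<in> carrier_mat n n) \<and>
     (\<forall>g\<in>carrier G. \<forall>h\<in>carrier G. \<rho> (g \<otimes> h) = \<rho> g * \<rho> h) \<and> \<rho> \<one> = 1\<^sub>m n"
proof -
  interpret group G by fact
  have units: "carrier (GL n) = {A \<in> carrier_mat n n. \<exists>B\<in>carrier_mat n n. B * A = 1\<^sub>m n \<and> A * B = 1\<^sub>m n}"
    by (auto simp: units_of_def Units_def ring_mat_simps)
  have mult: "(\<otimes>\<^bsub>GL n\<^esub>) = (*)" by (simp add: units_of_def ring_mat_simps)
  show ?thesis
  proof
    assume *: "representation G n \<rho>"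
    have "monoid (ring_mat TYPE(complex) n ())"
      using semiring_mat by (rule semiring.axioms(2))
    then have "group (GL n)" by (rule monoid.units_group)
    then have "\<rho> \<one> = \<one>\<^bsub>GL n\<^esub>"
      using * is_group unfolding representation_def by (metis hom_one)
    then have "\<rho> \<one> = 1\<^sub>m n" by (simp only: units_of_one ring_mat_simps)
    then show "(\<forall>g\<in>carrier G. \<rho> g \<in> carrier_mat n n) \<and>
      (\<forall>g\<in>carrier G. \<forall>h\<in>carrier G. \<rho> (g \<otimes> h) = \<rho> g * \<rho> h) \<and> \<rho> \<one> = 1\<^sub>m n"
      using * unfolding representation_def hom_def mult by (auto simp: units)
  next
    assume *: "(\<forall>g\<in>carrier G. \<rho> g \<in> carrier_mat n n) \<and>
      (\<forall>g\<in>carrier G. \<forall>h\<in>carrier G. \<rho> (g \<otimes> h) = \<rho> g * \<rho> h) \<and> \<rho> \<one> = 1\<^sub>m n"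
    have "\<rho> g \<in> carrier (GL n)" if g: "g \<in> carrier G" for g
    proof -
      have "\<rho> (inv g) * \<rho> g = 1\<^sub>m n" "\<rho> g * \<rho> (inv g) = 1\<^sub>m n"
        using * g by (metis inv_closed l_inv, metis inv_closed r_inv)
      then show ?thesis unfolding units using * g by (auto intro!: bexI[of _ "\<rho> (inv g)"])
    qed
    then show "representation G n \<rho>"
      using * unfolding representation_def hom_def mult by auto
  qed
qed

locale fin_group = group G for G (structure) +
  assumes fin [simp]: "finite (carrier G)"
begin

abbreviation ord_G :: complex where "ord_G \<equiv> of_nat (card (carrier G))"

lemma ord_G_nonzero [simp]: "ord_G \<noteq> 0" "card (carrier G) \<noteq> 0"
  using one_closed by auto

lemma rep_iff:
  "representation G n \<rho> \<longleftrightarrow> (\<forall>g\<in>carrier G. \<rho> g \<in> carrier_mat n n) \<and>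
     (\<forall>g\<in>carrier G. \<forall>h\<in>carrier G. \<rho> (g \<otimes> h) = \<rho> g * \<rho> h) \<and> \<rho> \<one> = 1\<^sub>m n"
  by (rule representation_iff[OF is_group])

lemma repD:
  assumes "representation G n \<rho>"
  shows "g \<in> carrier G \<Longrightarrow> \<rho> g \<in> carrier_mat n n"
    "g \<in> carrier G \<Longrightarrow> h \<in> carrier G \<Longrightarrow> \<rho> (g \<otimes> h) = \<rho> g * \<rho> h"
    "\<rho> \<one> = 1\<^sub>m n"
  using assms by (auto simp: rep_iff)

lemma rep_inv:
  assumes "representation G n \<rho>" "g \<in> carrier G"
  shows "\<rho> g * \<rho> (inv g) = 1\<^sub>m n" "\<rho> (inv g) * \<rho> g = 1\<^sub>m n"
  using repD[OF assms(1)] assms(2) by (metis inv_closed r_inv, metis inv_closed l_inv)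

lemma rep_det_nonzero:
  assumes "representation G n \<rho>" "g \<in> carrier G"
  shows "det (\<rho> g) \<noteq> 0"
  using invertible_of_right_inverse(2)[of "\<rho> g" n "\<rho> (inv g)"] repD[OF assms(1)] rep_inv[OF assms] assms(2)
  by auto

lemma rep_pow:
  assumes "representation G n \<rho>" "g \<in> carrier G"
  shows "\<rho> (g [^] (k::nat)) = \<rho> g ^\<^sub>m k"
proof (induction k)
  case 0
  show ?case using repD[OF assms(1)] assms(2) by (metis carrier_matD(1) nat_pow_0 pow_mat.simps(1))
next
  case (Suc k)
  then show ?case using repD[OF assms(1)] assms(2) by (simp add: nat_pow_Suc)
qed

lemma irr_rep: "irreducible_representation G n \<rho> \<Longrightarrow> representation G n \<rho>"
  and irr_pos: "irreducible_representation G n \<rho> \<Longrightarrow> 0 < n"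
  by (auto simp: irreducible_representation_def)

lemma irrD:
  assumes "irreducible_representation G n \<rho>" "linear_subspace n W"
    "\<And>g w. g \<in> carrier G \<Longrightarrow> w \<in> W \<Longrightarrow> \<rho> g *\<^sub>v w \<in> W"
  shows "W = {0\<^sub>v n} \<or> W = carrier_vec n"
  using assms unfolding irreducible_representation_def invariant_subspace_def subspace_iff_linear_subspace
  by blast

text \<open>
  Kernel and image of \<open>X\<close> are invariant, so \<open>X\<close> is zero or bijective, and a two-sided inverse can only
  exist between spaces of equal dimension.
\<close>

lemma intertwiner_zero_or_invertible:
  assumes \<rho>: "irreducible_representation G n \<rho>" and \<sigma>: "irreducible_representation G m \<sigma>"
    and X: "X \<in> carrier_mat n m" and int: "\<And>g. g \<in> carrier G \<Longrightarrow> \<rho> g * X = X * \<sigma> g"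
  shows "X = 0\<^sub>m n m \<or> n = m \<and> det X \<noteq> 0"
proof (cases "X = 0\<^sub>m n m")
  case False
  note \<rho>D = repD[OF irr_rep[OF \<rho>]] and \<sigma>D = repD[OF irr_rep[OF \<sigma>]]
  define K where "K = {v \<in> carrier_vec m. X *\<^sub>v v = 0\<^sub>v n}"
  define I where "I = (\<lambda>v. X *\<^sub>v v) ` carrier_vec m"
  have "linear_subspace m K"
    unfolding linear_subspace_def K_def using X
    by (auto simp: mult_add_distrib_mat_vec[of _ n m] mult_mat_vec[of _ n m])
  moreover have "\<sigma> g *\<^sub>v w \<in> K" if g: "g \<in> carrier G" and w: "w \<in> K" for g w
  proof -
    have wc: "w \<in> carrier_vec m" using w by (simp add: K_def)
    have "X *\<^sub>v (\<sigma> g *\<^sub>v w) = (X * \<sigma> g) *\<^sub>v w"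
      using X \<sigma>D(1)[OF g] wc by (metis assoc_mult_mat_vec)
    also have "\<dots> = \<rho> g *\<^sub>v (X *\<^sub>v w)"
      using X \<rho>D(1)[OF g] wc int[OF g] by (metis assoc_mult_mat_vec)
    also have "\<dots> = 0\<^sub>v n" using w \<rho>D(1)[OF g] by (auto simp: K_def)
    finally show ?thesis using \<sigma>D(1)[OF g] wc by (auto simp: K_def)
  qed
  ultimately have "K = {0\<^sub>v m} \<or> K = carrier_vec m" by (rule irrD[OF \<sigma>])
  moreover have "K \<noteq> carrier_vec m"
  proof
    assume "K = carrier_vec m"
    then have "X = 0\<^sub>m n m"
      using X by (intro mat_eq_zero_if_kills_vectors) (auto simp: K_def)
    then show False using False by simp
  qed
  ultimately have K: "K = {0\<^sub>v m}" by blast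
  have "linear_subspace n I"
    unfolding linear_subspace_def
  proof (intro conjI ballI allI)
    show "I \<subseteq> carrier_vec n" unfolding I_def using X by auto
    have "0\<^sub>v n = X *\<^sub>v 0\<^sub>v m" using X by auto
    then show "0\<^sub>v n \<in> I" unfolding I_def by (metis imageI zero_carrier_vec)
  next
    fix v w assume "v \<in> I" "w \<in> I"
    then obtain v' w' where *: "v' \<in> carrier_vec m" "w' \<in> carrier_vec m" "v = X *\<^sub>v v'" "w = X *\<^sub>v w'"
      unfolding I_def by auto
    then have eq: "v + w = X *\<^sub>v (v' + w')" using mult_add_distrib_mat_vec[OF X] by simp
    show "v + w \<in> I" unfolding I_def eq using *(1,2) by (intro imageI) simp
  next
    fix c v assume "v \<in> I"
    then obtain v' where *: "v' \<in> carrier_vec m" "v = X *\<^sub>v v'" unfolding I_def by auto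
    then have eq: "c \<cdot>\<^sub>v v = X *\<^sub>v (c \<cdot>\<^sub>v v')" using mult_mat_vec[OF X] by simp
    show "c \<cdot>\<^sub>v v \<in> I" unfolding I_def eq using *(1) by (intro imageI) simp
  qed
  moreover have "\<rho> g *\<^sub>v w \<in> I" if g: "g \<in> carrier G" and w: "w \<in> I" for g w
  proof -
    obtain v where v: "v \<in> carrier_vec m" "w = X *\<^sub>v v" using w unfolding I_def by auto
    have "\<rho> g *\<^sub>v w = (\<rho> g * X) *\<^sub>v v" unfolding v(2) using X \<rho>D(1)[OF g] v(1) by (metis assoc_mult_mat_vec)
    also have "\<dots> = X *\<^sub>v (\<sigma> g *\<^sub>v v)" unfolding int[OF g] using X \<sigma>D(1)[OF g] v(1) by (metis assoc_mult_mat_vec)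
    finally show ?thesis unfolding I_def using \<sigma>D(1)[OF g] v(1) by auto
  qed
  ultimately have "I = {0\<^sub>v n} \<or> I = carrier_vec n" by (rule irrD[OF \<rho>])
  moreover have "I \<noteq> {0\<^sub>v n}"
  proof
    assume "I = {0\<^sub>v n}"
    then have "X = 0\<^sub>m n m"
      using X by (intro mat_eq_zero_if_kills_vectors) (auto simp: I_def)
    then show False using False by simp
  qed
  ultimately have I: "I = carrier_vec n" by blast
  have "\<exists>y. y \<in> carrier_vec m \<and> X *\<^sub>v y = unit_vec n j" for j
  proof -
    have "unit_vec n j \<in> I" unfolding I by simp
    then show ?thesis unfolding I_def by (auto simp: image_iff)
  qed
  then obtain y where y: "\<And>j. y j \<in> carrier_vec m" "\<And>j. X *\<^sub>v y j = unit_vec n j" by metis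
  define Y where "Y = mat m n (\<lambda>(i, j). y j $ i)"
  have Y: "Y \<in> carrier_mat m n" by (simp add: Y_def)
  have XY: "X * Y = 1\<^sub>m n"
  proof (intro eq_matI)
    fix i j assume "i < dim_row (1\<^sub>m n :: complex mat)" "j < dim_col (1\<^sub>m n :: complex mat)"
    then have ij: "i < n" "j < n" by auto
    have "(X * Y) $$ (i, j) = (X *\<^sub>v y j) $ i"
      using ij unfolding mat_mult_entry[OF X Y ij] mat_vec_entry[OF X y(1) ij(1)] by (simp add: Y_def)
    then show "(X * Y) $$ (i, j) = 1\<^sub>m n $$ (i, j)" using y(2) ij by (auto simp: unit_vec_def)
  qed (use X Y in auto)
  have YX: "Y * X = 1\<^sub>m m"
  proof (rule mat_eqI_vec[of _ m m])
    fix v :: "complex vec" assume v: "v \<in> carrier_vec m"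
    have c: "(Y * X) *\<^sub>v v \<in> carrier_vec m" using Y X v by auto
    have "X *\<^sub>v ((Y * X) *\<^sub>v v) = (X * (Y * X)) *\<^sub>v v" using X Y v by (metis assoc_mult_mat_vec mult_carrier_mat)
    also have "X * (Y * X) = (X * Y) * X" using X Y X by (rule assoc_mult_mat[symmetric])
    also have "\<dots> = X" using XY X by simp
    finally have "X *\<^sub>v ((Y * X) *\<^sub>v v - v) = 0\<^sub>v n"
      using c v X by (simp add: mult_minus_distrib_mat_vec[of _ n m])
    then have "(Y * X) *\<^sub>v v - v \<in> K" using c v unfolding K_def by auto
    then have z: "(Y * X) *\<^sub>v v - v = 0\<^sub>v m" using K by simp
    show "(Y * X) *\<^sub>v v = 1\<^sub>m m *\<^sub>v v"
    proof (intro eq_vecI)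
      fix i assume "i < dim_vec (1\<^sub>m m *\<^sub>v v)"
      then have "i < m" by simp
      then have "((Y * X) *\<^sub>v v - v) $ i = 0" unfolding z by simp
      then show "((Y * X) *\<^sub>v v) $ i = (1\<^sub>m m *\<^sub>v v) $ i" using v \<open>i < m\<close> by simp
    qed (use Y in simp)
  qed (use X Y in auto)
  have "n = m" using right_inverse_dim_le[OF X Y XY] right_inverse_dim_le[OF Y X YX] by simp
  then show ?thesis using invertible_of_right_inverse(2)[of X n Y] X Y XY by simp
qed simp

text \<open>
  Subtracting an eigenvalue from \<open>X\<close> gives a singular intertwiner, which must vanish.
\<close>

theorem schur_scalar:
  assumes \<rho>: "irreducible_representation G n \<rho>" and X: "X \<in> carrier_mat n n"
    and int: "\<And>g. g \<in> carrier G \<Longrightarrow> \<rho> g * X = X * \<rho> g"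
  obtains c where "X = c \<cdot>\<^sub>m 1\<^sub>m n"
proof -
  have "degree (char_poly X) = n" using degree_monic_char_poly[OF X] by simp
  then have "\<not> constant (poly (char_poly X))" using irr_pos[OF \<rho>] constant_degree by (metis less_numeral_extra(3))
  then obtain c where "poly (char_poly X) c = 0" using fundamental_theorem_of_algebra by blast
  then have "eigenvalue X c" using eigenvalue_root_char_poly[OF X] by simp
  then have det: "det (char_matrix X c) = 0" using eigenvalue_det[OF X] by simp
  define Z where "Z = char_matrix X c"
  have Z: "Z = X + (-c) \<cdot>\<^sub>m 1\<^sub>m n" using X unfolding Z_def char_matrix_def by auto
  have Zc: "Z \<in> carrier_mat n n" unfolding Z using X by simp
  have "\<rho> g * Z = Z * \<rho> g" if g: "g \<in> carrier G" for g
  proof -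
    have r: "\<rho> g \<in> carrier_mat n n" using repD[OF irr_rep[OF \<rho>]] g by blast
    have "\<rho> g * Z = \<rho> g * X + \<rho> g * ((-c) \<cdot>\<^sub>m 1\<^sub>m n)"
      unfolding Z using r X by (intro mult_add_distrib_mat) auto
    also have "\<dots> = X * \<rho> g + ((-c) \<cdot>\<^sub>m 1\<^sub>m n) * \<rho> g"
      using int[OF g] mult_smult_one[OF r] by simp
    also have "\<dots> = Z * \<rho> g"
      unfolding Z using r X by (intro add_mult_distrib_mat[symmetric]) auto
    finally show ?thesis .
  qed
  then have "Z = 0\<^sub>m n n \<or> n = n \<and> det Z \<noteq> 0"
    by (intro intertwiner_zero_or_invertible[OF \<rho> \<rho> Zc])
  then have "Z = 0\<^sub>m n n" using det Z_def by simp
  then have *: "\<And>i j. i < n \<Longrightarrow> j < n \<Longrightarrow> Z $$ (i, j) = 0" by simp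
  have "X = c \<cdot>\<^sub>m 1\<^sub>m n"
  proof (intro eq_matI)
    fix i j assume "i < dim_row (c \<cdot>\<^sub>m 1\<^sub>m n)" "j < dim_col (c \<cdot>\<^sub>m 1\<^sub>m n)"
    then have ij: "i < n" "j < n" by auto
    then have "X $$ (i, j) + (- c) * 1\<^sub>m n $$ (i, j) = 0"
      using *[OF ij] X unfolding Z by simp
    then show "X $$ (i, j) = (c \<cdot>\<^sub>m 1\<^sub>m n) $$ (i, j)" using ij by (simp add: eq_neg_iff_add_eq_0)
  qed (use X in auto)
  then show ?thesis using that by blast
qed

lemma average_intertwines:
  assumes \<rho>: "representation G n \<rho>" and \<sigma>: "representation G m \<sigma>" and X: "X \<in> carrier_mat n m"
    and h: "h \<in> carrier G"
  shows "\<rho> h * mat_sum n m (\<lambda>g. \<rho> g * X * \<sigma> (inv g)) (carrier G) =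
    mat_sum n m (\<lambda>g. \<rho> g * X * \<sigma> (inv g)) (carrier G) * \<sigma> h"
proof -
  note \<rho>D = repD[OF \<rho>] and \<sigma>D = repD[OF \<sigma>]
  have cl: "\<rho> g * X * \<sigma> (inv g) \<in> carrier_mat n m" if "g \<in> carrier G" for g
    using that \<rho>D(1) \<sigma>D(1) X by (meson inv_closed mult_carrier_mat)
  have bij: "bij_betw (\<lambda>g. h \<otimes> g) (carrier G) (carrier G)"
    using h by (intro bij_betwI[where g = "\<lambda>g. inv h \<otimes> g"]) (auto simp: m_assoc[symmetric])
  have eq: "\<rho> h * (\<rho> g * X * \<sigma> (inv g)) = (\<rho> (h \<otimes> g) * X * \<sigma> (inv (h \<otimes> g))) * \<sigma> h"
    if g: "g \<in> carrier G" for g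
  proof -
    have 1: "\<sigma> (inv (h \<otimes> g)) * \<sigma> h = \<sigma> (inv g)"
      using \<sigma>D(2)[of "inv (h \<otimes> g)" h] g h by (simp add: inv_mult_group m_assoc)
    have c: "\<rho> h \<in> carrier_mat n n" "\<rho> g \<in> carrier_mat n n" "\<sigma> (inv g) \<in> carrier_mat m m"
      "\<sigma> (inv (h \<otimes> g)) \<in> carrier_mat m m" "\<sigma> h \<in> carrier_mat m m" "\<rho> (h \<otimes> g) * X \<in> carrier_mat n m"
      using \<rho>D(1) \<sigma>D(1) g h X by (auto intro!: mult_carrier_mat)
    have "(\<rho> (h \<otimes> g) * X * \<sigma> (inv (h \<otimes> g))) * \<sigma> h = \<rho> (h \<otimes> g) * X * \<sigma> (inv g)"
      using assoc_mult_mat[OF c(6,4,5)] 1 by simp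
    also have "\<dots> = \<rho> h * (\<rho> g * X) * \<sigma> (inv g)"
      using \<rho>D(2)[OF h g] assoc_mult_mat[OF c(1,2) X] by simp
    also have "\<dots> = \<rho> h * (\<rho> g * X * \<sigma> (inv g))"
      using c X by (intro assoc_mult_mat) auto
    finally show ?thesis by simp
  qed
  have "\<rho> h * mat_sum n m (\<lambda>g. \<rho> g * X * \<sigma> (inv g)) (carrier G) =
    mat_sum n m (\<lambda>g. \<rho> h * (\<rho> g * X * \<sigma> (inv g))) (carrier G)"
    using h \<rho>D(1) cl by (intro mult_mat_sum) auto
  also have "\<dots> = mat_sum n m (\<lambda>g. (\<rho> (h \<otimes> g) * X * \<sigma> (inv (h \<otimes> g))) * \<sigma> h) (carrier G)"
    by (intro mat_sum_cong eq)
  also have "\<dots> = mat_sum n m (\<lambda>g. (\<rho> g * X * \<sigma> (inv g)) * \<sigma> h) (carrier G)"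
    by (rule mat_sum_reindex[OF bij, where F = "\<lambda>g. (\<rho> g * X * \<sigma> (inv g)) * \<sigma> h"])
  also have "\<dots> = mat_sum n m (\<lambda>g. \<rho> g * X * \<sigma> (inv g)) (carrier G) * \<sigma> h"
    using h \<sigma>D(1) cl by (intro mat_sum_mult[symmetric]) auto
  finally show ?thesis .
qed

text \<open>
  Maschke: averaging a linear projection onto an invariant subspace over the group gives an
  equivariant one. The matrix \<open>B\<close> identifies the subspace with \<open>\<complex>\<^sup>d\<close>, on which \<open>G\<close> acts by \<open>A\<close>.
\<close>

lemma maschke:
  assumes \<sigma>: "representation G n \<sigma>" and W: "linear_subspace n W"
    and inv: "\<And>g w. g \<in> carrier G \<Longrightarrow> w \<in> W \<Longrightarrow> \<sigma> g *\<^sub>v w \<in> W"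
  obtains B d C A E where "B \<in> carrier_mat n d" "C \<in> carrier_mat d n" "C * B = 1\<^sub>m d"
    "W = (\<lambda>v. B *\<^sub>v v) ` carrier_vec d" "representation G d A"
    "\<And>g. g \<in> carrier G \<Longrightarrow> \<sigma> g * B = B * A g"
    "E \<in> carrier_mat n n" "E * B = B" "\<And>v. v \<in> carrier_vec n \<Longrightarrow> E *\<^sub>v v \<in> W"
    "\<And>g. g \<in> carrier G \<Longrightarrow> \<sigma> g * E = E * \<sigma> g"
proof -
  note \<sigma>D = repD[OF \<sigma>]
  obtain d B C where B: "B \<in> carrier_mat n d" and C: "C \<in> carrier_mat d n" and CB: "C * B = 1\<^sub>m d"
    and WB: "W = (\<lambda>v. B *\<^sub>v v) ` carrier_vec d"
    using linear_subspace_image[OF W] .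
  define A where "A g = C * (\<sigma> g * B)" for g
  have Ac: "A g \<in> carrier_mat d d" if "g \<in> carrier G" for g
    unfolding A_def using that \<sigma>D(1) B C by (meson mult_carrier_mat)
  have \<sigma>B: "\<sigma> g * B = B * A g" if g: "g \<in> carrier G" for g
  proof (rule mat_eqI_vec[of _ n d])
    fix v :: "complex vec" assume v: "v \<in> carrier_vec d"
    have s: "\<sigma> g \<in> carrier_mat n n" using \<sigma>D g by blast
    have sB: "\<sigma> g * B \<in> carrier_mat n d" using s B by simp
    have "(\<sigma> g * B) *\<^sub>v v \<in> W"
      using inv[OF g, of "B *\<^sub>v v"] v assoc_mult_mat_vec[OF s B v] unfolding WB by simp
    then obtain u where u: "u \<in> carrier_vec d" "(\<sigma> g * B) *\<^sub>v v = B *\<^sub>v u" unfolding WB by auto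
    have "(B * A g) *\<^sub>v v = B *\<^sub>v (A g *\<^sub>v v)" using B Ac[OF g] v by (rule assoc_mult_mat_vec)
    also have "A g *\<^sub>v v = C *\<^sub>v ((\<sigma> g * B) *\<^sub>v v)" unfolding A_def using C sB v by (rule assoc_mult_mat_vec)
    also have "\<dots> = (C * B) *\<^sub>v u" unfolding u(2) using C B u(1) by (rule assoc_mult_mat_vec[symmetric])
    also have "\<dots> = u" using CB u(1) by simp
    finally show "(\<sigma> g * B) *\<^sub>v v = (B * A g) *\<^sub>v v" using u(2) by simp
  next
    show "\<sigma> g * B \<in> carrier_mat n d" "B * A g \<in> carrier_mat n d"
      using mult_carrier_mat[OF \<sigma>D(1)[OF g] B] mult_carrier_mat[OF B Ac[OF g]] .
  qed
  have A: "representation G d A"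
    unfolding rep_iff
  proof (intro conjI ballI)
    show "A g \<in> carrier_mat d d" if "g \<in> carrier G" for g by (rule Ac[OF that])
    show "A \<one> = 1\<^sub>m d" unfolding A_def using \<sigma>D(3) B CB by simp
    fix g h assume gh: "g \<in> carrier G" "h \<in> carrier G"
    have s: "\<sigma> g \<in> carrier_mat n n" "\<sigma> h \<in> carrier_mat n n" using \<sigma>D gh by auto
    have "A (g \<otimes> h) = C * (\<sigma> g * (\<sigma> h * B))"
      unfolding A_def \<sigma>D(2)[OF gh] using assoc_mult_mat[OF s B] by simp
    also have "\<sigma> g * (\<sigma> h * B) = (\<sigma> g * B) * A h"
      unfolding \<sigma>B[OF gh(2)] using s(1) B Ac[OF gh(2)] by (rule assoc_mult_mat[symmetric])
    also have "C * ((\<sigma> g * B) * A h) = A g * A h"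
      unfolding A_def[of g] using C s(1) B Ac[OF gh(2)] by (intro assoc_mult_mat[symmetric]) auto
    finally show "A (g \<otimes> h) = A g * A h" .
  qed
  define C' where "C' = (1 / ord_G) \<cdot>\<^sub>m mat_sum d n (\<lambda>g. A g * C * \<sigma> (inv g)) (carrier G)"
  have C': "C' \<in> carrier_mat d n" unfolding C'_def by simp
  define E where "E = B * C'"
  have E: "E \<in> carrier_mat n n" using B C' unfolding E_def by simp
  have cl: "A g * C * \<sigma> (inv g) \<in> carrier_mat d n" if "g \<in> carrier G" for g
    using that Ac \<sigma>D(1) C by (meson inv_closed mult_carrier_mat)
  have "C' * B = (1 / ord_G) \<cdot>\<^sub>m mat_sum d d (\<lambda>g. A g * C * \<sigma> (inv g) * B) (carrier G)"
    unfolding C'_def using B cl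
    by (subst mult_smult_assoc_mat[of _ d n _ d]) (auto simp: mat_sum_mult)
  also have "mat_sum d d (\<lambda>g. A g * C * \<sigma> (inv g) * B) (carrier G) = mat_sum d d (\<lambda>g. 1\<^sub>m d) (carrier G)"
  proof (intro mat_sum_cong)
    fix g assume g: "g \<in> carrier G"
    have s: "\<sigma> (inv g) \<in> carrier_mat n n" and a: "A (inv g) \<in> carrier_mat d d" using \<sigma>D(1) Ac g by auto
    have AC: "A g * C \<in> carrier_mat d n" using Ac[OF g] C by simp
    have "A g * C * \<sigma> (inv g) * B = A g * C * (B * A (inv g))"
      using assoc_mult_mat[OF AC s B] \<sigma>B[of "inv g"] g by simp
    also have "\<dots> = A g * C * B * A (inv g)" using AC B a by (rule assoc_mult_mat[symmetric])
    also have "A g * C * B = A g" using assoc_mult_mat[OF Ac[OF g] C B] CB Ac[OF g] by simp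
    also have "A g * A (inv g) = 1\<^sub>m d" using rep_inv[OF A g] by simp
    finally show "A g * C * \<sigma> (inv g) * B = 1\<^sub>m d" .
  qed
  also have "(1 / ord_G) \<cdot>\<^sub>m \<dots> = 1\<^sub>m d"
    by (subst mat_sum_const[of _ d d]) (auto simp: smult_smult_mat one_smult_mat)
  finally have C'B: "C' * B = 1\<^sub>m d" .
  have EB: "E * B = B" unfolding E_def using assoc_mult_mat[OF B C' B] C'B B by simp
  have EW: "E *\<^sub>v v \<in> W" if v: "v \<in> carrier_vec n" for v
    unfolding E_def WB assoc_mult_mat_vec[OF B C' v] using C' v by simp
  have "E = (1 / ord_G) \<cdot>\<^sub>m mat_sum n n (\<lambda>g. \<sigma> g * (B * C) * \<sigma> (inv g)) (carrier G)"
  proof -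
    have "E = (1 / ord_G) \<cdot>\<^sub>m (B * mat_sum d n (\<lambda>g. A g * C * \<sigma> (inv g)) (carrier G))"
      unfolding E_def C'_def using B by (intro mult_smult_distrib[of _ n d _ n]) auto
    also have "B * mat_sum d n (\<lambda>g. A g * C * \<sigma> (inv g)) (carrier G) =
        mat_sum n n (\<lambda>g. B * (A g * C * \<sigma> (inv g))) (carrier G)"
      using B cl by (intro mult_mat_sum) auto
    also have "\<dots> = mat_sum n n (\<lambda>g. \<sigma> g * (B * C) * \<sigma> (inv g)) (carrier G)"
    proof (intro mat_sum_cong)
      fix g assume g: "g \<in> carrier G"
      have s: "\<sigma> (inv g) \<in> carrier_mat n n" "\<sigma> g \<in> carrier_mat n n" using \<sigma>D(1) g by auto
      have AC: "A g * C \<in> carrier_mat d n" using Ac[OF g] C by simp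
      have "B * (A g * C * \<sigma> (inv g)) = B * (A g * C) * \<sigma> (inv g)"
        using B AC s(1) by (rule assoc_mult_mat[symmetric])
      also have "B * (A g * C) = \<sigma> g * B * C"
        unfolding \<sigma>B[OF g] using B Ac[OF g] C by (rule assoc_mult_mat[symmetric])
      also have "\<dots> = \<sigma> g * (B * C)" using s(2) B C by (rule assoc_mult_mat)
      finally show "B * (A g * C * \<sigma> (inv g)) = \<sigma> g * (B * C) * \<sigma> (inv g)" .
    qed
    finally show ?thesis .
  qed
  then have comm: "\<sigma> g * E = E * \<sigma> g" if g: "g \<in> carrier G" for g
    using average_intertwines[OF \<sigma> \<sigma> _ g, of "B * C"] B C \<sigma>D(1)[OF g]
    by (simp add: mult_smult_distrib[of _ n n _ n] mult_smult_assoc_mat[of _ n n _ n])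
  show ?thesis using that[OF B C CB WB A \<sigma>B E EB EW comm] by blast
qed

text \<open>
  The converse of Schur's lemma: the equivariant projection onto an invariant subspace is a scalar,
  hence zero or the identity. It reduces later proofs of irreducibility to matrix identities.
\<close>

lemma irreducible_if_commutant_scalar:
  assumes \<sigma>: "representation G n \<sigma>" and n: "0 < n"
    and comm: "\<And>E. E \<in> carrier_mat n n \<Longrightarrow> (\<And>g. g \<in> carrier G \<Longrightarrow> \<sigma> g * E = E * \<sigma> g) \<Longrightarrow>
      \<exists>c. E = c \<cdot>\<^sub>m 1\<^sub>m n"
  shows "irreducible_representation G n \<sigma>"
  unfolding irreducible_representation_def
proof (intro conjI allI impI \<sigma> n)
  fix W assume "invariant_subspace G n \<sigma> W"
  then have W: "linear_subspace n W" and inv: "\<And>g w. g \<in> carrier G \<Longrightarrow> w \<in> W \<Longrightarrow> \<sigma> g *\<^sub>v w \<in> W"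
    unfolding invariant_subspace_def subspace_iff_linear_subspace by auto
  obtain B d C A E where m: "B \<in> carrier_mat n d" "C \<in> carrier_mat d n" "C * B = 1\<^sub>m d"
    "W = (\<lambda>v. B *\<^sub>v v) ` carrier_vec d" "representation G d A"
    "\<And>g. g \<in> carrier G \<Longrightarrow> \<sigma> g * B = B * A g"
    "E \<in> carrier_mat n n" "E * B = B" "\<And>v. v \<in> carrier_vec n \<Longrightarrow> E *\<^sub>v v \<in> W"
    "\<And>g. g \<in> carrier G \<Longrightarrow> \<sigma> g * E = E * \<sigma> g"
    by (rule maschke[OF \<sigma> W inv]) (assumption | blast)+
  obtain c where c: "E = c \<cdot>\<^sub>m 1\<^sub>m n" using comm[OF m(7,10)] by blast
  show "W = {0\<^sub>v n} \<or> W = carrier_vec n"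
  proof (cases "W = {0\<^sub>v n}")
    case False
    moreover have W0: "0\<^sub>v n \<in> W" "W \<subseteq> carrier_vec n" using W unfolding linear_subspace_def by auto
    ultimately obtain w where w: "w \<in> W" "w \<noteq> 0\<^sub>v n" by blast
    then have wc: "w \<in> carrier_vec n" using W0 by blast
    obtain u where u: "u \<in> carrier_vec d" "w = B *\<^sub>v u" using w(1) m(4) by auto
    have "E *\<^sub>v w = w" unfolding u(2) using assoc_mult_mat_vec[OF m(7,1) u(1)] m(8) by simp
    then have cw: "c \<cdot>\<^sub>v w = w" unfolding c using wc by (simp add: smult_one_mult_vec)
    obtain i where i: "i < n" "w $ i \<noteq> 0"
      using w(2) wc by (metis carrier_vecD dim_vec eq_vecI index_zero_vec(1) index_zero_vec(2))
    have "(c \<cdot>\<^sub>v w) $ i = w $ i" using cw by simp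
    then have "c = 1" using i wc by simp
    then have "E = 1\<^sub>m n" using c by (simp add: one_smult_mat)
    then have "v \<in> W" if "v \<in> carrier_vec n" for v using m(9)[OF that] that by simp
    then show ?thesis using W0 by blast
  qed simp
qed

end


section \<open>Orthogonality and the sum of the squared degrees\<close>

context fin_group
begin

lemma bij_inv: "bij_betw (\<lambda>g. inv g) (carrier G) (carrier G)"
  by (intro bij_betwI[where g = "\<lambda>g. inv g"]) auto

text \<open>
  The average is a scalar by Schur's lemma, and its trace determines which one.
\<close>

lemma average_scalar:
  assumes \<rho>: "irreducible_representation G n \<rho>" and X: "X \<in> carrier_mat n n"
  shows "mat_sum n n (\<lambda>g. \<rho> g * X * \<rho> (inv g)) (carrier G) = (ord_G * mat_trace X / of_nat n) \<cdot>\<^sub>m 1\<^sub>m n"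
proof -
  let ?S = "mat_sum n n (\<lambda>g. \<rho> g * X * \<rho> (inv g)) (carrier G)"
  note r = irr_rep[OF \<rho>] and rD = repD[OF irr_rep[OF \<rho>]]
  obtain c where c: "?S = c \<cdot>\<^sub>m 1\<^sub>m n"
    by (rule schur_scalar[OF \<rho>, of ?S]) (use average_intertwines[OF r r X] in auto)
  have cl: "\<rho> g * X * \<rho> (inv g) \<in> carrier_mat n n" if "g \<in> carrier G" for g
    using that rD(1) X by (meson inv_closed mult_carrier_mat)
  have "c * of_nat n = mat_trace ?S" using smult_eq_one_trace[OF c] by simp
  also have "\<dots> = (\<Sum>g\<in>carrier G. mat_trace (\<rho> g * X * \<rho> (inv g)))"
    using cl by (rule mat_trace_mat_sum)
  also have "\<dots> = (\<Sum>g\<in>carrier G. mat_trace X)"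
  proof (intro sum.cong refl)
    fix g assume g: "g \<in> carrier G"
    have c: "\<rho> g \<in> carrier_mat n n" "\<rho> (inv g) \<in> carrier_mat n n" using rD g by auto
    have "mat_trace (\<rho> g * X * \<rho> (inv g)) = mat_trace (\<rho> (inv g) * (\<rho> g * X))"
      using c X by (intro mat_trace_mult_commute[of _ n n]) auto
    also have "\<rho> (inv g) * (\<rho> g * X) = X"
      using assoc_mult_mat[OF c(2,1) X] rep_inv(2)[OF r g] X by simp
    finally show "mat_trace (\<rho> g * X * \<rho> (inv g)) = mat_trace X" .
  qed
  finally have "c * of_nat n = ord_G * mat_trace X" by simp
  then have "c = ord_G * mat_trace X / of_nat n" using irr_pos[OF \<rho>] by (simp add: field_simps)
  then show ?thesis using c by simp
qed

definition mat_single :: "nat \<Rightarrow> nat \<Rightarrow> nat \<Rightarrow> nat \<Rightarrow> complex mat" where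
  "mat_single n m i j = mat n m (\<lambda>(a, b). if a = i \<and> b = j then 1 else 0)"

lemma mat_single_sandwich:
  assumes "A \<in> carrier_mat n n" "B \<in> carrier_mat m m" "i < n" "j < m" "a < n" "b < m"
  shows "(A * mat_single n m i j * B) $$ (a, b) = A $$ (a, i) * B $$ (j, b)"
proof -
  have s: "mat_single n m i j \<in> carrier_mat n m" by (simp add: mat_single_def)
  have "(A * mat_single n m i j) $$ (a, l) = (if l = j then A $$ (a, i) else 0)" if "l < m" for l
  proof -
    have "(A * mat_single n m i j) $$ (a, l) = (\<Sum>k<n. if k = i then (if l = j then A $$ (a, i) else 0) else 0)"
      unfolding mat_mult_entry[OF assms(1) s assms(5) that]
      using that by (intro sum.cong) (auto simp: mat_single_def)
    then show ?thesis using assms by simp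
  qed
  then have "(A * mat_single n m i j * B) $$ (a, b) = (\<Sum>l<m. (if l = j then A $$ (a, i) * B $$ (j, b) else 0))"
    unfolding mat_mult_entry[OF mult_carrier_mat[OF assms(1) s] assms(2,5,6)]
    by (intro sum.cong) auto
  then show ?thesis using assms by simp
qed

lemma mat_trace_single: "i < n \<Longrightarrow> j < n \<Longrightarrow> mat_trace (mat_single n n i j) = (if i = j then 1 else 0)"
  unfolding mat_trace_def mat_single_def by (auto intro: sum.neutral)

lemma trace_smult_entry:
  assumes "A \<in> carrier_mat n n" "(B :: complex mat) \<in> carrier_mat m m" "j < m" "b < m"
  shows "(mat_trace A \<cdot>\<^sub>m B) $$ (j, b) = (\<Sum>i<n. A $$ (i, i) * B $$ (j, b))"
  using assms by (auto simp: mat_trace_def sum_distrib_right)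

text \<open>
  Averaging the matrix unit at \<open>(i, j)\<close> gives the orthogonality relations for matrix entries; the
  relations for characters follow by adding up diagonal entries.
\<close>

lemma character_orthogonality_same:
  assumes \<rho>: "irreducible_representation G n \<rho>"
  shows "mat_sum n n (\<lambda>g. mat_trace (\<rho> g) \<cdot>\<^sub>m \<rho> (inv g)) (carrier G) = (ord_G / of_nat n) \<cdot>\<^sub>m 1\<^sub>m n"
proof (intro eq_matI)
  note rD = repD[OF irr_rep[OF \<rho>]]
  fix j b assume "j < dim_row ((ord_G / of_nat n) \<cdot>\<^sub>m 1\<^sub>m n)" "b < dim_col ((ord_G / of_nat n) \<cdot>\<^sub>m 1\<^sub>m n)"
  then have jb: "j < n" "b < n" by auto
  have entry: "(\<Sum>g\<in>carrier G. \<rho> g $$ (i, i) * \<rho> (inv g) $$ (j, b)) =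
      (ord_G * mat_trace (mat_single n n i j) / of_nat n) * (if i = b then 1 else 0)" if i: "i < n" for i
  proof -
    have "(\<Sum>g\<in>carrier G. \<rho> g $$ (i, i) * \<rho> (inv g) $$ (j, b)) =
        mat_sum n n (\<lambda>g. \<rho> g * mat_single n n i j * \<rho> (inv g)) (carrier G) $$ (i, b)"
      using i jb rD by (simp add: mat_single_sandwich del: index_mult_mat(1))
    also have "\<dots> = (ord_G * mat_trace (mat_single n n i j) / of_nat n) * (if i = b then 1 else 0)"
      by (subst average_scalar[OF \<rho>]) (use i jb in \<open>auto simp: mat_single_def\<close>)
    finally show ?thesis .
  qed
  have "mat_sum n n (\<lambda>g. mat_trace (\<rho> g) \<cdot>\<^sub>m \<rho> (inv g)) (carrier G) $$ (j, b) =
      (\<Sum>g\<in>carrier G. \<Sum>i<n. \<rho> g $$ (i, i) * \<rho> (inv g) $$ (j, b))"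
    using jb rD(1) by (simp add: trace_smult_entry[of _ n _ n])
  also have "\<dots> = (\<Sum>i<n. \<Sum>g\<in>carrier G. \<rho> g $$ (i, i) * \<rho> (inv g) $$ (j, b))" by (rule sum.swap)
  also have "\<dots> = (\<Sum>i<n. if i = j then (if j = b then ord_G / of_nat n else 0) else 0)"
    using jb by (intro sum.cong refl) (auto simp: entry mat_trace_single)
  also have "\<dots> = ((ord_G / of_nat n) \<cdot>\<^sub>m 1\<^sub>m n) $$ (j, b)" using jb by simp
  finally show "mat_sum n n (\<lambda>g. mat_trace (\<rho> g) \<cdot>\<^sub>m \<rho> (inv g)) (carrier G) $$ (j, b) =
    ((ord_G / of_nat n) \<cdot>\<^sub>m 1\<^sub>m n) $$ (j, b)" .
qed auto

lemma character_orthogonality_no_intertwiner: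
  assumes \<rho>: "representation G n \<rho>" and \<sigma>: "representation G m \<sigma>"
    and no: "\<And>X. X \<in> carrier_mat n m \<Longrightarrow> (\<And>g. g \<in> carrier G \<Longrightarrow> \<rho> g * X = X * \<sigma> g) \<Longrightarrow> X = 0\<^sub>m n m"
  shows "mat_sum m m (\<lambda>g. mat_trace (\<rho> g) \<cdot>\<^sub>m \<sigma> (inv g)) (carrier G) = 0\<^sub>m m m"
proof (intro eq_matI)
  note rD = repD[OF \<rho>] and sD = repD[OF \<sigma>]
  fix j b assume "j < dim_row (0\<^sub>m m m :: complex mat)" "b < dim_col (0\<^sub>m m m :: complex mat)"
  then have jb: "j < m" "b < m" by auto
  have entry: "(\<Sum>g\<in>carrier G. \<rho> g $$ (i, i) * \<sigma> (inv g) $$ (j, b)) = 0" if i: "i < n" for i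
  proof -
    have "(\<Sum>g\<in>carrier G. \<rho> g $$ (i, i) * \<sigma> (inv g) $$ (j, b)) =
        mat_sum n m (\<lambda>g. \<rho> g * mat_single n m i j * \<sigma> (inv g)) (carrier G) $$ (i, b)"
      using i jb rD sD by (simp add: mat_single_sandwich del: index_mult_mat(1))
    also have "mat_sum n m (\<lambda>g. \<rho> g * mat_single n m i j * \<sigma> (inv g)) (carrier G) = 0\<^sub>m n m"
      by (intro no average_intertwines[OF \<rho> \<sigma>]) (auto simp: mat_single_def)
    finally show ?thesis using i jb by simp
  qed
  have "mat_sum m m (\<lambda>g. mat_trace (\<rho> g) \<cdot>\<^sub>m \<sigma> (inv g)) (carrier G) $$ (j, b) =
      (\<Sum>g\<in>carrier G. \<Sum>i<n. \<rho> g $$ (i, i) * \<sigma> (inv g) $$ (j, b))"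
    using jb rD(1) sD(1) by (simp add: trace_smult_entry[of _ n _ m])
  also have "\<dots> = (\<Sum>i<n. \<Sum>g\<in>carrier G. \<rho> g $$ (i, i) * \<sigma> (inv g) $$ (j, b))" by (rule sum.swap)
  finally show "mat_sum m m (\<lambda>g. mat_trace (\<rho> g) \<cdot>\<^sub>m \<sigma> (inv g)) (carrier G) $$ (j, b) = 0\<^sub>m m m $$ (j, b)"
    using jb entry by simp
qed auto

definition equivalent_by :: "nat \<Rightarrow> complex mat \<Rightarrow> ('a \<Rightarrow> complex mat) \<Rightarrow> ('a \<Rightarrow> complex mat) \<Rightarrow> bool" where
  "equivalent_by n X \<rho> \<sigma> \<longleftrightarrow> X \<in> carrier_mat n n \<and> det X \<noteq> 0 \<and> (\<forall>g\<in>carrier G. \<rho> g * X = X * \<sigma> g)"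

lemma det_nonzero_inverse:
  assumes "(X :: complex mat) \<in> carrier_mat n n" "det X \<noteq> 0"
  obtains Y where "Y \<in> carrier_mat n n" "X * Y = 1\<^sub>m n" "Y * X = 1\<^sub>m n"
proof -
  obtain Y where "Y \<in> carrier_mat n n" "X * Y = 1\<^sub>m n" "Y * X = 1\<^sub>m n"
    using det_non_zero_imp_unit[OF assms, of "()"] by (auto simp: Units_def ring_mat_simps)
  then show ?thesis using that by blast
qed

lemma equivalent_trace_det:
  assumes "equivalent_by n X \<rho> \<sigma>" "g \<in> carrier G" "\<rho> g \<in> carrier_mat n n" "\<sigma> g \<in> carrier_mat n n"
  shows "mat_trace (\<rho> g) = mat_trace (\<sigma> g)" "det (\<rho> g) = det (\<sigma> g)"
proof -
  have X: "X \<in> carrier_mat n n" "det X \<noteq> 0" and int: "\<rho> g * X = X * \<sigma> g"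
    using assms unfolding equivalent_by_def by auto
  obtain Y where Y: "Y \<in> carrier_mat n n" "X * Y = 1\<^sub>m n" "Y * X = 1\<^sub>m n"
    using det_nonzero_inverse[OF X] .
  have "\<rho> g = \<rho> g * (X * Y)" using Y(2) assms(3) by simp
  also have "\<dots> = (\<rho> g * X) * Y" using assms(3) X(1) Y(1) by (rule assoc_mult_mat[symmetric])
  also have "\<dots> = X * (\<sigma> g * Y)" unfolding int using X(1) assms(4) Y(1) by (rule assoc_mult_mat)
  finally have "mat_trace (\<rho> g) = mat_trace (X * (\<sigma> g * Y))" by simp
  also have "\<dots> = mat_trace ((\<sigma> g * Y) * X)"
    using X(1) assms(4) Y(1) by (intro mat_trace_mult_commute[of _ n n]) auto
  also have "(\<sigma> g * Y) * X = \<sigma> g" using assoc_mult_mat[OF assms(4) Y(1) X(1)] Y(3) assms(4) by simp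
  finally show "mat_trace (\<rho> g) = mat_trace (\<sigma> g)" .
  have "det (\<rho> g) * det X = det X * det (\<sigma> g)"
    using det_mult[OF assms(3) X(1)] det_mult[OF X(1) assms(4)] int by metis
  then show "det (\<rho> g) = det (\<sigma> g)" using X(2) by auto
qed

lemma character_of_apply [simp]: "g \<in> carrier G \<Longrightarrow> character_of G \<rho> g = mat_trace (\<rho> g)"
  by (simp add: character_of_def)

lemma character_of_eq_iff:
  "character_of G \<rho> = character_of G \<sigma> \<longleftrightarrow> (\<forall>g\<in>carrier G. mat_trace (\<rho> g) = mat_trace (\<sigma> g))"
  by (auto simp: character_of_def restrict_def fun_eq_iff)

lemma equivalent_character:
  assumes "equivalent_by n X \<rho> \<sigma>" "representation G n \<rho>" "representation G n \<sigma>"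
  shows "character_of G \<rho> = character_of G \<sigma>"
  unfolding character_of_eq_iff
  using equivalent_trace_det(1)[OF assms(1)] repD(1)[OF assms(2)] repD(1)[OF assms(3)] by blast

lemma irreducible_orthogonality:
  assumes \<rho>: "irreducible_representation G n \<rho>" and \<sigma>: "irreducible_representation G m \<sigma>"
  shows "mat_sum m m (\<lambda>g. mat_trace (\<rho> g) \<cdot>\<^sub>m \<sigma> (inv g)) (carrier G) =
    (if character_of G \<rho> = character_of G \<sigma> then ord_G / of_nat m else 0) \<cdot>\<^sub>m 1\<^sub>m m"
proof (cases "character_of G \<rho> = character_of G \<sigma>")
  case True
  then have "mat_sum m m (\<lambda>g. mat_trace (\<rho> g) \<cdot>\<^sub>m \<sigma> (inv g)) (carrier G) =
     mat_sum m m (\<lambda>g. mat_trace (\<sigma> g) \<cdot>\<^sub>m \<sigma> (inv g)) (carrier G)"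
    unfolding character_of_eq_iff by (intro mat_sum_cong) simp
  then show ?thesis using character_orthogonality_same[OF \<sigma>] True by simp
next
  case False
  have "X = 0\<^sub>m n m" if X: "X \<in> carrier_mat n m" "\<And>g. g \<in> carrier G \<Longrightarrow> \<rho> g * X = X * \<sigma> g" for X
  proof (rule ccontr)
    assume "X \<noteq> 0\<^sub>m n m"
    then have "n = m" "det X \<noteq> 0" using intertwiner_zero_or_invertible[OF \<rho> \<sigma> X] by auto
    then have "equivalent_by n X \<rho> \<sigma>" unfolding equivalent_by_def using X by auto
    then show False using False equivalent_character irr_rep \<rho> \<sigma> \<open>n = m\<close> by blast
  qed
  then show ?thesis
    using character_orthogonality_no_intertwiner[OF irr_rep[OF \<rho>] irr_rep[OF \<sigma>]] False
    by (auto intro!: eq_matI)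
qed

text \<open>
  Without a nonzero intertwiner the sum \<open>\<Sum>\<chi>(g) \<sigma>(g\<^sup>-\<^sup>1)\<close> would vanish, but for equal characters it
  is \<open>|G| / m\<close> times the identity.
\<close>

theorem equivalent_if_same_character:
  assumes \<rho>: "irreducible_representation G n \<rho>" and \<sigma>: "irreducible_representation G m \<sigma>"
    and eq: "character_of G \<rho> = character_of G \<sigma>"
  obtains X where "n = m" "equivalent_by n X \<rho> \<sigma>"
proof -
  have "\<exists>X. X \<in> carrier_mat n m \<and> (\<forall>g\<in>carrier G. \<rho> g * X = X * \<sigma> g) \<and> X \<noteq> 0\<^sub>m n m"
  proof (rule ccontr)
    assume "\<not> ?thesis"
    then have "mat_sum m m (\<lambda>g. mat_trace (\<rho> g) \<cdot>\<^sub>m \<sigma> (inv g)) (carrier G) = 0\<^sub>m m m"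
      by (intro character_orthogonality_no_intertwiner[OF irr_rep[OF \<rho>] irr_rep[OF \<sigma>]]) blast
    then have "((ord_G / of_nat m) \<cdot>\<^sub>m 1\<^sub>m m) = 0\<^sub>m m m"
      using irreducible_orthogonality[OF \<rho> \<sigma>] eq by simp
    then have "((ord_G / of_nat m) \<cdot>\<^sub>m 1\<^sub>m m) $$ (0, 0) = (0 :: complex)" using irr_pos[OF \<sigma>] by simp
    then show False using irr_pos[OF \<sigma>] by simp
  qed
  then obtain X where X: "X \<in> carrier_mat n m" "\<And>g. g \<in> carrier G \<Longrightarrow> \<rho> g * X = X * \<sigma> g" "X \<noteq> 0\<^sub>m n m" by blast
  then have "n = m" "det X \<noteq> 0" using intertwiner_zero_or_invertible[OF \<rho> \<sigma> X(1,2)] by auto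
  then show ?thesis using that X unfolding equivalent_by_def by blast
qed

text \<open>
  A function on \<open>G\<close> annihilated by all irreducible representations is annihilated by every
  representation: by complete reducibility a representation of least dimension that violates this
  would be irreducible.
\<close>

lemma annihilated_by_all_representations:
  assumes irr: "\<And>n \<rho>. irreducible_representation G n \<rho> \<Longrightarrow> mat_sum n n (\<lambda>g. f g \<cdot>\<^sub>m \<rho> g) (carrier G) = 0\<^sub>m n n"
  shows "representation G n \<sigma> \<Longrightarrow> mat_sum n n (\<lambda>g. f g \<cdot>\<^sub>m \<sigma> g) (carrier G) = 0\<^sub>m n n"
proof (induction n arbitrary: \<sigma> rule: less_induct)
  case (less n)
  note \<sigma> = less.prems and sD = repD[OF less.prems]
  let ?T = "mat_sum n n (\<lambda>g. f g \<cdot>\<^sub>m \<sigma> g) (carrier G)"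
  consider "n = 0" | "irreducible_representation G n \<sigma>" | "0 < n" "\<not> irreducible_representation G n \<sigma>" by blast
  then show ?case
  proof cases
    case 1
    then show ?thesis by (intro eq_matI) auto
  next
    case 2
    then show ?thesis by (rule irr)
  next
    case 3
    \<comment> \<open>\<open>?T\<close> kills every proper invariant subspace, in particular the image and the kernel of the
      projection onto one.\<close>
    have kill: "?T *\<^sub>v w = 0\<^sub>v n"
      if W: "linear_subspace n W" and inv: "\<And>g w. g \<in> carrier G \<Longrightarrow> w \<in> W \<Longrightarrow> \<sigma> g *\<^sub>v w \<in> W"
        and ne: "W \<noteq> carrier_vec n" and w: "w \<in> W" for W w
    proof -
      obtain B d C A E where m: "B \<in> carrier_mat n d" "C \<in> carrier_mat d n" "C * B = 1\<^sub>m d"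
        "W = (\<lambda>v. B *\<^sub>v v) ` carrier_vec d" "representation G d A"
        "\<And>g. g \<in> carrier G \<Longrightarrow> \<sigma> g * B = B * A g"
        "E \<in> carrier_mat n n" "E * B = B" "\<And>v. v \<in> carrier_vec n \<Longrightarrow> E *\<^sub>v v \<in> W"
        "\<And>g. g \<in> carrier G \<Longrightarrow> \<sigma> g * E = E * \<sigma> g"
        by (rule maschke[OF \<sigma> W inv]) (assumption | blast)+
      have "d \<noteq> n"
      proof
        assume d: "d = n"
        then have BC: "B * C = 1\<^sub>m n" using mat_mult_left_right_inverse[of C n B] m(1-3) by simp
        have "v \<in> W" if v: "v \<in> carrier_vec n" for v
        proof -
          have "v = (B * C) *\<^sub>v v" using BC v by simp
          also have "\<dots> = B *\<^sub>v (C *\<^sub>v v)" using m(1,2) v by (rule assoc_mult_mat_vec)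
          finally have v': "v = B *\<^sub>v (C *\<^sub>v v)" .
          show ?thesis unfolding m(4) using v' m(2) v by (intro image_eqI[of _ _ "C *\<^sub>v v"]) auto
        qed
        then show False using ne W unfolding linear_subspace_def by blast
      qed
      then have "d < n" using right_inverse_dim_le[OF m(2,1,3)] by simp
      then have IH: "mat_sum d d (\<lambda>g. f g \<cdot>\<^sub>m A g) (carrier G) = 0\<^sub>m d d" using less.IH m(5) by blast
      note AD = repD[OF m(5)]
      have "?T * B = mat_sum n d (\<lambda>g. (f g \<cdot>\<^sub>m \<sigma> g) * B) (carrier G)"
        using m(1) sD(1) by (intro mat_sum_mult) auto
      also have "\<dots> = mat_sum n d (\<lambda>g. B * (f g \<cdot>\<^sub>m A g)) (carrier G)"
      proof (intro mat_sum_cong)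
        fix g assume g: "g \<in> carrier G"
        show "(f g \<cdot>\<^sub>m \<sigma> g) * B = B * (f g \<cdot>\<^sub>m A g)"
          using mult_smult_assoc_mat[OF sD(1)[OF g] m(1)] mult_smult_distrib[OF m(1) AD(1)[OF g]] m(6)[OF g]
          by simp
      qed
      also have "\<dots> = B * mat_sum d d (\<lambda>g. f g \<cdot>\<^sub>m A g) (carrier G)"
        using m(1) AD(1) by (intro mult_mat_sum[symmetric]) auto
      also have "\<dots> = 0\<^sub>m n d" unfolding IH using m(1) by simp
      finally have TB: "?T * B = 0\<^sub>m n d" .
      obtain u where u: "u \<in> carrier_vec d" "w = B *\<^sub>v u" using w m(4) by auto
      have "?T *\<^sub>v w = (?T * B) *\<^sub>v u" unfolding u(2) using m(1) u(1) by (intro assoc_mult_mat_vec[symmetric]) auto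
      then show ?thesis unfolding TB using u(1) by (intro eq_vecI) (auto simp: scalar_prod_def)
    qed
    obtain W where W: "linear_subspace n W" and inv: "\<And>g w. g \<in> carrier G \<Longrightarrow> w \<in> W \<Longrightarrow> \<sigma> g *\<^sub>v w \<in> W"
      and ne: "W \<noteq> {0\<^sub>v n}" "W \<noteq> carrier_vec n"
      using 3 \<sigma> unfolding irreducible_representation_def invariant_subspace_def subspace_iff_linear_subspace
      by blast
    obtain B d C A E where m: "B \<in> carrier_mat n d" "C \<in> carrier_mat d n" "C * B = 1\<^sub>m d"
      "W = (\<lambda>v. B *\<^sub>v v) ` carrier_vec d" "representation G d A"
      "\<And>g. g \<in> carrier G \<Longrightarrow> \<sigma> g * B = B * A g"
      "E \<in> carrier_mat n n" "E * B = B" "\<And>v. v \<in> carrier_vec n \<Longrightarrow> E *\<^sub>v v \<in> W"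
      "\<And>g. g \<in> carrier G \<Longrightarrow> \<sigma> g * E = E * \<sigma> g"
      by (rule maschke[OF \<sigma> W inv]) (assumption | blast)+
    have EW: "E *\<^sub>v w = w" if wW: "w \<in> W" for w
    proof -
      obtain u where u: "u \<in> carrier_vec d" "w = B *\<^sub>v u" using wW m(4) by auto
      show ?thesis unfolding u(2) using assoc_mult_mat_vec[OF m(7,1) u(1)] m(8) by simp
    qed
    have Wc: "W \<subseteq> carrier_vec n" and W0: "0\<^sub>v n \<in> W" using W unfolding linear_subspace_def by auto
    define K where "K = {v \<in> carrier_vec n. E *\<^sub>v v = 0\<^sub>v n}"
    have K: "linear_subspace n K"
      unfolding linear_subspace_def K_def using m(7)
      by (auto simp: mult_add_distrib_mat_vec[of _ n n] mult_mat_vec[of _ n n])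
    have Kinv: "\<sigma> g *\<^sub>v w \<in> K" if g: "g \<in> carrier G" and w: "w \<in> K" for g w
    proof -
      have wc: "w \<in> carrier_vec n" "E *\<^sub>v w = 0\<^sub>v n" using w by (auto simp: K_def)
      have "E *\<^sub>v (\<sigma> g *\<^sub>v w) = \<sigma> g *\<^sub>v (E *\<^sub>v w)"
        using assoc_mult_mat_vec[OF m(7) sD(1)[OF g] wc(1)] assoc_mult_mat_vec[OF sD(1)[OF g] m(7) wc(1)] m(10)[OF g]
        by simp
      also have "\<dots> = 0\<^sub>v n" unfolding wc(2) using sD(1)[OF g] by auto
      finally show ?thesis using sD(1)[OF g] wc(1) by (auto simp: K_def)
    qed
    have Kne: "K \<noteq> carrier_vec n"
    proof
      assume *: "K = carrier_vec n"
      have "w = 0\<^sub>v n" if "w \<in> W" for w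
      proof -
        have "w \<in> K" using that Wc * by blast
        then show ?thesis using EW[OF that] by (simp add: K_def)
      qed
      then show False using ne(1) W0 by blast
    qed
    show ?thesis
    proof (rule mat_eq_zero_if_kills_vectors)
      fix v :: "complex vec" assume v: "v \<in> carrier_vec n"
      have Ev: "E *\<^sub>v v \<in> W" "E *\<^sub>v v \<in> carrier_vec n" using m(9)[OF v] Wc by auto
      have "E *\<^sub>v (v - E *\<^sub>v v) = 0\<^sub>v n"
        using mult_minus_distrib_mat_vec[OF m(7) v Ev(2)] EW[OF Ev(1)] Ev(2) by simp
      then have vK: "v - E *\<^sub>v v \<in> K" using v Ev(2) unfolding K_def by simp
      have "?T *\<^sub>v (v - E *\<^sub>v v) = ?T *\<^sub>v v - ?T *\<^sub>v (E *\<^sub>v v)"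
        using v Ev(2) by (intro mult_minus_distrib_mat_vec[of _ n n]) auto
      then have "?T *\<^sub>v v - 0\<^sub>v n = 0\<^sub>v n"
        using kill[OF W inv ne(2) Ev(1)] kill[OF K Kinv Kne vK] by simp
      moreover have "x = 0\<^sub>v n" if "x \<in> carrier_vec n" "x - 0\<^sub>v n = 0\<^sub>v n" for x :: "complex vec"
      proof (intro eq_vecI)
        fix i assume "i < dim_vec (0\<^sub>v n :: complex vec)"
        then show "x $ i = 0\<^sub>v n $ i" using arg_cong[OF that(2), of "\<lambda>y. y $ i"] that(1) by simp
      qed (use that in auto)
      ultimately show "?T *\<^sub>v v = 0\<^sub>v n" using v mult_mat_vec_carrier[OF mat_sum_carrier v] by blast
    qed auto
  qed
qed

text \<open>
  In the regular representation the function can be read off from the matrix entries of its action.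
\<close>

theorem zero_if_annihilated_by_irreducibles:
  assumes irr: "\<And>n \<rho>. irreducible_representation G n \<rho> \<Longrightarrow> mat_sum n n (\<lambda>g. f g \<cdot>\<^sub>m \<rho> g) (carrier G) = 0\<^sub>m n n"
    and x: "x \<in> carrier G"
  shows "f x = 0"
proof -
  let ?N = "card (carrier G)"
  obtain e where e: "bij_betw e {0..<?N} (carrier G)"
    using ex_bij_betw_nat_finite[OF fin] by blast
  have eG: "e i \<in> carrier G" if "i < ?N" for i using that e by (auto dest!: bij_betwE)
  have ex1: "\<exists>!k. k < ?N \<and> e k = g" if gG: "g \<in> carrier G" for g
  proof -
    obtain k where k: "k < ?N" "e k = g"
      using gG bij_betw_imp_surj_on[OF e] by (metis atLeastLessThan_iff imageE)
    have "k' = k" if "k' < ?N" "e k' = g" for k'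
      using inj_onD[OF bij_betw_imp_inj_on[OF e], of k' k] that k by simp
    then show ?thesis using k by blast
  qed
  \<comment> \<open>The regular representation, by permutation matrices.\<close>
  define R where "R g = mat ?N ?N (\<lambda>(i, j). if e i = g \<otimes> e j then 1 else 0 :: complex)" for g
  have "representation G ?N R"
    unfolding rep_iff
  proof (intro conjI ballI)
    show "R g \<in> carrier_mat ?N ?N" for g by (simp add: R_def)
    show "R \<one> = 1\<^sub>m ?N"
    proof (intro eq_matI)
      fix i j assume "i < dim_row (1\<^sub>m ?N :: complex mat)" "j < dim_col (1\<^sub>m ?N :: complex mat)"
      then have ij: "i < ?N" "j < ?N" by auto
      then show "R \<one> $$ (i, j) = 1\<^sub>m ?N $$ (i, j)" using ex1[OF eG[OF ij(1)]] eG[OF ij(2)] by (auto simp: R_def)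
    qed (auto simp: R_def)
    fix g h assume g: "g \<in> carrier G" and h: "h \<in> carrier G"
    show "R (g \<otimes> h) = R g * R h"
    proof (intro eq_matI)
      fix i j assume "i < dim_row (R g * R h)" "j < dim_col (R g * R h)"
      then have ij: "i < ?N" "j < ?N" by (auto simp: R_def)
      obtain k0 where k0: "k0 < ?N" "e k0 = h \<otimes> e j" "\<And>k. k < ?N \<Longrightarrow> e k = h \<otimes> e j \<Longrightarrow> k = k0"
        using ex1[of "h \<otimes> e j"] h eG[OF ij(2)] by auto
      have "(R g * R h) $$ (i, j) = (\<Sum>k<?N. R g $$ (i, k) * R h $$ (k, j))"
        using ij by (intro mat_mult_entry) (auto simp: R_def)
      also have "\<dots> = (\<Sum>k<?N. if k = k0 then R g $$ (i, k0) else 0)"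
      proof (intro sum.cong refl)
        fix k assume "k \<in> {..<?N}"
        then have k: "k < ?N" by simp
        have "R h $$ (k, j) = (if k = k0 then 1 else 0)"
        proof (cases "k = k0")
          case True
          then show ?thesis using k ij k0(2) by (simp add: R_def)
        next
          case False
          then have "e k \<noteq> h \<otimes> e j" using k0(3)[OF k] by blast
          then show ?thesis using k ij False by (simp add: R_def)
        qed
        then show "R g $$ (i, k) * R h $$ (k, j) = (if k = k0 then R g $$ (i, k0) else 0)" by simp
      qed
      also have "\<dots> = R g $$ (i, k0)" using k0(1) by simp
      also have "\<dots> = R (g \<otimes> h) $$ (i, j)"
        using ij k0(1,2) g h eG by (simp add: R_def m_assoc)
      finally show "R (g \<otimes> h) $$ (i, j) = (R g * R h) $$ (i, j)" by simp
    qed (auto simp: R_def)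
  qed
  then have 0: "mat_sum ?N ?N (\<lambda>g. f g \<cdot>\<^sub>m R g) (carrier G) = 0\<^sub>m ?N ?N"
    using annihilated_by_all_representations[of f] irr by blast
  obtain i where i: "i < ?N" "e i = x" using ex1[OF x] by blast
  obtain j where j: "j < ?N" "e j = \<one>" using ex1[of \<one>] by auto
  have "(\<Sum>g\<in>carrier G. (f g \<cdot>\<^sub>m R g) $$ (i, j)) = (\<Sum>g\<in>carrier G. if g = x then f x else 0)"
    using i j by (intro sum.cong) (auto simp: R_def)
  then show ?thesis using arg_cong[OF 0, of "\<lambda>M. M $$ (i, j)"] i j x by simp
qed

corollary zero_if_annihilated_by_irreducibles_inv:
  assumes irr: "\<And>n \<rho>. irreducible_representation G n \<rho> \<Longrightarrow>
      mat_sum n n (\<lambda>g. f g \<cdot>\<^sub>m \<rho> (inv g)) (carrier G) = 0\<^sub>m n n"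
    and x: "x \<in> carrier G"
  shows "f x = 0"
proof -
  have "f (inv (inv x)) = 0"
  proof (rule zero_if_annihilated_by_irreducibles[where f = "\<lambda>g. f (inv g)" and x = "inv x"])
    fix n \<rho> assume r: "irreducible_representation G n \<rho>"
    have "mat_sum n n (\<lambda>g. f (inv g) \<cdot>\<^sub>m \<rho> g) (carrier G) =
        mat_sum n n (\<lambda>g. (\<lambda>g. f g \<cdot>\<^sub>m \<rho> (inv g)) (inv g)) (carrier G)"
      by (intro mat_sum_cong) simp
    also have "\<dots> = mat_sum n n (\<lambda>g. f g \<cdot>\<^sub>m \<rho> (inv g)) (carrier G)"
      by (rule mat_sum_reindex[OF bij_inv])
    finally show "mat_sum n n (\<lambda>g. f (inv g) \<cdot>\<^sub>m \<rho> g) (carrier G) = 0\<^sub>m n n" using irr[OF r] by simp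
  qed (use x in auto)
  then show ?thesis using x by simp
qed

lemma IrrE:
  assumes "\<chi> \<in> Irr G"
  obtains n \<rho> where "irreducible_representation G n \<rho>" "\<chi> = character_of G \<rho>"
  using assms unfolding Irr_def by blast

lemma IrrI: "irreducible_representation G n \<rho> \<Longrightarrow> character_of G \<rho> \<in> Irr G"
  unfolding Irr_def by blast

lemma character_of_at_one: "representation G n \<rho> \<Longrightarrow> character_of G \<rho> \<one> = of_nat n"
  by (rule character_of_one[OF is_group])

lemma char_degree_eqI: "\<chi> \<one> = of_nat n \<Longrightarrow> char_degree G \<chi> = n"
  unfolding char_degree_def by (intro the_equality) auto

lemma char_degree_character_of: "representation G n \<rho> \<Longrightarrow> char_degree G (character_of G \<rho>) = n"
  by (intro char_degree_eqI character_of_at_one)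

lemma Irr_orthogonality:
  assumes \<chi>: "\<chi> \<in> Irr G" and \<sigma>: "irreducible_representation G m \<sigma>"
  shows "mat_sum m m (\<lambda>g. \<chi> g \<cdot>\<^sub>m \<sigma> (inv g)) (carrier G) =
    (if \<chi> = character_of G \<sigma> then ord_G / of_nat m else 0) \<cdot>\<^sub>m 1\<^sub>m m"
proof -
  obtain n \<rho> where \<rho>: "irreducible_representation G n \<rho>" "\<chi> = character_of G \<rho>" using IrrE[OF \<chi>] .
  have "mat_sum m m (\<lambda>g. \<chi> g \<cdot>\<^sub>m \<sigma> (inv g)) (carrier G) =
     mat_sum m m (\<lambda>g. mat_trace (\<rho> g) \<cdot>\<^sub>m \<sigma> (inv g)) (carrier G)"
    unfolding \<rho>(2) by (intro mat_sum_cong) simp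
  then show ?thesis using irreducible_orthogonality[OF \<rho>(1) \<sigma>] \<rho>(2) by simp
qed

lemma Irr_orthonormal:
  assumes "\<chi> \<in> Irr G" "\<psi> \<in> Irr G"
  shows "(\<Sum>g\<in>carrier G. \<chi> g * \<psi> (inv g)) = (if \<chi> = \<psi> then ord_G else 0)"
proof -
  obtain m \<sigma> where \<sigma>: "irreducible_representation G m \<sigma>" "\<psi> = character_of G \<sigma>" using IrrE[OF assms(2)] .
  note sD = repD[OF irr_rep[OF \<sigma>(1)]]
  have "(\<Sum>g\<in>carrier G. \<chi> g * \<psi> (inv g)) = (\<Sum>g\<in>carrier G. mat_trace (\<chi> g \<cdot>\<^sub>m \<sigma> (inv g)))"
    unfolding \<sigma>(2) using sD(1) by (intro sum.cong) (auto simp: mat_trace_smult[OF sD(1)])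
  also have "\<dots> = mat_trace (mat_sum m m (\<lambda>g. \<chi> g \<cdot>\<^sub>m \<sigma> (inv g)) (carrier G))"
    using sD(1) by (intro mat_trace_mat_sum[symmetric]) auto
  also have "\<dots> = (if \<chi> = \<psi> then ord_G / of_nat m else 0) * of_nat m"
    unfolding Irr_orthogonality[OF assms(1) \<sigma>(1)] \<sigma>(2) by (rule smult_eq_one_trace) simp
  finally show ?thesis using irr_pos[OF \<sigma>(1)] by simp
qed

text \<open>
  For \<open>m\<close> distinct irreducible characters the orthogonality relations say that an \<open>m \<times> |G|\<close> matrix
  of character values has a right inverse, so \<open>m \<le> |G|\<close>.
\<close>

lemma finite_Irr: "finite (Irr G)"
proof (rule finite_if_finite_subsets_card_bdd[THEN conjunct1, of _ "card (carrier G)"])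
  fix F assume F: "F \<subseteq> Irr G" "finite F"
  let ?m = "card F" and ?N = "card (carrier G)"
  obtain e where e: "bij_betw e {0..<?N} (carrier G)"
    using ex_bij_betw_nat_finite[OF fin] by blast
  obtain c where c: "bij_betw c {0..<?m} F"
    using ex_bij_betw_nat_finite[OF F(2)] by blast
  define X where "X = mat ?m ?N (\<lambda>(i, j). c i (e j))"
  define Y where "Y = mat ?N ?m (\<lambda>(i, j). c j (inv (e i)) / ord_G)"
  have XY: "X \<in> carrier_mat ?m ?N" "Y \<in> carrier_mat ?N ?m" by (auto simp: X_def Y_def)
  have "X * Y = 1\<^sub>m ?m"
  proof (intro eq_matI)
    fix i j assume "i < dim_row (1\<^sub>m ?m :: complex mat)" "j < dim_col (1\<^sub>m ?m :: complex mat)"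
    then have ij: "i < ?m" "j < ?m" by auto
    have cF: "c i \<in> Irr G" "c j \<in> Irr G" using ij c F(1) by (auto dest!: bij_betwE)
    have "(X * Y) $$ (i, j) = (\<Sum>k<?N. c i (e k) * (c j (inv (e k)) / ord_G))"
      unfolding mat_mult_entry[OF XY ij] using ij by (intro sum.cong) (auto simp: X_def Y_def)
    also have "\<dots> = (\<Sum>g\<in>carrier G. c i g * (c j (inv g) / ord_G))"
      using sum.reindex_bij_betw[OF e, of "\<lambda>g. c i g * (c j (inv g) / ord_G)"] by (simp add: lessThan_atLeast0)
    also have "\<dots> = (if c i = c j then 1 else 0)"
      using Irr_orthonormal[OF cF] by (simp flip: sum_divide_distrib)
    also have "\<dots> = 1\<^sub>m ?m $$ (i, j)" using c ij unfolding bij_betw_def inj_on_def by auto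
    finally show "(X * Y) $$ (i, j) = 1\<^sub>m ?m $$ (i, j)" .
  qed (auto simp: X_def Y_def)
  then show "?m \<le> ?N" using right_inverse_dim_le[OF XY] by blast
qed

text \<open>
  Both sides of the conclusion act in the same way on every irreducible representation: for the right
  hand side this is the orthogonality of characters.
\<close>

theorem character_expansion:
  assumes X: "X \<subseteq> Irr G"
    and h: "\<And>m \<sigma>. irreducible_representation G m \<sigma> \<Longrightarrow>
      mat_sum m m (\<lambda>g. h g \<cdot>\<^sub>m \<sigma> (inv g)) (carrier G) =
      (if character_of G \<sigma> \<in> X then c (character_of G \<sigma>) * ord_G / of_nat m else 0) \<cdot>\<^sub>m 1\<^sub>m m"
    and x: "x \<in> carrier G"
  shows "h x = (\<Sum>\<chi>\<in>X. c \<chi> * \<chi> x)"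
proof -
  have fX: "finite X" using finite_subset[OF X finite_Irr] .
  define f where "f g = h g - (\<Sum>\<chi>\<in>X. c \<chi> * \<chi> g)" for g
  have "f x = 0"
  proof (rule zero_if_annihilated_by_irreducibles_inv)
    fix m \<sigma> assume \<sigma>: "irreducible_representation G m \<sigma>"
    note sD = repD[OF irr_rep[OF \<sigma>]]
    show "mat_sum m m (\<lambda>g. f g \<cdot>\<^sub>m \<sigma> (inv g)) (carrier G) = 0\<^sub>m m m"
    proof (intro eq_matI)
      fix i j assume "i < dim_row (0\<^sub>m m m :: complex mat)" "j < dim_col (0\<^sub>m m m :: complex mat)"
      then have ij: "i < m" "j < m" by auto
      have ent: "(z \<cdot>\<^sub>m \<sigma> (inv g)) $$ (i, j) = z * \<sigma> (inv g) $$ (i, j)" if "g \<in> carrier G" for z g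
        using sD(1)[of "inv g"] that ij by auto
      let ?\<psi> = "character_of G \<sigma>"
      have orth: "(\<Sum>g\<in>carrier G. \<chi> g * \<sigma> (inv g) $$ (i, j)) =
          (if \<chi> = ?\<psi> then ord_G / of_nat m else 0) * 1\<^sub>m m $$ (i, j)" if "\<chi> \<in> X" for \<chi>
        using arg_cong[OF Irr_orthogonality[OF _ \<sigma>], of \<chi> "\<lambda>M. M $$ (i, j)"] X that ij ent by auto
      have "(\<Sum>g\<in>carrier G. f g * \<sigma> (inv g) $$ (i, j)) = (\<Sum>g\<in>carrier G. h g * \<sigma> (inv g) $$ (i, j)) -
          (\<Sum>g\<in>carrier G. \<Sum>\<chi>\<in>X. c \<chi> * (\<chi> g * \<sigma> (inv g) $$ (i, j)))"
        unfolding f_def by (simp add: left_diff_distrib sum_subtractf sum_distrib_right mult.assoc)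
      also have "(\<Sum>g\<in>carrier G. h g * \<sigma> (inv g) $$ (i, j)) =
          (if ?\<psi> \<in> X then c ?\<psi> * ord_G / of_nat m else 0) * 1\<^sub>m m $$ (i, j)"
        using arg_cong[OF h[OF \<sigma>], of "\<lambda>M. M $$ (i, j)"] ij ent by simp
      also have "(\<Sum>g\<in>carrier G. \<Sum>\<chi>\<in>X. c \<chi> * (\<chi> g * \<sigma> (inv g) $$ (i, j))) =
          (\<Sum>\<chi>\<in>X. c \<chi> * (\<Sum>g\<in>carrier G. \<chi> g * \<sigma> (inv g) $$ (i, j)))"
        by (subst sum.swap) (simp add: sum_distrib_left)
      also have "\<dots> = (\<Sum>\<chi>\<in>X. if \<chi> = ?\<psi> then c ?\<psi> * ord_G / of_nat m * 1\<^sub>m m $$ (i, j) else 0)"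
        by (intro sum.cong refl) (auto simp: orth)
      also have "\<dots> = (if ?\<psi> \<in> X then c ?\<psi> * ord_G / of_nat m else 0) * 1\<^sub>m m $$ (i, j)"
        using fX by simp
      finally have "(\<Sum>g\<in>carrier G. f g * \<sigma> (inv g) $$ (i, j)) = 0" by simp
      then show "mat_sum m m (\<lambda>g. f g \<cdot>\<^sub>m \<sigma> (inv g)) (carrier G) $$ (i, j) = 0\<^sub>m m m $$ (i, j)"
        using ij ent by simp
    qed auto
  qed (rule x)
  then show ?thesis by (simp add: f_def)
qed

text \<open>Expand the indicator function of the identity and evaluate at the identity.\<close>

theorem sum_squared_degrees: "(\<Sum>\<chi>\<in>Irr G. (char_degree G \<chi>)\<^sup>2) = card (carrier G)"
proof -
  have "(if \<one> = \<one> then 1 else 0) = (\<Sum>\<chi>\<in>Irr G. of_nat (char_degree G \<chi>) / ord_G * \<chi> \<one>)"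
  proof (rule character_expansion[where h = "\<lambda>g. if g = \<one> then 1 else 0"
        and c = "\<lambda>\<chi>. of_nat (char_degree G \<chi>) / ord_G"])
    fix m \<sigma> assume \<sigma>: "irreducible_representation G m \<sigma>"
    note sD = repD[OF irr_rep[OF \<sigma>]]
    have "mat_sum m m (\<lambda>g. (if g = \<one> then 1 else 0) \<cdot>\<^sub>m \<sigma> (inv g)) (carrier G) = 1\<^sub>m m"
    proof (intro eq_matI)
      fix i j assume "i < dim_row (1\<^sub>m m :: complex mat)" "j < dim_col (1\<^sub>m m :: complex mat)"
      then have ij: "i < m" "j < m" by auto
      have "(\<Sum>g\<in>carrier G. ((if g = \<one> then 1 else 0) \<cdot>\<^sub>m \<sigma> (inv g)) $$ (i, j)) =
          (\<Sum>g\<in>carrier G. if g = \<one> then 1\<^sub>m m $$ (i, j) else 0)"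
        using ij sD(3) carrier_matD[OF sD(1)[OF inv_closed]] by (intro sum.cong refl) auto
      then show "mat_sum m m (\<lambda>g. (if g = \<one> then 1 else 0) \<cdot>\<^sub>m \<sigma> (inv g)) (carrier G) $$ (i, j) = 1\<^sub>m m $$ (i, j)"
        using ij by simp
    qed auto
    then show "mat_sum m m (\<lambda>g. (if g = \<one> then 1 else 0) \<cdot>\<^sub>m \<sigma> (inv g)) (carrier G) =
        (if character_of G \<sigma> \<in> Irr G then of_nat (char_degree G (character_of G \<sigma>)) / ord_G * ord_G / of_nat m else 0) \<cdot>\<^sub>m 1\<^sub>m m"
      using IrrI[OF \<sigma>] irr_pos[OF \<sigma>] by (simp add: char_degree_character_of[OF irr_rep[OF \<sigma>]] one_smult_mat)
  qed auto
  also have "\<dots> = (\<Sum>\<chi>\<in>Irr G. of_nat ((char_degree G \<chi>)\<^sup>2)) / ord_G"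
    unfolding sum_divide_distrib
    by (auto intro!: sum.cong simp: Irr_degree[OF is_group] power2_eq_square)
  finally have "of_nat (\<Sum>\<chi>\<in>Irr G. (char_degree G \<chi>)\<^sup>2) = ord_G" by (simp add: field_simps)
  then show ?thesis by (simp only: of_nat_eq_iff)
qed

end


section \<open>Characters separate conjugacy classes; degrees divide the order\<close>

context fin_group
begin

text \<open>
  The sums over the conjugacy classes of \<open>g\<close> and \<open>h\<close>, with multiplicity, act on each irreducible
  representation as scalars determined by the character values at \<open>g\<close> and \<open>h\<close>. If these agree, the
  difference of the two sums is annihilated by all irreducible representations, hence zero.
\<close>

theorem conjugate_if_characters_agree:
  assumes g: "g \<in> carrier G" and h: "h \<in> carrier G" and eq: "\<And>\<chi>. \<chi> \<in> Irr G \<Longrightarrow> \<chi> g = \<chi> h"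
  obtains a where "a \<in> carrier G" "g = a \<otimes> h \<otimes> inv a"
proof -
  define f where "f x = (\<Sum>a\<in>carrier G. (if x = a \<otimes> g \<otimes> inv a then 1 else 0) -
     (if x = a \<otimes> h \<otimes> inv a then 1 else 0 :: complex))" for x
  have "f g = 0"
  proof (rule zero_if_annihilated_by_irreducibles)
    fix n \<rho> assume \<rho>: "irreducible_representation G n \<rho>"
    note rD = repD[OF irr_rep[OF \<rho>]]
    have "mat_trace (\<rho> g) = mat_trace (\<rho> h)" using eq[OF IrrI[OF \<rho>]] g h by simp
    then have same: "mat_sum n n (\<lambda>a. \<rho> a * \<rho> g * \<rho> (inv a)) (carrier G) = mat_sum n n (\<lambda>a. \<rho> a * \<rho> h * \<rho> (inv a)) (carrier G)"
      using average_scalar[OF \<rho> rD(1)[OF g]] average_scalar[OF \<rho> rD(1)[OF h]] by simp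
    have conj: "\<rho> (a \<otimes> x \<otimes> inv a) = \<rho> a * \<rho> x * \<rho> (inv a)" if "a \<in> carrier G" "x \<in> carrier G" for a x
      using that rD(2) by simp
    show "mat_sum n n (\<lambda>g. f g \<cdot>\<^sub>m \<rho> g) (carrier G) = 0\<^sub>m n n"
    proof (intro eq_matI)
      fix i j assume "i < dim_row (0\<^sub>m n n :: complex mat)" "j < dim_col (0\<^sub>m n n :: complex mat)"
      then have ij: "i < n" "j < n" by auto
      have ent: "(c \<cdot>\<^sub>m \<rho> x) $$ (i, j) = c * \<rho> x $$ (i, j)" if "x \<in> carrier G" for c x
        using rD(1)[OF that] ij by auto
      have "(\<Sum>x\<in>carrier G. f x * \<rho> x $$ (i, j)) =
        (\<Sum>x\<in>carrier G. \<Sum>a\<in>carrier G. (if x = a \<otimes> g \<otimes> inv a then \<rho> x $$ (i, j) else 0) -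
          (if x = a \<otimes> h \<otimes> inv a then \<rho> x $$ (i, j) else 0))"
        unfolding f_def sum_distrib_right by (intro sum.cong refl) auto
      also have "\<dots> = (\<Sum>a\<in>carrier G. \<Sum>x\<in>carrier G. (if x = a \<otimes> g \<otimes> inv a then \<rho> x $$ (i, j) else 0) -
          (if x = a \<otimes> h \<otimes> inv a then \<rho> x $$ (i, j) else 0))" by (rule sum.swap)
      also have "\<dots> = (\<Sum>a\<in>carrier G. \<rho> (a \<otimes> g \<otimes> inv a) $$ (i, j) - \<rho> (a \<otimes> h \<otimes> inv a) $$ (i, j))"
        using g h by (intro sum.cong refl) (auto simp: sum_subtractf)
      also have "\<dots> = (\<Sum>a\<in>carrier G. (\<rho> a * \<rho> g * \<rho> (inv a)) $$ (i, j)) - (\<Sum>a\<in>carrier G. (\<rho> a * \<rho> h * \<rho> (inv a)) $$ (i, j))"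
        unfolding sum_subtractf using conj g h by simp
      also have "\<dots> = 0" using arg_cong[OF same, of "\<lambda>M. M $$ (i, j)"] ij by (simp del: index_mult_mat)
      finally show "mat_sum n n (\<lambda>g. f g \<cdot>\<^sub>m \<rho> g) (carrier G) $$ (i, j) = 0\<^sub>m n n $$ (i, j)"
        using ij ent by simp
    qed auto
  qed (rule g)
  show ?thesis
  proof (rule ccontr)
    assume "\<not> thesis"
    then have no: "\<And>a. a \<in> carrier G \<Longrightarrow> g \<noteq> a \<otimes> h \<otimes> inv a" using that by blast
    then have "f g = (\<Sum>a\<in>carrier G. if g = a \<otimes> g \<otimes> inv a then 1 else 0)"
      unfolding f_def by (intro sum.cong) auto
    also have "\<dots> = of_nat (card {a \<in> carrier G. g = a \<otimes> g \<otimes> inv a})" by (simp add: sum.If_cases Int_def)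
    finally have "{a \<in> carrier G. g = a \<otimes> g \<otimes> inv a} = {}" using \<open>f g = 0\<close> by simp
    moreover have "\<one> \<in> {a \<in> carrier G. g = a \<otimes> g \<otimes> inv a}" using g by simp
    ultimately show False by blast
  qed
qed

text \<open>
  The inner sum over \<open>a\<close> averages \<open>\<rho>(b)\<close> to a multiple of \<open>\<chi>(b)\<close>, and the remaining sum over \<open>b\<close> is
  the orthogonality relation.
\<close>

lemma commutator_sum:
  assumes \<rho>: "irreducible_representation G n \<rho>"
  shows "mat_sum n n (\<lambda>b. mat_sum n n (\<lambda>a. \<rho> (a \<otimes> b \<otimes> inv a \<otimes> inv b)) (carrier G)) (carrier G) =
    ((ord_G / of_nat n)\<^sup>2) \<cdot>\<^sub>m 1\<^sub>m n"
proof -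
  note rD = repD[OF irr_rep[OF \<rho>]]
  have "mat_sum n n (\<lambda>b. mat_sum n n (\<lambda>a. \<rho> (a \<otimes> b \<otimes> inv a \<otimes> inv b)) (carrier G)) (carrier G) =
    mat_sum n n (\<lambda>b. (ord_G / of_nat n) \<cdot>\<^sub>m (mat_trace (\<rho> b) \<cdot>\<^sub>m \<rho> (inv b))) (carrier G)"
  proof (intro mat_sum_cong)
    fix b assume b: "b \<in> carrier G"
    have c: "\<rho> b \<in> carrier_mat n n" "\<rho> (inv b) \<in> carrier_mat n n" using rD(1) b by auto
    have "mat_sum n n (\<lambda>a. \<rho> (a \<otimes> b \<otimes> inv a \<otimes> inv b)) (carrier G) =
        mat_sum n n (\<lambda>a. \<rho> a * \<rho> b * \<rho> (inv a) * \<rho> (inv b)) (carrier G)"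
      using b rD(2) by (intro mat_sum_cong) simp
    also have "\<dots> = mat_sum n n (\<lambda>a. \<rho> a * \<rho> b * \<rho> (inv a)) (carrier G) * \<rho> (inv b)"
      using c rD(1) by (intro mat_sum_mult[symmetric]) (auto intro!: mult_carrier_mat)
    also have "\<dots> = (ord_G * mat_trace (\<rho> b) / of_nat n) \<cdot>\<^sub>m \<rho> (inv b)"
      unfolding average_scalar[OF \<rho> c(1)] using mult_smult_one(2)[OF c(2)] by simp
    finally show "mat_sum n n (\<lambda>a. \<rho> (a \<otimes> b \<otimes> inv a \<otimes> inv b)) (carrier G) =
        (ord_G / of_nat n) \<cdot>\<^sub>m (mat_trace (\<rho> b) \<cdot>\<^sub>m \<rho> (inv b))"
      by (simp add: smult_smult_mat)
  qed
  also have "\<dots> = (ord_G / of_nat n) \<cdot>\<^sub>m mat_sum n n (\<lambda>b. mat_trace (\<rho> b) \<cdot>\<^sub>m \<rho> (inv b)) (carrier G)"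
    using rD(1) by (intro smult_mat_sum[symmetric]) auto
  also have "\<dots> = ((ord_G / of_nat n)\<^sup>2) \<cdot>\<^sub>m 1\<^sub>m n"
    unfolding character_orthogonality_same[OF \<rho>] by (simp add: smult_smult_mat power2_eq_square)
  finally show ?thesis .
qed

text \<open>
  By the commutator sum, \<open>(|G| / n)\<^sup>2\<close> is an eigenvalue of the integral matrix by which the sum of all
  commutators \<open>[a, b]\<close> acts on the group ring. A rational eigenvalue of an integral matrix is an
  integer.
\<close>

theorem degree_dvd_order:
  assumes \<rho>: "irreducible_representation G n \<rho>"
  shows "n dvd card (carrier G)"
proof -
  let ?N = "card (carrier G)"
  note rD = repD[OF irr_rep[OF \<rho>]]
  have n: "0 < n" using irr_pos[OF \<rho>] .
  define \<alpha> where "\<alpha> = (ord_G / of_nat n)\<^sup>2"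
  obtain e where e: "bij_betw e {0..<?N} (carrier G)"
    using ex_bij_betw_nat_finite[OF fin] by blast
  have eG: "e i \<in> carrier G" if "i < ?N" for i using that e by (auto dest!: bij_betwE)
  let ?c = "\<lambda>a b. a \<otimes> b \<otimes> inv a \<otimes> inv b"
  define A :: "int mat" where
    "A = mat ?N ?N (\<lambda>(i, j). \<Sum>b\<in>carrier G. \<Sum>a\<in>carrier G. if e j = ?c a b \<otimes> e i then 1 else 0)"
  have A: "A \<in> carrier_mat ?N ?N" by (simp add: A_def)
  define v where "v = vec ?N (\<lambda>i. \<rho> (e i) $$ (0, 0))"
  have v: "v \<in> carrier_vec ?N" by (simp add: v_def)
  have "v \<noteq> 0\<^sub>v ?N"
  proof
    assume "v = 0\<^sub>v ?N"
    moreover obtain i where i: "i < ?N" "e i = \<one>" using bij_betw_imp_surj_on[OF e] one_closed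
      by (metis atLeastLessThan_iff imageE)
    ultimately have "v $ i = 0" by simp
    then show False using i rD(3) n by (simp add: v_def)
  qed
  moreover have "map_mat of_int A *\<^sub>v v = \<alpha> \<cdot>\<^sub>v v"
  proof (intro eq_vecI)
    fix i assume "i < dim_vec (\<alpha> \<cdot>\<^sub>v v)"
    then have i: "i < ?N" by (simp add: v_def)
    have "(map_mat of_int A *\<^sub>v v) $ i = (\<Sum>j<?N. (map_mat of_int A) $$ (i, j) * v $ j)"
      using A v i by (intro mat_vec_entry) auto
    also have "\<dots> = (\<Sum>j<?N. \<Sum>b\<in>carrier G. \<Sum>a\<in>carrier G. if e j = ?c a b \<otimes> e i then \<rho> (e j) $$ (0, 0) else 0)"
      using i by (intro sum.cong refl)
        (simp add: A_def v_def sum_distrib_right if_distrib[of of_int] if_distrib[of "\<lambda>x. x * _"] cong: if_cong)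
    also have "\<dots> = (\<Sum>x\<in>carrier G. \<Sum>b\<in>carrier G. \<Sum>a\<in>carrier G. if x = ?c a b \<otimes> e i then \<rho> x $$ (0, 0) else 0)"
      using sum.reindex_bij_betw[OF e, of "\<lambda>x. \<Sum>b\<in>carrier G. \<Sum>a\<in>carrier G. if x = ?c a b \<otimes> e i then \<rho> x $$ (0, 0) else 0"]
      by (simp add: lessThan_atLeast0)
    also have "\<dots> = (\<Sum>b\<in>carrier G. \<Sum>a\<in>carrier G. \<Sum>x\<in>carrier G. if x = ?c a b \<otimes> e i then \<rho> x $$ (0, 0) else 0)"
      by (subst sum.swap) (intro sum.cong refl sum.swap)
    also have "\<dots> = (\<Sum>b\<in>carrier G. \<Sum>a\<in>carrier G. \<rho> (?c a b \<otimes> e i) $$ (0, 0))"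
      using eG[OF i] by (intro sum.cong refl) simp
    also have "\<dots> = (\<Sum>b\<in>carrier G. \<Sum>a\<in>carrier G. (\<rho> (?c a b) * \<rho> (e i)) $$ (0, 0))"
      using eG[OF i] rD(2) by (intro sum.cong refl) simp
    also have "\<dots> = (mat_sum n n (\<lambda>b. mat_sum n n (\<lambda>a. \<rho> (?c a b)) (carrier G) * \<rho> (e i)) (carrier G)) $$ (0, 0)"
    proof -
      have "mat_sum n n (\<lambda>a. \<rho> (?c a b)) (carrier G) * \<rho> (e i) = mat_sum n n (\<lambda>a. \<rho> (?c a b) * \<rho> (e i)) (carrier G)"
        if "b \<in> carrier G" for b
        using rD(1) eG[OF i] that by (intro mat_sum_mult) auto
      then show ?thesis using n by (simp del: index_mult_mat)
    qed
    also have "mat_sum n n (\<lambda>b. mat_sum n n (\<lambda>a. \<rho> (?c a b)) (carrier G) * \<rho> (e i)) (carrier G) =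
        mat_sum n n (\<lambda>b. mat_sum n n (\<lambda>a. \<rho> (?c a b)) (carrier G)) (carrier G) * \<rho> (e i)"
      using rD(1) eG[OF i] by (intro mat_sum_mult[symmetric]) auto
    also have "\<dots> = \<alpha> \<cdot>\<^sub>m \<rho> (e i)"
      unfolding commutator_sum[OF \<rho>] \<alpha>_def using mult_smult_one(2)[OF rD(1)[OF eG[OF i]]] by simp
    also have "(\<alpha> \<cdot>\<^sub>m \<rho> (e i)) $$ (0, 0) = (\<alpha> \<cdot>\<^sub>v v) $ i"
      using rD(1)[OF eG[OF i]] n i by (simp add: v_def)
    finally show "(map_mat of_int A *\<^sub>v v) $ i = (\<alpha> \<cdot>\<^sub>v v) $ i" .
  qed (use A in \<open>auto simp: v_def\<close>)
  ultimately have "eigenvalue (map_mat of_int A) \<alpha>"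
    using A v unfolding eigenvalue_def eigenvector_def by (intro exI[of _ v]) auto
  then have root: "poly (char_poly (map_mat of_int A)) \<alpha> = 0"
    using eigenvalue_root_char_poly[of "map_mat of_int A" ?N \<alpha>] A by simp
  have "algebraic_int \<alpha>"
  proof (rule algebraic_int.intros)
    show "lead_coeff (char_poly (map_mat of_int A :: complex mat)) = 1"
      using degree_monic_char_poly[of "map_mat of_int A :: complex mat" ?N] A by auto
    show "\<forall>i. poly.coeff (char_poly (map_mat of_int A :: complex mat)) i \<in> \<int>"
      using of_int_hom.char_poly_hom[OF A, where 'a = complex] by simp
  qed (rule root)
  moreover have "\<alpha> \<in> \<rat>" unfolding \<alpha>_def by simp
  ultimately have "\<alpha> \<in> \<int>" by (rule rational_algebraic_int_is_int)
  then obtain z where z: "\<alpha> = of_int z" by (elim Ints_cases)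
  then have "(of_nat ?N)\<^sup>2 = of_int z * (of_nat n :: complex)\<^sup>2"
    using n unfolding \<alpha>_def by (simp add: field_simps)
  then have "(of_int ((int ?N)\<^sup>2) :: complex) = of_int (z * (int n)\<^sup>2)" by simp
  then have "(int ?N)\<^sup>2 = z * (int n)\<^sup>2" by (simp only: of_int_eq_iff)
  then have "(int n)\<^sup>2 dvd (int ?N)\<^sup>2" by simp
  then have "int n dvd int ?N" by simp
  then show ?thesis by simp
qed

end


section \<open>Linear characters\<close>

definition linear_characters :: "('a, 'b) monoid_scheme \<Rightarrow> ('a \<Rightarrow> complex) set" where
  "linear_characters G = {\<mu>. \<mu> \<in> extensional (carrier G) \<and> \<mu> \<one>\<^bsub>G\<^esub> = 1 \<and>
     (\<forall>g\<in>carrier G. \<forall>h\<in>carrier G. \<mu> (g \<otimes>\<^bsub>G\<^esub> h) = \<mu> g * \<mu> h)}"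

definition linear_character_group :: "('a, 'b) monoid_scheme \<Rightarrow> ('a \<Rightarrow> complex) monoid" where
  "linear_character_group G = \<lparr>carrier = linear_characters G,
     monoid.mult = (\<lambda>\<alpha> \<beta>. \<lambda>g\<in>carrier G. \<alpha> g * \<beta> g), one = (\<lambda>g\<in>carrier G. 1)\<rparr>"

lemma coprime_powers_eq_one:
  fixes z :: "'c :: idom"
  assumes "z ^ a = 1" "z ^ b = 1" "coprime a b"
  shows "z = 1"
proof (cases "a = 0")
  case False
  obtain x y where "a * x = b * y + gcd a b" using bezout_nat[OF False, of b] by blast
  then have "z ^ (a * x) = z ^ (b * y) * z" using assms(3) by (simp add: power_add)
  then show ?thesis using assms(1,2) by (simp add: power_mult)
qed (use assms in simp)

context fin_group
begin

lemma linD: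
  assumes "\<mu> \<in> linear_characters G"
  shows "\<mu> \<in> extensional (carrier G)" "\<mu> \<one> = 1"
    "g \<in> carrier G \<Longrightarrow> h \<in> carrier G \<Longrightarrow> \<mu> (g \<otimes> h) = \<mu> g * \<mu> h"
  using assms unfolding linear_characters_def by auto

lemma linI:
  assumes "\<mu> \<in> extensional (carrier G)" "\<mu> \<one> = 1"
    "\<And>g h. g \<in> carrier G \<Longrightarrow> h \<in> carrier G \<Longrightarrow> \<mu> (g \<otimes> h) = \<mu> g * \<mu> h"
  shows "\<mu> \<in> linear_characters G"
  using assms unfolding linear_characters_def by auto

lemma lin_inv:
  assumes "\<mu> \<in> linear_characters G" "g \<in> carrier G"
  shows "\<mu> g * \<mu> (inv g) = 1" "\<mu> g \<noteq> 0"
  using linD(2)[OF assms(1)] linD(3)[OF assms(1) assms(2), of "inv g"] assms(2) by auto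

lemma lin_pow:
  assumes "\<mu> \<in> linear_characters G" "g \<in> carrier G"
  shows "\<mu> (g [^] (k::nat)) = \<mu> g ^ k"
  using linD[OF assms(1)] assms(2) by (induction k) (auto simp: nat_pow_Suc)

lemma lin_eqI:
  assumes "\<alpha> \<in> linear_characters G" "\<beta> \<in> linear_characters G" "\<And>g. g \<in> carrier G \<Longrightarrow> \<alpha> g = \<beta> g"
  shows "\<alpha> = \<beta>"
  using assms linD(1) by (blast intro: extensionalityI)

lemma lin_group_simps [simp]:
  "carrier (linear_character_group G) = linear_characters G"
  "\<alpha> \<otimes>\<^bsub>linear_character_group G\<^esub> \<beta> = (\<lambda>g\<in>carrier G. \<alpha> g * \<beta> g)"
  "\<one>\<^bsub>linear_character_group G\<^esub> = (\<lambda>g\<in>carrier G. 1)"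
  by (simp_all add: linear_character_group_def)

lemma lin_mult_closed: "\<alpha> \<in> linear_characters G \<Longrightarrow> \<beta> \<in> linear_characters G \<Longrightarrow>
    (\<lambda>g\<in>carrier G. \<alpha> g * \<beta> g) \<in> linear_characters G"
  by (intro linI) (auto simp: linD)

lemma lin_one_closed: "(\<lambda>g\<in>carrier G. 1) \<in> linear_characters G"
  by (intro linI) auto

lemma lin_inv_closed:
  assumes "\<alpha> \<in> linear_characters G"
  shows "(\<lambda>g\<in>carrier G. inverse (\<alpha> g)) \<in> linear_characters G"
  by (intro linI) (auto simp: linD[OF assms])

lemma lin_comm_group: "comm_group (linear_character_group G)"
proof (rule comm_groupI)
  fix \<alpha> assume "\<alpha> \<in> carrier (linear_character_group G)"
  then have a: "\<alpha> \<in> linear_characters G" by simp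
  have "(\<lambda>g\<in>carrier G. (\<lambda>g\<in>carrier G. inverse (\<alpha> g)) g * \<alpha> g) = (\<lambda>g\<in>carrier G. 1)"
    using lin_inv(2)[OF a] by (intro restrict_ext) simp
  then show "\<exists>\<beta>\<in>carrier (linear_character_group G).
      \<beta> \<otimes>\<^bsub>linear_character_group G\<^esub> \<alpha> = \<one>\<^bsub>linear_character_group G\<^esub>"
    using lin_inv_closed[OF a] by (intro bexI[of _ "\<lambda>g\<in>carrier G. inverse (\<alpha> g)"]) auto
next
  fix \<alpha> assume "\<alpha> \<in> carrier (linear_character_group G)"
  then have a: "\<alpha> \<in> linear_characters G" by simp
  show "\<one>\<^bsub>linear_character_group G\<^esub> \<otimes>\<^bsub>linear_character_group G\<^esub> \<alpha> = \<alpha>"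
    using linD(1)[OF a] by (auto intro!: extensionalityI[of _ "carrier G"])
qed (auto simp: lin_mult_closed lin_one_closed mult_ac intro!: restrict_ext)

lemma lin_group_pow:
  assumes "\<alpha> \<in> linear_characters G" "g \<in> carrier G"
  shows "(\<alpha> [^]\<^bsub>linear_character_group G\<^esub> (k::nat)) g = \<alpha> g ^ k"
proof -
  interpret L: comm_group "linear_character_group G" by (rule lin_comm_group)
  show ?thesis using assms by (induction k) (auto simp: L.nat_pow_Suc mult_ac)
qed

lemma lin_representation:
  assumes "\<mu> \<in> linear_characters G"
  shows "irreducible_representation G 1 (\<lambda>g. \<mu> g \<cdot>\<^sub>m 1\<^sub>m 1)"
    "character_of G (\<lambda>g. \<mu> g \<cdot>\<^sub>m 1\<^sub>m 1) = \<mu>"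
proof -
  have r: "representation G 1 (\<lambda>g. \<mu> g \<cdot>\<^sub>m 1\<^sub>m 1)"
    unfolding rep_iff using linD[OF assms] mult_smult_one(1)[of "_ \<cdot>\<^sub>m 1\<^sub>m 1" 1 1]
    by (auto simp: smult_smult_mat one_smult_mat mult.commute)
  show "irreducible_representation G 1 (\<lambda>g. \<mu> g \<cdot>\<^sub>m 1\<^sub>m 1)"
  proof (rule irreducible_if_commutant_scalar[OF r])
    fix E :: "complex mat" assume "E \<in> carrier_mat 1 1"
    then have "E = (E $$ (0, 0)) \<cdot>\<^sub>m 1\<^sub>m 1" by (intro eq_matI) auto
    then show "\<exists>c. E = c \<cdot>\<^sub>m 1\<^sub>m 1" by blast
  qed simp
  show "character_of G (\<lambda>g. \<mu> g \<cdot>\<^sub>m 1\<^sub>m 1) = \<mu>"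
    using linD(1)[OF assms] by (intro extensionalityI[of _ "carrier G"]) (auto simp: character_of_def mat_trace_def)
qed

lemma lin_in_Irr: "linear_characters G \<subseteq> Irr G"
  using lin_representation IrrI by (metis subsetI)

lemma finite_lin: "finite (linear_characters G)"
  using lin_in_Irr finite_Irr finite_subset by blast

lemma degree_one_character:
  assumes "representation G 1 \<sigma>"
  shows "character_of G \<sigma> \<in> linear_characters G"
    "g \<in> carrier G \<Longrightarrow> \<sigma> g = character_of G \<sigma> g \<cdot>\<^sub>m 1\<^sub>m 1"
proof -
  note D = repD[OF assms]
  have tr: "mat_trace (\<sigma> g) = \<sigma> g $$ (0, 0)" if "g \<in> carrier G" for g
    using D(1)[OF that] by (auto simp: mat_trace_def)
  show "character_of G \<sigma> \<in> linear_characters G"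
  proof (intro linI)
    fix g h assume gh: "g \<in> carrier G" "h \<in> carrier G"
    have "(\<sigma> g * \<sigma> h) $$ (0, 0) = \<sigma> g $$ (0, 0) * \<sigma> h $$ (0, 0)"
      using D(1)[OF gh(1)] D(1)[OF gh(2)] by (subst mat_mult_entry[of _ 1 1 _ 1]) auto
    then show "character_of G \<sigma> (g \<otimes> h) = character_of G \<sigma> g * character_of G \<sigma> h"
      using gh tr[of "g \<otimes> h"] tr[OF gh(1)] tr[OF gh(2)] D(2)[OF gh] by simp
  qed (use D in \<open>auto simp: character_of_def\<close>)
  show "\<sigma> g = character_of G \<sigma> g \<cdot>\<^sub>m 1\<^sub>m 1" if "g \<in> carrier G"
    using D(1)[OF that] tr[OF that] that by (intro eq_matI) auto
qed

text \<open>
  Every matrix commutes with scalars, so a matrix unit would be scalar by Schur's lemma.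
\<close>

lemma scalar_irreducible_degree_one:
  assumes \<sigma>: "irreducible_representation G m \<sigma>" and sc: "\<And>g. g \<in> carrier G \<Longrightarrow> \<exists>c. \<sigma> g = c \<cdot>\<^sub>m 1\<^sub>m m"
  shows "m = 1"
proof (rule ccontr)
  assume "m \<noteq> 1"
  then have m: "1 < m" using irr_pos[OF \<sigma>] by simp
  let ?E = "mat_single m m 0 0"
  have E: "?E \<in> carrier_mat m m" by (simp add: mat_single_def)
  have "\<sigma> g * ?E = ?E * \<sigma> g" if g: "g \<in> carrier G" for g
    using sc[OF g] mult_smult_one[OF E] by auto
  then obtain c where c: "?E = c \<cdot>\<^sub>m 1\<^sub>m m" using schur_scalar[OF \<sigma> E] by blast
  have "?E $$ (0, 0) = 1" "?E $$ (1, 1) = 0" using m by (auto simp: mat_single_def)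
  moreover have "?E $$ (0, 0) = c" "?E $$ (1, 1) = c" unfolding c using m by auto
  ultimately show False by simp
qed

lemma lin_trivial_on_derived:
  assumes \<mu>: "\<mu> \<in> linear_characters G" and d: "d \<in> derived G (carrier G)"
  shows "\<mu> d = 1"
proof -
  let ?K = "{g \<in> carrier G. \<mu> g = 1}"
  have iv: "\<mu> (inv g) = inverse (\<mu> g)" if "g \<in> carrier G" for g
    using lin_inv[OF \<mu> that] by (simp add: field_simps)
  have K: "subgroup ?K G"
    using linD[OF \<mu>] iv by (intro subgroupI) auto
  have "derived_set G (carrier G) \<subseteq> ?K"
    by (auto simp: linD(3)[OF \<mu>] iv lin_inv(2)[OF \<mu>] field_simps)
  then have "derived G (carrier G) \<subseteq> ?K"
    unfolding derived_def by (rule generate_subgroup_incl[OF _ K])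
  then show ?thesis using d by blast
qed

text \<open>
  Expand the indicator function of \<open>G'\<close> as \<open>|G'| / |G|\<close> times the sum of the linear characters and
  evaluate at the identity. On a nonlinear irreducible representation the sum over \<open>G'\<close> acts as a
  scalar, and this scalar is zero because otherwise \<open>G'\<close>, hence every commutator, would act
  trivially.
\<close>

theorem card_linear_characters:
  "card (linear_characters G) * card (derived G (carrier G)) = card (carrier G)"
proof -
  let ?D = "derived G (carrier G)"
  have DG: "?D \<subseteq> carrier G" by (rule derived_in_carrier) simp
  have nD: "?D \<lhd> G" by (rule derived_self_is_normal)
  interpret D: normal ?D G by (rule nD)
  have fD: "finite ?D" using finite_subset[OF DG fin] .
  let ?d = "of_nat (card ?D) :: complex"
  have "(if \<one> \<in> ?D then 1 else 0) = (\<Sum>\<mu>\<in>linear_characters G. ?d / ord_G * \<mu> \<one>)"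
  proof (rule character_expansion[OF lin_in_Irr, where h = "\<lambda>g. if g \<in> ?D then 1 else 0"
        and c = "\<lambda>_. ?d / ord_G"])
    fix m \<sigma> assume \<sigma>: "irreducible_representation G m \<sigma>"
    note s = irr_rep[OF \<sigma>] and sD = repD[OF irr_rep[OF \<sigma>]]
    let ?S = "mat_sum m m (\<lambda>g. \<sigma> (inv g)) ?D"
    have Sc: "?S \<in> carrier_mat m m" by simp
    have S: "?S = (if m = 1 then ?d else 0) \<cdot>\<^sub>m 1\<^sub>m m"
    proof (cases "m = 1")
      case True
      have "?S = mat_sum 1 1 (\<lambda>g. 1\<^sub>m 1) ?D"
        unfolding True
      proof (intro mat_sum_cong)
        fix g assume g: "g \<in> ?D"
        then have "inv g \<in> ?D" by (rule D.m_inv_closed)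
        then have "character_of G \<sigma> (inv g) = 1"
          using degree_one_character(1)[of \<sigma>] lin_trivial_on_derived s True by blast
        then show "\<sigma> (inv g) = 1\<^sub>m 1"
          using degree_one_character(2)[of \<sigma> "inv g"] s True g DG by (auto simp: one_smult_mat)
      qed
      then show ?thesis using True by (simp add: mat_sum_const[of _ "Suc 0" "Suc 0"])
    next
      case False
      have comm: "\<sigma> h * ?S = ?S * \<sigma> h" if h: "h \<in> carrier G" for h
      proof -
        have bij: "bij_betw (\<lambda>g. h \<otimes> g \<otimes> inv h) ?D ?D"
        proof (intro bij_betwI[where g = "\<lambda>g. inv h \<otimes> g \<otimes> h"])
          show "(\<lambda>g. h \<otimes> g \<otimes> inv h) \<in> ?D \<rightarrow> ?D" using D.inv_op_closed2 h by auto
          show "(\<lambda>g. inv h \<otimes> g \<otimes> h) \<in> ?D \<rightarrow> ?D" using D.inv_op_closed1 h by auto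
        next
          fix g assume "g \<in> ?D"
          then have g: "g \<in> carrier G" using DG by blast
          show "inv h \<otimes> (h \<otimes> g \<otimes> inv h) \<otimes> h = g"
            using h g by (simp add: m_assoc inv_solve_left')
          show "h \<otimes> (inv h \<otimes> g \<otimes> h) \<otimes> inv h = g"
            using h g by (simp add: m_assoc) (simp add: m_assoc[symmetric])
        qed
        have "\<sigma> h * ?S = mat_sum m m (\<lambda>g. \<sigma> h * \<sigma> (inv g)) ?D"
          using sD(1) h DG by (intro mult_mat_sum) auto
        also have "\<dots> = mat_sum m m (\<lambda>g. \<sigma> (inv (h \<otimes> g \<otimes> inv h)) * \<sigma> h) ?D"
        proof (intro mat_sum_cong)
          fix g assume "g \<in> ?D"
          then have g: "g \<in> carrier G" using DG by blast
          have "inv (h \<otimes> g \<otimes> inv h) \<otimes> h = h \<otimes> inv g"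
            using g h by (simp add: inv_mult_group m_assoc)
          then show "\<sigma> h * \<sigma> (inv g) = \<sigma> (inv (h \<otimes> g \<otimes> inv h)) * \<sigma> h"
            using sD(2)[of h "inv g"] sD(2)[of "inv (h \<otimes> g \<otimes> inv h)" h] g h by simp
        qed
        also have "\<dots> = mat_sum m m (\<lambda>g. \<sigma> (inv g) * \<sigma> h) ?D"
          by (rule mat_sum_reindex[OF bij, where F = "\<lambda>g. \<sigma> (inv g) * \<sigma> h"])
        also have "\<dots> = ?S * \<sigma> h"
          using sD(1) h DG by (intro mat_sum_mult[symmetric]) auto
        finally show ?thesis .
      qed
      obtain c where c: "?S = c \<cdot>\<^sub>m 1\<^sub>m m" using schur_scalar[OF \<sigma> Sc] comm by blast
      have "c = 0"
      proof (rule ccontr)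
        assume c0: "c \<noteq> 0"
        have triv: "\<sigma> x = 1\<^sub>m m" if x: "x \<in> ?D" for x
        proof -
          have xG: "x \<in> carrier G" using x DG by blast
          have bij: "bij_betw (\<lambda>g. g \<otimes> inv x) ?D ?D"
          proof (intro bij_betwI[where g = "\<lambda>g. g \<otimes> x"])
            show "(\<lambda>g. g \<otimes> inv x) \<in> ?D \<rightarrow> ?D" "(\<lambda>g. g \<otimes> x) \<in> ?D \<rightarrow> ?D"
              using x D.m_closed D.m_inv_closed by auto
          next
            fix g assume "g \<in> ?D"
            then have "g \<in> carrier G" using DG by blast
            then show "g \<otimes> inv x \<otimes> x = g" "g \<otimes> x \<otimes> inv x = g" using xG by (simp_all add: m_assoc)
          qed
          have "\<sigma> x * ?S = mat_sum m m (\<lambda>g. \<sigma> x * \<sigma> (inv g)) ?D"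
            using sD(1) xG DG by (intro mult_mat_sum) auto
          also have "\<dots> = mat_sum m m (\<lambda>g. \<sigma> (inv (g \<otimes> inv x))) ?D"
          proof (intro mat_sum_cong)
            fix g assume "g \<in> ?D"
            then have g: "g \<in> carrier G" using DG by blast
            then show "\<sigma> x * \<sigma> (inv g) = \<sigma> (inv (g \<otimes> inv x))"
              using sD(2)[of x "inv g"] xG by (simp add: inv_mult_group)
          qed
          also have "\<dots> = ?S" by (rule mat_sum_reindex[OF bij, where F = "\<lambda>g. \<sigma> (inv g)"])
          finally have "c \<cdot>\<^sub>m \<sigma> x = c \<cdot>\<^sub>m 1\<^sub>m m"
            unfolding c using mult_smult_one(1)[OF sD(1)[OF xG]] by simp
          then show ?thesis using smult_mat_cancel[OF c0] by blast
        qed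
        have "\<exists>c. \<sigma> g = c \<cdot>\<^sub>m 1\<^sub>m m" if g: "g \<in> carrier G" for g
        proof -
          have "\<sigma> h * \<sigma> g = \<sigma> g * \<sigma> h" if h: "h \<in> carrier G" for h
          proof -
            have "h \<otimes> g \<otimes> inv h \<otimes> inv g \<in> ?D"
              unfolding derived_def using g h by (intro generate.incl) auto
            then have "\<sigma> (h \<otimes> g \<otimes> inv h \<otimes> inv g) = 1\<^sub>m m" by (rule triv)
            then have "\<sigma> (h \<otimes> g \<otimes> inv h \<otimes> inv g) * \<sigma> (g \<otimes> h) = \<sigma> (g \<otimes> h)"
              using sD(1)[of "g \<otimes> h"] g h by simp
            moreover have "\<sigma> (h \<otimes> g \<otimes> inv h \<otimes> inv g) * \<sigma> (g \<otimes> h) = \<sigma> (h \<otimes> g \<otimes> inv h \<otimes> inv g \<otimes> (g \<otimes> h))"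
              using g h by (intro sD(2)[symmetric]) auto
            moreover have "h \<otimes> g \<otimes> inv h \<otimes> inv g \<otimes> (g \<otimes> h) = h \<otimes> g"
              using g h by (simp add: m_assoc inv_solve_left')
            ultimately show ?thesis using sD(2) g h by simp
          qed
          then show ?thesis using schur_scalar[OF \<sigma> sD(1)[OF g]] by blast
        qed
        then show False using scalar_irreducible_degree_one[OF \<sigma>] False by blast
      qed
      then show ?thesis using c False by simp
    qed
    have lin_iff: "character_of G \<sigma> \<in> linear_characters G \<longleftrightarrow> m = 1"
      using degree_one_character(1) s linD(2) character_of_at_one[OF s] by (metis of_nat_eq_1_iff)
    have "mat_sum m m (\<lambda>g. (if g \<in> ?D then 1 else 0) \<cdot>\<^sub>m \<sigma> (inv g)) (carrier G) = ?S"
    proof (intro eq_matI)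
      fix i j assume "i < dim_row ?S" "j < dim_col ?S"
      then have ij: "i < m" "j < m" by auto
      have "(\<Sum>g\<in>carrier G. ((if g \<in> ?D then 1 else 0) \<cdot>\<^sub>m \<sigma> (inv g)) $$ (i, j)) =
          (\<Sum>g\<in>carrier G. if g \<in> ?D then \<sigma> (inv g) $$ (i, j) else 0)"
        using ij carrier_matD[OF sD(1)[OF inv_closed]] by (intro sum.cong refl) auto
      then show "mat_sum m m (\<lambda>g. (if g \<in> ?D then 1 else 0) \<cdot>\<^sub>m \<sigma> (inv g)) (carrier G) $$ (i, j) = ?S $$ (i, j)"
        using ij DG by (simp add: sum.If_cases Int_absorb1)
    qed auto
    then show "mat_sum m m (\<lambda>g. (if g \<in> ?D then 1 else 0) \<cdot>\<^sub>m \<sigma> (inv g)) (carrier G) =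
        (if character_of G \<sigma> \<in> linear_characters G then ?d / ord_G * ord_G / of_nat m else 0) \<cdot>\<^sub>m 1\<^sub>m m"
      unfolding S lin_iff by simp
  qed simp
  also have "\<dots> = ?d / ord_G * of_nat (card (linear_characters G))" by (simp add: linD(2))
  finally have "of_nat (card (linear_characters G) * card ?D) = ord_G"
    using D.one_closed by (simp add: field_simps)
  then show ?thesis by (simp only: of_nat_eq_iff)
qed

lemma subgroup_index_derived: "subgroup_index G (derived G (carrier G)) = card (linear_characters G)"
proof -
  have sub: "subgroup (derived G (carrier G)) G" by (rule derived_is_subgroup) simp
  have pos: "card (derived G (carrier G)) \<noteq> 0"
    using subgroup.one_closed[OF sub] finite_subset[OF subgroup.subset[OF sub]] by auto
  have "card (rcosets (derived G (carrier G))) * card (derived G (carrier G)) = Coset.order G"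
    by (rule lagrange[OF sub])
  then show ?thesis
    using card_linear_characters pos unfolding subgroup_index_def Coset.order_def
    by (metis mult_right_cancel)
qed

lemma lin_pow_card:
  assumes "\<mu> \<in> linear_characters G" "g \<in> carrier G"
  shows "\<mu> g ^ card (linear_characters G) = 1"
proof -
  interpret L: comm_group "linear_character_group G" by (rule lin_comm_group)
  have "\<mu> [^]\<^bsub>linear_character_group G\<^esub> Coset.order (linear_character_group G) = (\<lambda>g\<in>carrier G. 1)"
    using L.pow_order_eq_1[of \<mu>] assms(1) by simp
  then have "(\<mu> [^]\<^bsub>linear_character_group G\<^esub> Coset.order (linear_character_group G)) g = 1" using assms(2) by simp
  then show ?thesis using lin_group_pow[OF assms] by (simp add: Coset.order_def)
qed

lemma card_lin_pos: "0 < card (linear_characters G)"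
  using lin_one_closed finite_lin by (auto simp: card_gt_0_iff)

text \<open>
  Cauchy's theorem in the group of linear characters.
\<close>

lemma lin_of_prime_order:
  assumes p: "prime p" and dvd: "p dvd card (linear_characters G)"
  obtains \<mu> x where "\<mu> \<in> linear_characters G" "\<And>g. g \<in> carrier G \<Longrightarrow> \<mu> g ^ p = 1" "x \<in> carrier G" "\<mu> x \<noteq> 1"
proof -
  interpret L: comm_group "linear_character_group G" by (rule lin_comm_group)
  obtain m where "Coset.order (linear_character_group G) = p ^ 1 * m"
    using dvd by (auto simp: Coset.order_def)
  then obtain H where H: "subgroup H (linear_character_group G)" "card H = p"
    using sylow_thm[OF p L.is_group, of 1 m] finite_lin by auto
  have "1 < card H" using H(2) p prime_gt_1_nat by simp
  moreover have fH: "finite H" using subgroup.subset[OF H(1)] finite_lin finite_subset by auto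
  ultimately obtain \<mu> where \<mu>: "\<mu> \<in> H" "\<mu> \<noteq> (\<lambda>g\<in>carrier G. 1)"
    by (metis card_le_Suc0_iff_eq leD One_nat_def)
  have \<mu>L: "\<mu> \<in> linear_characters G" using \<mu>(1) subgroup.subset[OF H(1)] by auto
  interpret H: group "(linear_character_group G)\<lparr>carrier := H\<rparr>" by (rule L.subgroup_imp_group[OF H(1)])
  have "\<mu> [^]\<^bsub>(linear_character_group G)\<lparr>carrier := H\<rparr>\<^esub> p = \<one>\<^bsub>linear_character_group G\<^esub>"
    using H.pow_order_eq_1[of \<mu>] \<mu>(1) H(2) by (simp add: Coset.order_def)
  then have pw: "\<mu> [^]\<^bsub>linear_character_group G\<^esub> p = (\<lambda>g\<in>carrier G. 1)"
    using L.nat_pow_consistent[of \<mu> p H] by simp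
  have "\<mu> g ^ p = 1" if "g \<in> carrier G" for g
    using lin_group_pow[OF \<mu>L that, of p] pw that by simp
  moreover obtain x where "x \<in> carrier G" "\<mu> x \<noteq> 1"
    using \<mu>(2) lin_eqI[OF \<mu>L lin_one_closed] by auto
  ultimately show ?thesis using that \<mu>L by blast
qed

lemma prime_dvd_card_lin:
  assumes "prime p" "\<mu> \<in> linear_characters G" "x \<in> carrier G" "\<mu> x \<noteq> 1" "\<mu> x ^ p = 1"
  shows "p dvd card (linear_characters G)"
  using coprime_powers_eq_one[of "\<mu> x" p "card (linear_characters G)"] lin_pow_card[OF assms(2,3)] assms
    prime_imp_coprime by blast

text \<open>
  The last property holds because the quotient by the Sylow subgroup \<open>L\<close> has order \<open>m\<close>.
\<close>

lemma lin_sylow: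
  assumes p: "prime p" and card: "card (linear_characters G) = p ^ a * m"
  obtains L where "subgroup L (linear_character_group G)" "card L = p ^ a"
    "\<And>\<mu> g. \<mu> \<in> L \<Longrightarrow> g \<in> carrier G \<Longrightarrow> \<mu> g ^ (p ^ a) = 1"
    "\<And>\<mu>. \<mu> \<in> linear_characters G \<Longrightarrow> \<mu> [^]\<^bsub>linear_character_group G\<^esub> m \<in> L"
proof -
  let ?A = "linear_character_group G"
  interpret A: comm_group ?A by (rule lin_comm_group)
  have ord: "Coset.order ?A = p ^ a * m" using card by (simp add: Coset.order_def)
  obtain L where L: "subgroup L ?A" "card L = p ^ a"
    using sylow_thm[OF p A.is_group ord] finite_lin by auto
  have LA: "L \<subseteq> linear_characters G" using subgroup.subset[OF L(1)] by simp
  interpret LG: group "?A\<lparr>carrier := L\<rparr>" by (rule A.subgroup_imp_group[OF L(1)])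
  have 1: "\<mu> g ^ (p ^ a) = 1" if "\<mu> \<in> L" "g \<in> carrier G" for \<mu> g
  proof -
    have "\<mu> [^]\<^bsub>?A\<lparr>carrier := L\<rparr>\<^esub> (p ^ a) = \<one>\<^bsub>?A\<^esub>"
      using LG.pow_order_eq_1[of \<mu>] that(1) L(2) by (simp add: Coset.order_def)
    then have "\<mu> [^]\<^bsub>?A\<^esub> (p ^ a) = (\<lambda>g\<in>carrier G. 1)" using A.nat_pow_consistent[of \<mu> "p ^ a" L] by simp
    then show ?thesis using lin_group_pow[of \<mu> g "p ^ a"] that LA by auto
  qed
  have nL: "L \<lhd> ?A" by (rule A.subgroup_imp_normal[OF L(1)])
  interpret N: normal L ?A by (rule nL)
  interpret Q: group "?A Mod L" by (rule N.factorgroup_is_group)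
  have cQ: "Coset.order (?A Mod L) = m"
  proof -
    have "card (rcosets\<^bsub>?A\<^esub> L) * p ^ a = p ^ a * m" using A.lagrange[OF L(1)] L(2) ord by simp
    then have "card (rcosets\<^bsub>?A\<^esub> L) = m" using p prime_gt_0_nat by simp
    then show ?thesis by (simp add: Coset.order_def FactGroup_def)
  qed
  have 2: "\<mu> [^]\<^bsub>?A\<^esub> m \<in> L" if \<mu>: "\<mu> \<in> linear_characters G" for \<mu>
  proof -
    have c: "L #>\<^bsub>?A\<^esub> \<mu> \<in> carrier (?A Mod L)" using \<mu> by (auto simp: FactGroup_def RCOSETS_def)
    have "L #>\<^bsub>?A\<^esub> (\<mu> [^]\<^bsub>?A\<^esub> m) = (L #>\<^bsub>?A\<^esub> \<mu>) [^]\<^bsub>?A Mod L\<^esub> m"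
      using N.FactGroup_pow[of \<mu> m] \<mu> by simp
    also have "\<dots> = \<one>\<^bsub>?A Mod L\<^esub>" using Q.pow_order_eq_1[OF c] cQ by simp
    also have "\<dots> = L" by (simp add: FactGroup_def)
    finally show ?thesis using A.rcos_self[OF _ L(1), of "\<mu> [^]\<^bsub>?A\<^esub> m"] A.nat_pow_closed[of \<mu> m] \<mu> by simp
  qed
  show ?thesis using that[of L] L 1 2 by blast
qed

end


section \<open>Normalising determinants\<close>

definition degree_square_sum :: "('a, 'b) monoid_scheme \<Rightarrow> ('a \<Rightarrow> complex) set \<Rightarrow> nat" where
  "degree_square_sum G X = (\<Sum>\<chi>\<in>X. (char_degree G \<chi>)\<^sup>2)"

text \<open>
  For \<open>k = |G|\<^bsub>p'\<^esub>\<close> the condition on the determinant says that the linear character \<open>det \<rho>\<close> has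
  order prime to \<open>p\<close>. Stating it by \<open>k\<close> makes it inherited in both directions between \<open>G\<close> and a
  normal subgroup of index \<open>p\<close>, which has the same \<open>k\<close>.
\<close>

definition Irr_det :: "nat \<Rightarrow> nat \<Rightarrow> ('a, 'b) monoid_scheme \<Rightarrow> ('a \<Rightarrow> complex) set" where
  "Irr_det p k G = {character_of G \<rho> | n \<rho>. irreducible_representation G n \<rho> \<and> \<not> p dvd n \<and>
     (\<forall>g\<in>carrier G. det (\<rho> g) ^ k = 1)}"

context fin_group
begin

lemma Irr_det_subset: "Irr_det p k G \<subseteq> Irr G"
  unfolding Irr_det_def Irr_def by blast

lemma finite_Irr_det: "finite (Irr_det p k G)"
  using Irr_det_subset finite_Irr finite_subset by metis

lemma Irr_detE:
  assumes "\<chi> \<in> Irr_det p k G"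
  obtains n \<rho> where "irreducible_representation G n \<rho>" "\<chi> = character_of G \<rho>" "\<not> p dvd n"
    "\<And>g. g \<in> carrier G \<Longrightarrow> det (\<rho> g) ^ k = 1"
  using assms unfolding Irr_det_def by blast

lemma Irr_detI:
  assumes "irreducible_representation G n \<rho>" "\<not> p dvd n" "\<And>g. g \<in> carrier G \<Longrightarrow> det (\<rho> g) ^ k = 1"
  shows "character_of G \<rho> \<in> Irr_det p k G"
  using assms unfolding Irr_det_def by blast

lemma twist:
  assumes \<mu>: "\<mu> \<in> linear_characters G" and \<rho>: "irreducible_representation G n \<rho>"
  shows "irreducible_representation G n (\<lambda>g. \<mu> g \<cdot>\<^sub>m \<rho> g)"
    "character_of G (\<lambda>g. \<mu> g \<cdot>\<^sub>m \<rho> g) = (\<lambda>g\<in>carrier G. \<mu> g * character_of G \<rho> g)"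
    "g \<in> carrier G \<Longrightarrow> det (\<mu> g \<cdot>\<^sub>m \<rho> g) = \<mu> g ^ n * det (\<rho> g)"
proof -
  note rD = repD[OF irr_rep[OF \<rho>]] and lD = linD[OF \<mu>]
  have mult: "(\<mu> g * \<mu> h) \<cdot>\<^sub>m (\<rho> g * \<rho> h) = (\<mu> g \<cdot>\<^sub>m \<rho> g) * (\<mu> h \<cdot>\<^sub>m \<rho> h)"
    if gh: "g \<in> carrier G" "h \<in> carrier G" for g h
    using mult_smult_assoc_mat[of "\<rho> g" n n "\<mu> h \<cdot>\<^sub>m \<rho> h" n "\<mu> g"]
      mult_smult_distrib[of "\<rho> g" n n "\<rho> h" n "\<mu> h"] rD(1)[OF gh(1)] rD(1)[OF gh(2)]
    by (simp add: smult_smult_mat)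
  have r: "representation G n (\<lambda>g. \<mu> g \<cdot>\<^sub>m \<rho> g)"
    unfolding rep_iff using rD lD mult by (auto simp: one_smult_mat)
  show "irreducible_representation G n (\<lambda>g. \<mu> g \<cdot>\<^sub>m \<rho> g)"
  proof (rule irreducible_if_commutant_scalar[OF r irr_pos[OF \<rho>]])
    fix E assume E: "E \<in> carrier_mat n n"
      and comm: "\<And>g. g \<in> carrier G \<Longrightarrow> (\<mu> g \<cdot>\<^sub>m \<rho> g) * E = E * (\<mu> g \<cdot>\<^sub>m \<rho> g)"
    have "\<rho> g * E = E * \<rho> g" if g: "g \<in> carrier G" for g
    proof -
      have "\<mu> g \<cdot>\<^sub>m (\<rho> g * E) = \<mu> g \<cdot>\<^sub>m (E * \<rho> g)"
        using comm[OF g] mult_smult_assoc_mat[OF rD(1)[OF g] E] mult_smult_distrib[OF E rD(1)[OF g]] by simp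
      then show ?thesis using smult_mat_cancel lin_inv(2)[OF \<mu> g] by blast
    qed
    then obtain c where "E = c \<cdot>\<^sub>m 1\<^sub>m n" using schur_scalar[OF \<rho> E] by blast
    then show "\<exists>c. E = c \<cdot>\<^sub>m 1\<^sub>m n" by blast
  qed
  show "character_of G (\<lambda>g. \<mu> g \<cdot>\<^sub>m \<rho> g) = (\<lambda>g\<in>carrier G. \<mu> g * character_of G \<rho> g)"
    using rD(1) by (auto simp: character_of_def mat_trace_smult[of _ n] intro!: restrict_ext)
  show "det (\<mu> g \<cdot>\<^sub>m \<rho> g) = \<mu> g ^ n * det (\<rho> g)" if "g \<in> carrier G"
    using rD(1)[OF that] by simp
qed

lemma det_linear_character:
  assumes "representation G n \<rho>"
  shows "(\<lambda>g\<in>carrier G. det (\<rho> g)) \<in> linear_characters G"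
  using repD[OF assms] by (intro linI) (auto simp: det_mult[of _ n])

lemma same_character_same_det:
  assumes "irreducible_representation G n \<rho>" "irreducible_representation G m \<sigma>"
    "character_of G \<rho> = character_of G \<sigma>"
  shows "n = m" "g \<in> carrier G \<Longrightarrow> det (\<rho> g) = det (\<sigma> g)"
proof -
  obtain X where X: "n = m" "equivalent_by n X \<rho> \<sigma>" using equivalent_if_same_character[OF assms] .
  show "n = m" by fact
  show "det (\<rho> g) = det (\<sigma> g)" if "g \<in> carrier G"
    using equivalent_trace_det(2)[OF X(2) that] repD(1)[OF irr_rep[OF assms(1)] that]
      repD(1)[OF irr_rep[OF assms(2)] that] X(1) by blast
qed

text \<open>
  The Sylow \<open>p\<close>-subgroup \<open>L\<close> of the group of linear characters acts freely on the irreducible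
  characters of degree prime to \<open>p\<close>, since twisting by \<open>\<mu>\<close> changes the determinant by the power
  \<open>\<mu>\<^bsup>\<chi>(1)\<^esup>\<close> and \<open>\<chi>(1)\<close> is invertible modulo \<open>|L|\<close>. For the same reason every orbit contains exactly
  one character whose determinant has order prime to \<open>p\<close>.
\<close>

theorem u_pprime_factorisation:
  assumes p: "prime p" and card: "card (linear_characters G) = p ^ a * m" and mk: "m dvd k" and pk: "\<not> p dvd k"
  shows "u_pprime p G = p ^ a * degree_square_sum G (Irr_det p k G)"
proof -
  let ?A = "linear_character_group G"
  obtain L where L: "subgroup L ?A" "card L = p ^ a"
    "\<And>\<mu> g. \<mu> \<in> L \<Longrightarrow> g \<in> carrier G \<Longrightarrow> \<mu> g ^ (p ^ a) = 1"
    "\<And>\<mu>. \<mu> \<in> linear_characters G \<Longrightarrow> \<mu> [^]\<^bsub>?A\<^esub> m \<in> L"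
    using lin_sylow[OF p card] by metis
  interpret A: comm_group ?A by (rule lin_comm_group)
  have LA: "L \<subseteq> linear_characters G" using subgroup.subset[OF L(1)] by simp
  have Lpow: "\<mu> [^]\<^bsub>?A\<^esub> (j::nat) \<in> L" if "\<mu> \<in> L" for \<mu> j
    using that subgroup.m_closed[OF L(1)] subgroup.one_closed[OF L(1)] by (induction j) (auto simp: A.nat_pow_Suc)
  define \<Phi> where "\<Phi> = (\<lambda>(\<mu>, \<chi>). \<lambda>g\<in>carrier G. \<mu> g * \<chi> g :: complex)"
  let ?U = "{\<chi> \<in> Irr G. \<not> p dvd char_degree G \<chi>}"
  have cop: "coprime (n * k) (p ^ a)" if "\<not> p dvd n" for n
    using that pk p by (meson coprime_commute coprime_power_right_iff prime_dvd_mult_iff prime_imp_coprime)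
  have \<Phi>: "\<Phi> (\<mu>, \<chi>) \<in> ?U \<and> char_degree G (\<Phi> (\<mu>, \<chi>)) = char_degree G \<chi>"
    if \<mu>: "\<mu> \<in> L" and \<chi>: "\<chi> \<in> Irr_det p k G" for \<mu> \<chi>
  proof -
    obtain n \<rho> where r: "irreducible_representation G n \<rho>" "\<chi> = character_of G \<rho>" "\<not> p dvd n"
      using Irr_detE[OF \<chi>] by metis
    have \<mu>': "\<mu> \<in> linear_characters G" using \<mu> LA by blast
    have "\<Phi> (\<mu>, \<chi>) = character_of G (\<lambda>g. \<mu> g \<cdot>\<^sub>m \<rho> g)"
      unfolding twist(2)[OF \<mu>' r(1)] by (simp add: \<Phi>_def r(2))
    then show ?thesis
      using IrrI[OF twist(1)[OF \<mu>' r(1)]] char_degree_character_of[OF irr_rep[OF twist(1)[OF \<mu>' r(1)]]]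
        char_degree_character_of[OF irr_rep[OF r(1)]] r(2,3) by simp
  qed
  have inj: "inj_on \<Phi> (L \<times> Irr_det p k G)"
  proof (rule inj_onI, clarify)
    fix \<mu> \<chi> \<mu>' \<chi>' assume \<mu>: "\<mu> \<in> L" and \<chi>: "\<chi> \<in> Irr_det p k G" and \<mu>': "\<mu>' \<in> L" and \<chi>': "\<chi>' \<in> Irr_det p k G"
      and eq: "\<Phi> (\<mu>, \<chi>) = \<Phi> (\<mu>', \<chi>')"
    obtain n \<rho> where r: "irreducible_representation G n \<rho>" "\<chi> = character_of G \<rho>" "\<not> p dvd n"
      "\<And>g. g \<in> carrier G \<Longrightarrow> det (\<rho> g) ^ k = 1" using Irr_detE[OF \<chi>] by metis
    obtain n' \<rho>' where r': "irreducible_representation G n' \<rho>'" "\<chi>' = character_of G \<rho>'" "\<not> p dvd n'"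
      "\<And>g. g \<in> carrier G \<Longrightarrow> det (\<rho>' g) ^ k = 1" using Irr_detE[OF \<chi>'] by metis
    have \<mu>A: "\<mu> \<in> linear_characters G" "\<mu>' \<in> linear_characters G" using \<mu> \<mu>' LA by auto
    have ceq: "character_of G (\<lambda>g. \<mu> g \<cdot>\<^sub>m \<rho> g) = character_of G (\<lambda>g. \<mu>' g \<cdot>\<^sub>m \<rho>' g)"
      unfolding twist(2)[OF \<mu>A(1) r(1)] twist(2)[OF \<mu>A(2) r'(1)] using eq by (simp add: \<Phi>_def r(2) r'(2))
    note same = same_character_same_det[OF twist(1)[OF \<mu>A(1) r(1)] twist(1)[OF \<mu>A(2) r'(1)] ceq]
    have "\<mu> = \<mu>'"
    proof (rule lin_eqI[OF \<mu>A])
      fix g assume g: "g \<in> carrier G"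
      have nz: "\<mu>' g \<noteq> 0" using lin_inv(2)[OF \<mu>A(2) g] .
      have "\<mu> g ^ n * det (\<rho> g) = \<mu>' g ^ n * det (\<rho>' g)"
        using same(2)[OF g] twist(3)[OF \<mu>A(1) r(1) g] twist(3)[OF \<mu>A(2) r'(1) g] same(1) by simp
      then have "(\<mu> g ^ n * det (\<rho> g)) ^ k = (\<mu>' g ^ n * det (\<rho>' g)) ^ k" by simp
      then have "\<mu> g ^ (n * k) = \<mu>' g ^ (n * k)"
        using r(4)[OF g] r'(4)[OF g] by (simp add: power_mult_distrib power_mult)
      then have "(\<mu> g / \<mu>' g) ^ (n * k) = 1" using nz by (simp add: power_divide)
      moreover have "(\<mu> g / \<mu>' g) ^ (p ^ a) = 1" using L(3)[OF \<mu> g] L(3)[OF \<mu>' g] by (simp add: power_divide)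
      ultimately have "\<mu> g / \<mu>' g = 1" using cop[OF r(3)] by (rule coprime_powers_eq_one)
      then show "\<mu> g = \<mu>' g" using nz by simp
    qed
    moreover have "\<chi> = \<chi>'"
      unfolding r(2) r'(2) character_of_eq_iff
    proof
      fix g assume g: "g \<in> carrier G"
      have "\<Phi> (\<mu>, \<chi>) g = \<Phi> (\<mu>', \<chi>') g" using eq by simp
      then show "mat_trace (\<rho> g) = mat_trace (\<rho>' g)"
        using g \<open>\<mu> = \<mu>'\<close> lin_inv(2)[OF \<mu>A(2) g] by (simp add: \<Phi>_def r(2) r'(2))
    qed
    ultimately show "\<mu> = \<mu>' \<and> \<chi> = \<chi>'" by blast
  qed
  have "?U \<subseteq> \<Phi> ` (L \<times> Irr_det p k G)"
  proof
    fix \<chi> assume \<chi>: "\<chi> \<in> ?U"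
    then obtain n \<rho> where r: "irreducible_representation G n \<rho>" "\<chi> = character_of G \<rho>" using IrrE by blast
    have n: "\<not> p dvd n" using \<chi> char_degree_character_of[OF irr_rep[OF r(1)]] r(2) by simp
    define \<delta> where "\<delta> = (\<lambda>g\<in>carrier G. det (\<rho> g))"
    have \<delta>: "\<delta> \<in> linear_characters G" unfolding \<delta>_def by (rule det_linear_character[OF irr_rep[OF r(1)]])
    obtain j where j: "k = m * j" using mk by blast
    define D where "D = \<delta> [^]\<^bsub>?A\<^esub> k"
    have "D = (\<delta> [^]\<^bsub>?A\<^esub> m) [^]\<^bsub>?A\<^esub> j" unfolding D_def j using A.nat_pow_pow \<delta> by simp
    then have DL: "D \<in> L" using Lpow L(4)[OF \<delta>] by simp
    have D: "D g = det (\<rho> g) ^ k" if "g \<in> carrier G" for g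
      unfolding D_def using lin_group_pow[OF \<delta> that] that by (simp add: \<delta>_def)
    obtain t where t: "[n * k * t = 1] (mod p ^ a)" using cong_solve_coprime_nat[OF cop[OF n]] by auto
    \<comment> \<open>The twist that normalises the determinant is by the inverse of the \<open>n k\<close>-th root \<open>\<mu>\<close> of \<open>D\<close> in \<open>L\<close>.\<close>
    define \<mu> where "\<mu> = D [^]\<^bsub>?A\<^esub> t"
    have \<mu>L: "\<mu> \<in> L" unfolding \<mu>_def by (rule Lpow[OF DL])
    then have \<mu>: "\<mu> \<in> linear_characters G" using LA by blast
    have DA: "D \<in> linear_characters G" using DL LA by blast
    have \<mu>D: "\<mu> g ^ (n * k) = D g" if g: "g \<in> carrier G" for g
    proof -
      have "D g ^ (n * k * t) = D g"
      proof (cases "p ^ a = 1")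
        case True
        then have "D g = 1" using L(3)[OF DL g] by (metis power_one_right)
        then show ?thesis by simp
      next
        case False
        then have "1 < p ^ a" using zero_less_power[OF prime_gt_0_nat[OF p], of a] by linarith
        then have "(n * k * t) mod (p ^ a) = 1" using t unfolding cong_def by (metis mod_less)
        then have "n * k * t = p ^ a * ((n * k * t) div (p ^ a)) + 1" by (metis mult_div_mod_eq)
        then have "D g ^ (n * k * t) = (D g ^ (p ^ a)) ^ ((n * k * t) div (p ^ a)) * D g"
          by (metis power_add power_mult power_one_right)
        then show ?thesis using L(3)[OF DL g] by simp
      qed
      then show ?thesis unfolding \<mu>_def lin_group_pow[OF DA g] by (simp add: power_mult[symmetric] mult_ac)
    qed
    define \<nu> where "\<nu> = (\<lambda>g\<in>carrier G. inverse (\<mu> g))"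
    have \<nu>: "\<nu> \<in> linear_characters G" unfolding \<nu>_def by (rule lin_inv_closed[OF \<mu>])
    define \<psi> where "\<psi> = character_of G (\<lambda>g. \<nu> g \<cdot>\<^sub>m \<rho> g)"
    have "\<psi> \<in> Irr_det p k G"
      unfolding \<psi>_def
    proof (rule Irr_detI[OF twist(1)[OF \<nu> r(1)] n])
      fix g assume g: "g \<in> carrier G"
      have "det (\<nu> g \<cdot>\<^sub>m \<rho> g) ^ k = inverse (\<mu> g ^ (n * k)) * det (\<rho> g) ^ k"
        unfolding twist(3)[OF \<nu> r(1) g] using g
        by (simp add: \<nu>_def power_mult_distrib power_mult power_inverse)
      also have "\<dots> = 1" using \<mu>D[OF g] D[OF g] rep_det_nonzero[OF irr_rep[OF r(1)] g] by simp
      finally show "det (\<nu> g \<cdot>\<^sub>m \<rho> g) ^ k = 1" .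
    qed
    moreover have "\<chi> = \<Phi> (\<mu>, \<psi>)"
    proof (rule extensionalityI[of _ "carrier G"])
      show "\<chi> \<in> extensional (carrier G)" unfolding r(2) character_of_def by simp
      show "\<Phi> (\<mu>, \<psi>) \<in> extensional (carrier G)" by (simp add: \<Phi>_def)
      fix g assume g: "g \<in> carrier G"
      then show "\<chi> g = \<Phi> (\<mu>, \<psi>) g"
        using lin_inv(2)[OF \<mu> g] unfolding \<Phi>_def \<psi>_def twist(2)[OF \<nu> r(1)] by (simp add: \<nu>_def r(2))
    qed
    ultimately show "\<chi> \<in> \<Phi> ` (L \<times> Irr_det p k G)" using \<mu>L by blast
  qed
  then have img: "\<Phi> ` (L \<times> Irr_det p k G) = ?U" using \<Phi> by fast
  have "u_pprime p G = (\<Sum>\<chi>\<in>\<Phi> ` (L \<times> Irr_det p k G). (char_degree G \<chi>)\<^sup>2)"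
    unfolding u_pprime_def img ..
  also have "\<dots> = (\<Sum>x\<in>L \<times> Irr_det p k G. (char_degree G (\<Phi> x))\<^sup>2)"
    by (simp add: sum.reindex[OF inj])
  also have "\<dots> = (\<Sum>x\<in>L \<times> Irr_det p k G. (char_degree G (snd x))\<^sup>2)"
    using \<Phi> by (intro sum.cong refl) auto
  also have "\<dots> = (\<Sum>\<mu>\<in>L. \<Sum>\<chi>\<in>Irr_det p k G. (char_degree G \<chi>)\<^sup>2)"
    by (simp only: sum.cartesian_product case_prod_unfold)
  also have "\<dots> = p ^ a * degree_square_sum G (Irr_det p k G)"
    using L(2) by (simp add: degree_square_sum_def)
  finally show ?thesis .
qed

end

section \<open>Fixed points of maps of prime power order\<close>

text \<open>
  A point that is not fixed lies in an orbit of exactly \<open>p\<close> points of equal weight.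
\<close>

lemma fixed_points_mod_prime:
  fixes w :: "'c \<Rightarrow> nat"
  assumes p: "prime p" and "finite X" "f ` X \<subseteq> X" "\<And>a. a \<in> X \<Longrightarrow> (f ^^ p) a = a" "\<And>a. a \<in> X \<Longrightarrow> w (f a) = w a"
  shows "[sum w X = sum w {a \<in> X. f a = a}] (mod p)"
  using assms(2-)
proof (induction "card X" arbitrary: X rule: less_induct)
  case less
  note X = less.prems
  have pw: "(f ^^ i) a \<in> X" "w ((f ^^ i) a) = w a" if "a \<in> X" for a i
    using that X(2,4) by (induction i) auto
  show ?case
  proof (cases "\<forall>a\<in>X. f a = a")
    case True
    then have "{a \<in> X. f a = a} = X" by blast
    then show ?thesis by simp
  next
    case False
    then obtain a where a: "a \<in> X" "f a \<noteq> a" by blast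
    let ?O = "(\<lambda>i. (f ^^ i) a) ` {..<p}"
    have per: "(f ^^ (p * q)) b = b" if "b \<in> X" for b q
    proof (induction q)
      case (Suc q)
      have "(f ^^ (p * Suc q)) b = (f ^^ (p * q)) ((f ^^ p) b)"
        by (simp only: mult_Suc_right add.commute[of p] funpow_add o_apply)
      then show ?case using Suc X(3)[OF that] by simp
    qed simp
    \<comment> \<open>A nonzero exponent \<open>d\<close> below \<open>p\<close> is invertible modulo \<open>p\<close>, so a point fixed by the \<open>d\<close>-th
      iterate is fixed by \<open>f\<close>.\<close>
    have nofix: "d = 0" if d: "d < p" and fx: "(f ^^ d) b = b" and b: "b \<in> X" "f b \<noteq> b" for d b
    proof (rule ccontr)
      assume "d \<noteq> 0"
      then have "coprime d p" using d p
        by (metis coprime_commute dvd_imp_le leD not_gr_zero prime_imp_coprime)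
      then obtain y z where yz: "d * y = p * z + 1"
        using bezout_nat[OF \<open>d \<noteq> 0\<close>, of p] by auto
      have fxq: "(f ^^ (d * q)) b = b" for q
        by (induction q) (auto simp: funpow_add fx)
      have "b = (f ^^ (p * z + 1)) b" using fxq[of y] yz by simp
      also have "\<dots> = (f ^^ (1 + p * z)) b" by simp
      also have "\<dots> = f ((f ^^ (p * z)) b)" by (simp only: funpow_add o_apply) simp
      also have "\<dots> = f b" using per[OF b(1)] by simp
      finally show False using b(2) by simp
    qed
    have fne: "f ((f ^^ i) a) \<noteq> (f ^^ i) a" for i
    proof
      assume *: "f ((f ^^ i) a) = (f ^^ i) a"
      then have st: "(f ^^ j) ((f ^^ i) a) = (f ^^ i) a" for j by (induction j) auto
      have "a = (f ^^ (p * i)) a" using per[OF a(1)] by simp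
      also have "\<dots> = (f ^^ ((p * i - i) + i)) a" using p prime_gt_0_nat[OF p] by simp
      also have "\<dots> = (f ^^ i) a" using st by (simp only: funpow_add o_apply)
      finally have "a = (f ^^ i) a" .
      then show False using * a(2) by simp
    qed
    have inj: "inj_on (\<lambda>i. (f ^^ i) a) {..<p}"
    proof (rule linorder_inj_onI)
      fix i j assume ij: "i < j" "i \<in> {..<p}" "j \<in> {..<p}"
      show "(f ^^ i) a \<noteq> (f ^^ j) a"
      proof
        assume eq: "(f ^^ i) a = (f ^^ j) a"
        have "(f ^^ (j - i)) ((f ^^ i) a) = (f ^^ (j - i + i)) a" by (simp only: funpow_add o_apply)
        also have "\<dots> = (f ^^ i) a" using ij eq by simp
        finally have "j - i = 0" using nofix[of "j - i" "(f ^^ i) a"] ij(3) less_imp_diff_less[of j p i] pw(1)[OF a(1)] fne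
          by simp
        then show False using ij by simp
      qed
    qed auto
    have OX: "?O \<subseteq> X" using pw(1)[OF a(1)] by blast
    have wO: "sum w ?O = p * w a"
      using pw(2)[OF a(1)] by (simp add: sum.reindex[OF inj])
    have fO: "f b \<in> ?O \<longleftrightarrow> b \<in> ?O" if b: "b \<in> X" for b
    proof
      assume "b \<in> ?O"
      then obtain i where i: "i < p" "b = (f ^^ i) a" by blast
      show "f b \<in> ?O"
      proof (cases "Suc i = p")
        case True
        then have "f b = (f ^^ p) a" using i(2) by auto
        then have "f b = (f ^^ 0) a" using X(3)[OF a(1)] by simp
        then show ?thesis using prime_gt_0_nat[OF p] by blast
      next
        case False
        have "f b = (f ^^ Suc i) a" using i(2) by simp
        then show ?thesis using False i(1) by (intro image_eqI[of _ _ "Suc i"]) auto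
      qed
    next
      assume "f b \<in> ?O"
      then obtain i where i: "i < p" "f b = (f ^^ i) a" by blast
      have "b = (f ^^ p) b" using X(3)[OF b] by simp
      also have "\<dots> = (f ^^ (p - 1 + 1)) b" using prime_gt_0_nat[OF p] by simp
      also have "\<dots> = (f ^^ (p - 1)) (f b)" by (simp only: funpow_add o_apply) simp
      also have "\<dots> = (f ^^ (p - 1 + i)) a" by (simp only: funpow_add o_apply i)
      finally have b': "b = (f ^^ (p - 1 + i)) a" .
      show "b \<in> ?O"
      proof (cases "i = 0")
        case True
        then show ?thesis using b' prime_gt_0_nat[OF p] by (intro image_eqI[of _ _ "p - 1"]) auto
      next
        case False
        then have "p - 1 + i = (i - 1) + p" using prime_gt_0_nat[OF p] by simp
        then have "b = (f ^^ (i - 1)) a" using b' X(3)[OF a(1)] by (simp only: funpow_add o_apply)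
        then show ?thesis using i(1) False by (intro image_eqI[of _ _ "i - 1"]) auto
      qed
    qed
    have aO: "a \<in> ?O" using prime_gt_0_nat[OF p] by (intro image_eqI[of _ _ 0]) auto
    have lt: "card (X - ?O) < card X" using a(1) aO X(1) by (intro psubset_card_mono) auto
    have IH: "[sum w (X - ?O) = sum w {a \<in> X - ?O. f a = a}] (mod p)"
    proof (rule less.hyps[OF lt])
      show "f ` (X - ?O) \<subseteq> X - ?O"
      proof (rule image_subsetI)
        fix b assume "b \<in> X - ?O"
        then show "f b \<in> X - ?O" using fO[of b] X(2) by (metis Diff_iff image_subset_iff)
      qed
      show "(f ^^ p) b = b" "w (f b) = w b" if "b \<in> X - ?O" for b using that X(3,4)[of b] by simp_all
    qed (use X(1) in simp)
    moreover have "f b \<noteq> b" if bO: "b \<in> ?O" for b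
    proof -
      obtain i where "b = (f ^^ i) a" using bO by blast
      then show ?thesis using fne[of i] by metis
    qed
    then have "{a \<in> X - ?O. f a = a} = {a \<in> X. f a = a}" by blast
    moreover have "sum w X = sum w (X - ?O) + p * w a"
      using sum.subset_diff[OF OX X(1), of w] wO by simp
    ultimately show ?thesis by (simp add: cong_def)
  qed
qed

text \<open>
  By induction on the exponent: \<open>f\<close> acts on the fixed points of \<open>f\<close> iterated \<open>p\<^sup>j\<close> times, and its
  \<open>p\<^sup>j\<close>-th iterate there is the identity.
\<close>

corollary fixed_points_mod_prime_power:
  fixes w :: "'c \<Rightarrow> nat"
  assumes p: "prime p" and "finite X" "f ` X \<subseteq> X" "\<And>a. a \<in> X \<Longrightarrow> (f ^^ (p ^ j)) a = a" "\<And>a. a \<in> X \<Longrightarrow> w (f a) = w a"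
  shows "[sum w X = sum w {a \<in> X. f a = a}] (mod p)"
  using assms(2-)
proof (induction j arbitrary: X)
  case 0
  then have "{a \<in> X. f a = a} = X" by auto
  then show ?case by simp
next
  case (Suc j)
  note X = Suc.prems
  let ?h = "f ^^ (p ^ j)"
  let ?Y = "{a \<in> X. ?h a = a}"
  have pw: "(f ^^ i) a \<in> X" "w ((f ^^ i) a) = w a" if "a \<in> X" for a i
    using that X(2,4) by (induction i) auto
  have "[sum w X = sum w ?Y] (mod p)"
  proof (rule fixed_points_mod_prime[OF p X(1)])
    show "?h ` X \<subseteq> X" using pw(1) by blast
    show "(?h ^^ p) a = a" if "a \<in> X" for a
      using X(3)[OF that] by (simp add: funpow_mult mult.commute)
    show "w (?h a) = w a" if "a \<in> X" for a using pw(2)[OF that] .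
  qed
  also have "[sum w ?Y = sum w {a \<in> ?Y. f a = a}] (mod p)"
  proof (rule Suc.IH)
    show "f ` ?Y \<subseteq> ?Y"
    proof
      fix b assume "b \<in> f ` ?Y"
      then obtain a where a: "a \<in> X" "?h a = a" "b = f a" by blast
      have "?h (f a) = f (?h a)" by (rule funpow_swap1[symmetric])
      then show "b \<in> ?Y" using a X(2) by auto
    qed
  qed (use X in auto)
  also have "{a \<in> ?Y. f a = a} = {a \<in> X. f a = a}"
  proof -
    have "(f ^^ i) a = a" if "f a = a" for a i using that by (induction i) auto
    then show ?thesis by blast
  qed
  finally show ?case .
qed


section \<open>Restriction to a normal subgroup of prime index\<close>

text \<open>
  A normal subgroup \<open>M\<close> of index \<open>p\<close> is given as the kernel of a linear character \<open>\<mu>\<close> of order \<open>p\<close>,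
  together with \<open>x \<notin> M\<close>. The powers of \<open>\<mu>\<close> then serve as the characters of \<open>G/M\<close>, and the powers of
  \<open>x\<close> represent the cosets.
\<close>

locale prime_kernel = fin_group +
  fixes p :: nat and \<mu> :: "'a \<Rightarrow> complex" and x :: 'a
  assumes p: "prime p" and \<mu>: "\<mu> \<in> linear_characters G" and \<mu>_pow: "g \<in> carrier G \<Longrightarrow> \<mu> g ^ p = 1"
    and x [simp]: "x \<in> carrier G" and \<mu>x: "\<mu> x \<noteq> 1"
begin

definition M :: "'a set" where "M = {g \<in> carrier G. \<mu> g = 1}"

abbreviation "H \<equiv> G\<lparr>carrier := M\<rparr>"

lemma M_G: "g \<in> M \<Longrightarrow> g \<in> carrier G"
  by (simp add: M_def)

lemma \<mu>_inv: "g \<in> carrier G \<Longrightarrow> \<mu> (inv g) = inverse (\<mu> g)"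
  using lin_inv[OF \<mu>] by (simp add: field_simps)

lemma M_subgroup: "subgroup M G"
  unfolding M_def using linD[OF \<mu>] \<mu>_inv by (intro subgroupI) auto

lemma H_group: "fin_group H"
  using subgroup_imp_group[OF M_subgroup] finite_subset[of M "carrier G"] M_G
  by (auto simp: fin_group_def fin_group_axioms_def)

lemma p_pos: "0 < p" using prime_gt_0_nat[OF p] .

lemma M_conj: "g \<in> carrier G \<Longrightarrow> m \<in> M \<Longrightarrow> g \<otimes> m \<otimes> inv g \<in> M"
  unfolding M_def using linD[OF \<mu>] lin_inv(1)[OF \<mu>] by simp

lemma M_mult: "m \<in> M \<Longrightarrow> n \<in> M \<Longrightarrow> m \<otimes> n \<in> M"
  and M_inv: "m \<in> M \<Longrightarrow> inv m \<in> M"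
  and M_one: "\<one> \<in> M"
  using M_subgroup by (auto simp: subgroup_def)

lemma xp_M: "x [^] p \<in> M"
  unfolding M_def using lin_pow[OF \<mu> x] \<mu>_pow by simp

lemma \<mu>x_eq_iff: "\<mu> x ^ i = \<mu> x ^ j \<longleftrightarrow> [i = j] (mod p)"
proof -
  have nz: "\<mu> x \<noteq> 0" using lin_inv(2)[OF \<mu> x] .
  have one: "\<mu> x ^ d = 1 \<longleftrightarrow> p dvd d" for d
  proof
    assume "\<mu> x ^ d = 1"
    then show "p dvd d"
      using coprime_powers_eq_one[of "\<mu> x" p d] \<mu>_pow[OF x] \<mu>x p prime_imp_coprime by blast
  next
    assume "p dvd d"
    then show "\<mu> x ^ d = 1" using \<mu>_pow[OF x] by (auto simp: power_mult)
  qed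
  have main: "\<mu> x ^ i = \<mu> x ^ j \<longleftrightarrow> [i = j] (mod p)" if "i \<le> j" for i j
  proof -
    have "\<mu> x ^ j = \<mu> x ^ i * \<mu> x ^ (j - i)" using that by (simp flip: power_add)
    then have "\<mu> x ^ i = \<mu> x ^ j \<longleftrightarrow> \<mu> x ^ (j - i) = 1" using nz by auto
    then show ?thesis using one[of "j - i"] that by (metis cong_altdef_nat cong_sym_eq)
  qed
  show ?thesis using main[of i j] main[of j i] by (metis cong_sym_eq nle_le)
qed

text \<open>The powers of \<open>\<mu> x\<close> exhaust the \<open>p\<close>-th roots of unity.\<close>

lemma coset_rep: assumes g: "g \<in> carrier G" obtains i where "i < p" "g \<otimes> inv (x [^] i) \<in> M"
proof -
  let ?R = "{z::complex. z ^ p = 1}"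
  have inj: "inj_on (\<lambda>i. \<mu> x ^ i) {..<p}"
    by (rule inj_onI) (simp add: \<mu>x_eq_iff cong_def)
  have sub: "(\<lambda>i. \<mu> x ^ i) ` {..<p} \<subseteq> ?R"
    using \<mu>_pow[OF x] by (auto simp: power_mult[symmetric] mult.commute[of _ p]) (simp add: power_mult)
  have cR: "card ?R = p" using p_pos by (simp add: card_roots_unity_eq)
  have "finite ?R" using cR p_pos by (metis card.infinite less_irrefl)
  then have "(\<lambda>i. \<mu> x ^ i) ` {..<p} = ?R"
    using sub cR card_image[OF inj] by (intro card_subset_eq) auto
  moreover have "\<mu> g \<in> ?R" using \<mu>_pow[OF g] by simp
  ultimately obtain i where i: "i < p" "\<mu> g = \<mu> x ^ i" by blast
  have "g \<otimes> inv (x [^] i) \<in> M"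
    unfolding M_def using g linD(3)[OF \<mu>] \<mu>_inv[of "x [^] i"] lin_pow[OF \<mu> x] i(2) lin_inv(2)[OF \<mu> x]
    by simp
  then show ?thesis using that i(1) by blast
qed

lemma card_G: "card (carrier G) = p * card M"
proof -
  have \<mu>c: "\<mu> (m \<otimes> x [^] i) = \<mu> x ^ i" if "m \<in> M" for m i
    using that linD(3)[OF \<mu>, of m "x [^] i"] lin_pow[OF \<mu> x] unfolding M_def by simp
  have "bij_betw (\<lambda>(m, i). m \<otimes> x [^] i) (M \<times> {..<p}) (carrier G)"
    unfolding bij_betw_def
  proof
    show "inj_on (\<lambda>(m, i). m \<otimes> x [^] i) (M \<times> {..<p})"
    proof (rule inj_onI, clarify)
      fix m i m' j assume m: "m \<in> M" "m' \<in> M" and ij: "i < p" "j < p" and eq: "m \<otimes> x [^] i = m' \<otimes> x [^] j"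
      have "\<mu> x ^ i = \<mu> x ^ j" using \<mu>c[OF m(1), of i] \<mu>c[OF m(2), of j] eq by simp
      then have "i = j" using ij by (simp add: \<mu>x_eq_iff cong_def)
      then show "m = m' \<and> i = j" using eq m M_G by simp
    qed
    show "(\<lambda>(m, i). m \<otimes> x [^] i) ` (M \<times> {..<p}) = carrier G"
    proof
      show "(\<lambda>(m, i). m \<otimes> x [^] i) ` (M \<times> {..<p}) \<subseteq> carrier G" using M_G by auto
      show "carrier G \<subseteq> (\<lambda>(m, i). m \<otimes> x [^] i) ` (M \<times> {..<p})"
      proof
        fix g assume g: "g \<in> carrier G"
        obtain i where i: "i < p" "g \<otimes> inv (x [^] i) \<in> M" using coset_rep[OF g] .
        have "g = (g \<otimes> inv (x [^] i)) \<otimes> x [^] i" using g by (simp add: m_assoc)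
        then show "g \<in> (\<lambda>(m, i). m \<otimes> x [^] i) ` (M \<times> {..<p})"
          using i by (intro image_eqI[of _ _ "(g \<otimes> inv (x [^] i), i)"]) auto
      qed
    qed
  qed
  then have "card (carrier G) = card (M \<times> {..<p})" by (metis bij_betw_same_card)
  then show ?thesis by (simp add: card_cartesian_product mult.commute)
qed

lemma restrict_rep:
  assumes "representation G n \<rho>"
  shows "representation H n \<rho>"
  using repD[OF assms] M_G unfolding fin_group.rep_iff[OF H_group] by auto

lemma lin_char_pow:
  obtains \<mu>i where "\<mu>i \<in> linear_characters G" "\<And>g. g \<in> carrier G \<Longrightarrow> \<mu>i g = \<mu> g ^ i"
proof -
  interpret A: comm_group "linear_character_group G" by (rule lin_comm_group)
  have "\<mu> [^]\<^bsub>linear_character_group G\<^esub> i \<in> linear_characters G"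
    using A.nat_pow_closed[of \<mu> i] \<mu> by simp
  then show ?thesis using that lin_group_pow[OF \<mu>] by blast
qed

text \<open>
  If \<open>E\<close> commutes with \<open>\<rho>(M)\<close>, split it along the characters \<open>\<mu>\<^sup>i\<close> of \<open>G/M\<close>: the \<open>i\<close>-th component
  intertwines \<open>\<rho>\<close> with its twist by \<open>\<mu>\<^sup>i\<close>. Comparing determinants, these are inequivalent for
  \<open>0 < i < p\<close> when \<open>p\<close> does not divide the degree, so only the scalar component \<open>i = 0\<close> remains.
\<close>

theorem restriction_irreducible:
  assumes \<rho>: "irreducible_representation G n \<rho>" and pn: "\<not> p dvd n"
  shows "irreducible_representation H n \<rho>"
proof -
  interpret H: fin_group H by (rule H_group)
  note r = irr_rep[OF \<rho>] and rD = repD[OF irr_rep[OF \<rho>]]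
  show ?thesis
  proof (rule H.irreducible_if_commutant_scalar[OF restrict_rep[OF r] irr_pos[OF \<rho>]])
    fix E assume E: "E \<in> carrier_mat n n" and "\<And>g. g \<in> carrier H \<Longrightarrow> \<rho> g * E = E * \<rho> g"
    then have comm: "\<And>g. g \<in> M \<Longrightarrow> \<rho> g * E = E * \<rho> g" by simp
    define F where "F i = mat_sum n n (\<lambda>g. (\<mu> g ^ i \<cdot>\<^sub>m \<rho> g) * E * \<rho> (inv g)) (carrier G)" for i
    have Fc: "F i \<in> carrier_mat n n" for i unfolding F_def by simp
    have F_int: "(\<mu> h ^ i \<cdot>\<^sub>m \<rho> h) * F i = F i * \<rho> h" if h: "h \<in> carrier G" for i h
    proof -
      obtain \<mu>i where \<mu>i: "\<mu>i \<in> linear_characters G" "\<And>g. g \<in> carrier G \<Longrightarrow> \<mu>i g = \<mu> g ^ i"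
        using lin_char_pow[where i = i] by blast
      have "F i = mat_sum n n (\<lambda>g. (\<mu>i g \<cdot>\<^sub>m \<rho> g) * E * \<rho> (inv g)) (carrier G)"
        unfolding F_def by (intro mat_sum_cong) (simp add: \<mu>i(2))
      then show ?thesis
        using average_intertwines[OF irr_rep[OF twist(1)[OF \<mu>i(1) \<rho>]] r E h] \<mu>i(2)[OF h] by simp
    qed
    have F0: "F i = 0\<^sub>m n n" if i: "0 < i" "i < p" for i
    proof (rule ccontr)
      assume "F i \<noteq> 0\<^sub>m n n"
      obtain \<mu>i where \<mu>i: "\<mu>i \<in> linear_characters G" "\<And>g. g \<in> carrier G \<Longrightarrow> \<mu>i g = \<mu> g ^ i"
        using lin_char_pow[where i = i] by blast
      have int: "(\<mu>i h \<cdot>\<^sub>m \<rho> h) * F i = F i * \<rho> h" if h: "h \<in> carrier G" for h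
        using F_int[OF h] \<mu>i(2)[OF h] by simp
      have "det (F i) \<noteq> 0"
        using intertwiner_zero_or_invertible[OF twist(1)[OF \<mu>i(1) \<rho>] \<rho> Fc int] \<open>F i \<noteq> 0\<^sub>m n n\<close> by blast
      then have "equivalent_by n (F i) (\<lambda>g. \<mu>i g \<cdot>\<^sub>m \<rho> g) \<rho>"
        unfolding equivalent_by_def using Fc int by blast
      then have "det (\<mu>i x \<cdot>\<^sub>m \<rho> x) = det (\<rho> x)"
        using equivalent_trace_det(2)[of n "F i" "\<lambda>g. \<mu>i g \<cdot>\<^sub>m \<rho> g" \<rho> x] rD(1)[OF x] by simp
      then have "\<mu> x ^ (i * n) = 1"
        unfolding twist(3)[OF \<mu>i(1) \<rho> x] \<mu>i(2)[OF x] using rep_det_nonzero[OF r x] carrier_matD(2)[OF rD(1)[OF x]]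
        by (simp add: power_mult)
      moreover have "coprime (i * n) p"
        using i pn p by (metis coprime_commute dvd_imp_le leD prime_dvd_mult_iff prime_imp_coprime)
      ultimately have "\<mu> x = 1" using coprime_powers_eq_one[OF _ \<mu>_pow[OF x]] by blast
      then show False using \<mu>x by simp
    qed
    have "\<rho> h * F 0 = F 0 * \<rho> h" if "h \<in> carrier G" for h
      using F_int[OF that, of 0] by (simp add: one_smult_mat)
    then obtain c where c: "F 0 = c \<cdot>\<^sub>m 1\<^sub>m n" using schur_scalar[OF \<rho> Fc] by blast
    have geo: "(\<Sum>i<p. z ^ i) = (if z = 1 then of_nat p else 0)" if "z ^ p = 1" for z :: complex
      using that by (auto simp: sum_gp_strict)
    have "F 0 = (of_nat p * of_nat (card M)) \<cdot>\<^sub>m E"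
    proof (intro eq_matI)
      fix a b assume "a < dim_row ((of_nat p * of_nat (card M)) \<cdot>\<^sub>m E)" "b < dim_col ((of_nat p * of_nat (card M)) \<cdot>\<^sub>m E)"
      then have ab: "a < n" "b < n" using E by auto
      have ent: "((\<mu> g ^ i \<cdot>\<^sub>m \<rho> g) * E * \<rho> (inv g)) $$ (a, b) = \<mu> g ^ i * (\<rho> g * E * \<rho> (inv g)) $$ (a, b)"
        if g: "g \<in> carrier G" for g i
      proof -
        have c: "\<rho> g \<in> carrier_mat n n" "\<rho> (inv g) \<in> carrier_mat n n" "\<rho> g * E \<in> carrier_mat n n"
          using rD(1) g E by (auto intro: mult_carrier_mat)
        have "(\<mu> g ^ i \<cdot>\<^sub>m \<rho> g) * E * \<rho> (inv g) = \<mu> g ^ i \<cdot>\<^sub>m (\<rho> g * E * \<rho> (inv g))"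
          using mult_smult_assoc_mat[OF c(1) E] mult_smult_assoc_mat[OF c(3,2)] by simp
        then show ?thesis using ab c by (simp del: index_mult_mat(1))
      qed
      have "F 0 $$ (a, b) = (\<Sum>i<p. F i $$ (a, b))"
      proof -
        have "(\<Sum>i<p. F i $$ (a, b)) = (\<Sum>i<p. if i = 0 then F 0 $$ (a, b) else 0)"
          using F0 ab by (intro sum.cong) auto
        then show ?thesis using p_pos by simp
      qed
      also have "\<dots> = (\<Sum>i<p. \<Sum>g\<in>carrier G. \<mu> g ^ i * (\<rho> g * E * \<rho> (inv g)) $$ (a, b))"
        unfolding F_def using ab ent by (simp del: index_mult_mat(1))
      also have "\<dots> = (\<Sum>g\<in>carrier G. (\<Sum>i<p. \<mu> g ^ i) * (\<rho> g * E * \<rho> (inv g)) $$ (a, b))"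
        by (subst sum.swap) (simp add: sum_distrib_right)
      also have "\<dots> = (\<Sum>g\<in>carrier G. if g \<in> M then of_nat p * E $$ (a, b) else 0)"
      proof (intro sum.cong refl)
        fix g assume g: "g \<in> carrier G"
        show "(\<Sum>i<p. \<mu> g ^ i) * (\<rho> g * E * \<rho> (inv g)) $$ (a, b) = (if g \<in> M then of_nat p * E $$ (a, b) else 0)"
        proof (cases "g \<in> M")
          case True
          have "\<rho> g * E * \<rho> (inv g) = E * (\<rho> g * \<rho> (inv g))"
            unfolding comm[OF True] using E rD(1) g by (intro assoc_mult_mat[of _ n n _ n _ n]) auto
          then have "\<rho> g * E * \<rho> (inv g) = E" using rep_inv[OF r g] E by simp
          then show ?thesis using True geo[OF \<mu>_pow[OF g]] by (simp add: M_def)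
        next
          case False
          then show ?thesis using g geo[OF \<mu>_pow[OF g]] by (simp add: M_def)
        qed
      qed
      also have "\<dots> = of_nat p * of_nat (card M) * E $$ (a, b)"
        using M_G by (simp add: sum.If_cases Int_absorb1 subset_iff)
      finally show "F 0 $$ (a, b) = ((of_nat p * of_nat (card M)) \<cdot>\<^sub>m E) $$ (a, b)" using ab E by simp
    qed (use E in \<open>auto simp: F_def\<close>)
    then have "(of_nat p * of_nat (card M)) \<cdot>\<^sub>m E = (of_nat p * of_nat (card M)) \<cdot>\<^sub>m
        ((c / (of_nat p * of_nat (card M))) \<cdot>\<^sub>m 1\<^sub>m n)"
      using c p_pos H.ord_G_nonzero(2) by (simp add: smult_smult_mat)
    then have "E = (c / (of_nat p * of_nat (card M))) \<cdot>\<^sub>m 1\<^sub>m n"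
      by (rule smult_mat_cancel[rotated]) (use p_pos H.ord_G_nonzero(2) in simp)
    then show "\<exists>c. E = c \<cdot>\<^sub>m 1\<^sub>m n" by blast
  qed
qed

lemma restrict_character: "restrict (character_of G \<rho>) M = character_of H \<rho>"
  using M_G by (auto simp: character_of_def restrict_def fun_eq_iff)

lemma restrict_Irr_det:
  assumes "\<chi> \<in> Irr_det p k G"
  shows "restrict \<chi> M \<in> Irr_det p k H"
proof -
  interpret H: fin_group H by (rule H_group)
  obtain n \<rho> where r: "irreducible_representation G n \<rho>" "\<chi> = character_of G \<rho>" "\<not> p dvd n"
    "\<And>g. g \<in> carrier G \<Longrightarrow> det (\<rho> g) ^ k = 1" using Irr_detE[OF assms] by metis
  show ?thesis
    unfolding r(2) restrict_character using H.Irr_detI[OF restriction_irreducible[OF r(1,3)] r(3)] r(4) M_G by simp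
qed

text \<open>
  Two irreducible representations that agree on \<open>M\<close>, after conjugation, differ at \<open>x\<close> by a scalar \<open>c\<close>
  with \<open>c\<^sup>p = 1\<close>, because \<open>x\<^sup>p \<in> M\<close>; the determinants force \<open>c\<close> to have order prime to \<open>p\<close> as well.
\<close>

theorem restriction_inj:
  assumes pk: "\<not> p dvd k"
  shows "inj_on (\<lambda>\<chi>. restrict \<chi> M) (Irr_det p k G)"
proof (rule inj_onI)
  interpret H: fin_group H by (rule H_group)
  fix \<chi> \<psi> assume \<chi>: "\<chi> \<in> Irr_det p k G" and \<psi>: "\<psi> \<in> Irr_det p k G" and eq: "restrict \<chi> M = restrict \<psi> M"
  obtain n \<rho> where r: "irreducible_representation G n \<rho>" "\<chi> = character_of G \<rho>" "\<not> p dvd n"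
    "\<And>g. g \<in> carrier G \<Longrightarrow> det (\<rho> g) ^ k = 1" using Irr_detE[OF \<chi>] by metis
  obtain n' \<sigma> where s: "irreducible_representation G n' \<sigma>" "\<psi> = character_of G \<sigma>" "\<not> p dvd n'"
    "\<And>g. g \<in> carrier G \<Longrightarrow> det (\<sigma> g) ^ k = 1" using Irr_detE[OF \<psi>] by metis
  have rM: "irreducible_representation H n \<rho>" and sM: "irreducible_representation H n' \<sigma>"
    using restriction_irreducible r s by auto
  have "character_of H \<rho> = character_of H \<sigma>" using eq r(2) s(2) by (simp add: restrict_character)
  then obtain X where nn: "n = n'" and X: "H.equivalent_by n X \<rho> \<sigma>"
    using H.equivalent_if_same_character[OF rM sM] by blast
  have Xc: "X \<in> carrier_mat n n" and Xd: "det X \<noteq> 0" and Xint: "\<And>m. m \<in> M \<Longrightarrow> \<rho> m * X = X * \<sigma> m"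
    using X unfolding H.equivalent_by_def by auto
  obtain Y where Y: "Y \<in> carrier_mat n n" "X * Y = 1\<^sub>m n" "Y * X = 1\<^sub>m n" using det_nonzero_inverse[OF Xc Xd] .
  note rD = repD[OF irr_rep[OF r(1)]] and sD = repD[OF irr_rep[OF s(1)], folded nn]
  \<comment> \<open>\<open>Z\<close> is a second intertwiner over \<open>M\<close>, because \<open>M\<close> is normal, hence a multiple of \<open>X\<close>.\<close>
  define Z where "Z = \<rho> (inv x) * X * \<sigma> x"
  have cx: "\<rho> x \<in> carrier_mat n n" "\<rho> (inv x) \<in> carrier_mat n n" "\<sigma> x \<in> carrier_mat n n" "\<sigma> (inv x) \<in> carrier_mat n n"
    using rD(1) sD(1) by auto
  have Zc: "Z \<in> carrier_mat n n" unfolding Z_def using cx Xc by simp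
  have Zint: "\<rho> m * Z = Z * \<sigma> m" if m: "m \<in> M" for m
  proof -
    let ?m = "x \<otimes> m \<otimes> inv x"
    have mG: "m \<in> carrier G" "?m \<in> M" "?m \<in> carrier G" using m M_G M_conj[OF x] by auto
    have c: "\<rho> m \<in> carrier_mat n n" "\<sigma> m \<in> carrier_mat n n" "\<rho> ?m \<in> carrier_mat n n" "\<sigma> ?m \<in> carrier_mat n n"
      using rD(1) sD(1) mG by auto
    have 1: "\<rho> m * \<rho> (inv x) = \<rho> (inv x) * \<rho> ?m"
      using rD(2)[of m "inv x"] rD(2)[of "inv x" ?m] mG by (simp add: m_assoc[symmetric])
    have 2: "\<sigma> ?m * \<sigma> x = \<sigma> x * \<sigma> m"
      using sD(2)[of x m] sD(2)[of ?m x] mG by (simp add: m_assoc)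
    have "\<rho> m * Z = \<rho> m * \<rho> (inv x) * X * \<sigma> x"
      unfolding Z_def using c cx Xc by (simp add: assoc_mult_mat[of _ n n _ n _ n])
    also have "\<dots> = \<rho> (inv x) * (\<rho> ?m * X) * \<sigma> x"
      unfolding 1 using c cx Xc by (simp add: assoc_mult_mat[of _ n n _ n _ n])
    also have "\<dots> = \<rho> (inv x) * X * (\<sigma> ?m * \<sigma> x)"
      unfolding Xint[OF mG(2)] using c cx Xc by (simp add: assoc_mult_mat[of _ n n _ n _ n])
    also have "\<dots> = Z * \<sigma> m"
      unfolding 2 Z_def using c cx Xc by (simp add: assoc_mult_mat[of _ n n _ n _ n])
    finally show ?thesis .
  qed
  have "\<rho> m * (Z * Y) = (Z * Y) * \<rho> m" if m: "m \<in> M" for m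
  proof -
    have c: "\<rho> m \<in> carrier_mat n n" "\<sigma> m \<in> carrier_mat n n" using rD(1) sD(1) m M_G by auto
    have "Y * \<rho> m = Y * (\<rho> m * X) * Y"
      using c Y Xc by (simp add: assoc_mult_mat[of _ n n _ n _ n])
    also have "\<dots> = (Y * X) * \<sigma> m * Y"
      unfolding Xint[OF m] using c Y(1) Xc by (simp add: assoc_mult_mat[of _ n n _ n _ n])
    also have "\<dots> = \<sigma> m * Y" unfolding Y(3) using c by simp
    finally have YR: "Y * \<rho> m = \<sigma> m * Y" .
    have "\<rho> m * (Z * Y) = Z * \<sigma> m * Y"
      using assoc_mult_mat[OF c(1) Zc Y(1)] Zint[OF m] by simp
    also have "\<dots> = Z * (Y * \<rho> m)" unfolding YR using Zc c(2) Y(1) by (rule assoc_mult_mat)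
    also have "\<dots> = Z * Y * \<rho> m" using Zc Y(1) c(1) by (rule assoc_mult_mat[symmetric])
    finally show ?thesis .
  qed
  then obtain c where c: "Z * Y = c \<cdot>\<^sub>m 1\<^sub>m n"
    using H.schur_scalar[OF rM, of "Z * Y"] Zc Y(1) by auto
  have "Z = Z * Y * X" using assoc_mult_mat[OF Zc Y(1) Xc] Y(3) Zc by simp
  then have Zc': "Z = c \<cdot>\<^sub>m X" unfolding c using mult_smult_one(2)[OF Xc] by simp
  have "X * \<sigma> x = \<rho> x * Z"
  proof -
    have "\<rho> x * Z = (\<rho> x * \<rho> (inv x)) * X * \<sigma> x"
      unfolding Z_def using cx Xc by (simp add: assoc_mult_mat[of _ n n _ n _ n])
    then show ?thesis using rep_inv(1)[OF irr_rep[OF r(1)] x] Xc by simp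
  qed
  then have Xx: "X * \<sigma> x = c \<cdot>\<^sub>m (\<rho> x * X)" unfolding Zc' using mult_smult_distrib[OF cx(1) Xc] by simp
  have pw: "X * \<sigma> (x [^] i) = c ^ i \<cdot>\<^sub>m (\<rho> (x [^] i) * X)" for i :: nat
  proof (induction i)
    case 0
    show ?case using rD(3) sD(3) Xc by (simp add: one_smult_mat)
  next
    case (Suc i)
    have ci: "\<sigma> (x [^] i) \<in> carrier_mat n n" "\<rho> (x [^] i) \<in> carrier_mat n n" using rD(1) sD(1) by auto
    have "X * \<sigma> (x [^] Suc i) = X * \<sigma> (x [^] i) * \<sigma> x"
      using sD(2)[of "x [^] i" x] assoc_mult_mat[OF Xc ci(1) cx(3)] by simp
    also have "\<dots> = c ^ i \<cdot>\<^sub>m (\<rho> (x [^] i) * (X * \<sigma> x))"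
      unfolding Suc using ci Xc cx by (simp add: mult_smult_assoc_mat[of _ n n _ n] assoc_mult_mat[of _ n n _ n _ n])
    also have "\<dots> = c ^ Suc i \<cdot>\<^sub>m (\<rho> (x [^] i) * (\<rho> x * X))"
      unfolding Xx using ci Xc cx by (simp add: mult_smult_distrib[of _ n n _ n] smult_smult_mat mult.commute)
    also have "\<rho> (x [^] i) * (\<rho> x * X) = \<rho> (x [^] Suc i) * X"
      using rD(2)[of "x [^] i" x] assoc_mult_mat[OF ci(2) cx(1) Xc] by simp
    finally show ?case .
  qed
  have n: "0 < n" using irr_pos[OF r(1)] .
  have "c ^ p = 1"
  proof -
    have d0: "det (\<rho> (x [^] p) * X) \<noteq> 0"
      using rep_det_nonzero[OF irr_rep[OF r(1)], of "x [^] p"] Xd det_mult[of "\<rho> (x [^] p)" n X] rD(1)[of "x [^] p"] Xc by simp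
    have "\<rho> (x [^] p) * X = c ^ p \<cdot>\<^sub>m (\<rho> (x [^] p) * X)" using pw[of p] Xint[OF xp_M] by simp
    moreover have "\<exists>i<n. \<exists>j<n. (\<rho> (x [^] p) * X) $$ (i, j) \<noteq> 0"
    proof (rule ccontr)
      assume "\<not> ?thesis"
      then have "\<rho> (x [^] p) * X = 0\<^sub>m n n" using rD(1)[of "x [^] p"] Xc by (intro eq_matI) (auto simp del: index_mult_mat(1))
      then show False using d0 n by (simp add: det_zero)
    qed
    then obtain i j where ij: "i < n" "j < n" "(\<rho> (x [^] p) * X) $$ (i, j) \<noteq> 0" by blast
    ultimately have "(\<rho> (x [^] p) * X) $$ (i, j) = c ^ p * (\<rho> (x [^] p) * X) $$ (i, j)"
      using rD(1)[of "x [^] p"] Xc by (metis carrier_matD index_mult_mat(2,3) index_smult_mat(1) nat_pow_closed x)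
    then show ?thesis using ij(3) by simp
  qed
  moreover have "c ^ (n * k) = 1"
  proof -
    have "det X * det (\<sigma> x) = c ^ n * (det (\<rho> x) * det X)"
      using arg_cong[OF Xx, of det] det_mult[OF Xc cx(3)] det_mult[OF cx(1) Xc] Xc by simp
    then have "det (\<sigma> x) = c ^ n * det (\<rho> x)" using Xd by simp
    then have "det (\<sigma> x) ^ k = c ^ (n * k) * det (\<rho> x) ^ k" by (simp add: power_mult_distrib power_mult)
    then show ?thesis using r(4)[OF x] s(4)[OF x] by simp
  qed
  moreover have "coprime p (n * k)" using p pk r(3) by (meson prime_dvd_mult_iff prime_imp_coprime)
  ultimately have c1: "c = 1" by (rule coprime_powers_eq_one)
  have "\<rho> g * X = X * \<sigma> g" if g: "g \<in> carrier G" for g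
  proof -
    obtain i where i: "i < p" "g \<otimes> inv (x [^] i) \<in> M" using coset_rep[OF g] .
    let ?m = "g \<otimes> inv (x [^] i)"
    have gm: "g = ?m \<otimes> x [^] i" using g by (simp add: m_assoc)
    have mG: "?m \<in> carrier G" "x [^] i \<in> carrier G" using g by auto
    have cc: "\<rho> ?m \<in> carrier_mat n n" "\<sigma> ?m \<in> carrier_mat n n" "\<rho> (x [^] i) \<in> carrier_mat n n" "\<sigma> (x [^] i) \<in> carrier_mat n n"
      using mG rD(1) sD(1) by auto
    have "\<rho> g * X = \<rho> ?m * (\<rho> (x [^] i) * X)"
      using gm rD(2)[OF mG] assoc_mult_mat[OF cc(1,3) Xc] by simp
    also have "\<rho> (x [^] i) * X = X * \<sigma> (x [^] i)" using pw[of i] c1 by (simp add: one_smult_mat)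
    also have "\<rho> ?m * (X * \<sigma> (x [^] i)) = X * \<sigma> ?m * \<sigma> (x [^] i)"
      using assoc_mult_mat[OF cc(1) Xc cc(4)] Xint[OF i(2)] by simp
    also have "\<dots> = X * \<sigma> g" using gm sD(2)[OF mG] assoc_mult_mat[OF Xc cc(2,4)] by simp
    finally show ?thesis .
  qed
  then have "equivalent_by n X \<rho> \<sigma>" unfolding equivalent_by_def using Xc Xd by blast
  then show "\<chi> = \<psi>"
    unfolding r(2) s(2) using equivalent_character irr_rep[OF r(1)] irr_rep[OF s(1)] nn by blast
qed

end


section \<open>Extension from a normal subgroup of prime index\<close>

lemma (in fin_group) trace_conjugate:
  assumes "representation G n \<rho>" "a \<in> carrier G" "g \<in> carrier G"
  shows "mat_trace (\<rho> (a \<otimes> g \<otimes> inv a)) = mat_trace (\<rho> g)"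
proof -
  note rD = repD[OF assms(1)]
  have c: "\<rho> a \<in> carrier_mat n n" "\<rho> g \<in> carrier_mat n n" "\<rho> (inv a) \<in> carrier_mat n n"
    using rD(1) assms by auto
  have "mat_trace (\<rho> (a \<otimes> g \<otimes> inv a)) = mat_trace (\<rho> a * \<rho> g * \<rho> (inv a))"
    using rD(2) assms by simp
  also have "\<dots> = mat_trace (\<rho> (inv a) * (\<rho> a * \<rho> g))"
    using c by (intro mat_trace_mult_commute[of _ n n]) auto
  also have "\<rho> (inv a) * (\<rho> a * \<rho> g) = \<rho> g"
    using assoc_mult_mat[OF c(3,1,2)] rep_inv(2)[OF assms(1,2)] c by simp
  finally show ?thesis .
qed

lemma (in group) inv_cancel:
  assumes "a \<in> carrier G" "b \<in> carrier G"
  shows "inv a \<otimes> (a \<otimes> b) = b" "a \<otimes> (inv a \<otimes> b) = b"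
  using assms by (simp_all add: m_assoc[symmetric])

lemma complex_root_exists:
  assumes "0 < (p::nat)"
  obtains r :: complex where "r ^ p = z"
proof -
  have "rcis (root p (cmod z)) (Arg z / of_nat p) ^ p = rcis (root p (cmod z) ^ p) (of_nat p * (Arg z / of_nat p))"
    by (rule DeMoivre2)
  also have "\<dots> = z" using assms by (simp add: rcis_cmod_Arg)
  finally show ?thesis using that by blast
qed

context prime_kernel
begin

lemma restrict_repD:
  assumes "representation H n \<rho>"
  shows "m \<in> M \<Longrightarrow> \<rho> m \<in> carrier_mat n n" "m \<in> M \<Longrightarrow> m' \<in> M \<Longrightarrow> \<rho> (m \<otimes> m') = \<rho> m * \<rho> m'"
    "\<rho> \<one> = 1\<^sub>m n"
  using fin_group.repD[OF H_group assms] by auto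

lemma power_conjugation:
  assumes \<rho>: "representation H n \<rho>" and T: "T \<in> carrier_mat n n"
    and TM: "\<And>m. m \<in> M \<Longrightarrow> T * \<rho> m = \<rho> (x \<otimes> m \<otimes> inv x) * T" and m: "m \<in> M"
  shows "T ^\<^sub>m i * \<rho> m = \<rho> (x [^] i \<otimes> m \<otimes> inv (x [^] i)) * T ^\<^sub>m i"
  using m
proof (induction i arbitrary: m)
  case 0
  then show ?case using restrict_repD(1)[OF \<rho> 0] T M_G[OF 0] by simp
next
  case (Suc i)
  have mc: "x \<otimes> m \<otimes> inv x \<in> M" using M_conj[OF x Suc.prems] .
  have c: "\<rho> m \<in> carrier_mat n n" "\<rho> (x \<otimes> m \<otimes> inv x) \<in> carrier_mat n n" "T ^\<^sub>m i \<in> carrier_mat n n"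
    using restrict_repD(1)[OF \<rho>] Suc.prems mc T by auto
  have mc2: "x [^] i \<otimes> (x \<otimes> m \<otimes> inv x) \<otimes> inv (x [^] i) \<in> M" using M_conj[OF _ mc] by simp
  have "T ^\<^sub>m Suc i * \<rho> m = T ^\<^sub>m i * (T * \<rho> m)"
    using assoc_mult_mat[OF c(3) T c(1)] by simp
  also have "\<dots> = (T ^\<^sub>m i * \<rho> (x \<otimes> m \<otimes> inv x)) * T"
    unfolding TM[OF Suc.prems] using c(3,2) T by (rule assoc_mult_mat[symmetric])
  also have "\<dots> = \<rho> (x [^] i \<otimes> (x \<otimes> m \<otimes> inv x) \<otimes> inv (x [^] i)) * T ^\<^sub>m Suc i"
    unfolding Suc.IH[OF mc] using assoc_mult_mat[OF restrict_repD(1)[OF \<rho> mc2] c(3) T] by simp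
  also have "x [^] i \<otimes> (x \<otimes> m \<otimes> inv x) \<otimes> inv (x [^] i) = x [^] Suc i \<otimes> m \<otimes> inv (x [^] Suc i)"
    using M_G[OF Suc.prems] by (simp add: m_assoc inv_mult_group)
  finally show ?case .
qed

text \<open>
  An element of \<open>G\<close> is \<open>m x\<^sup>i\<close> with \<open>m \<in> M\<close>, and the extension sends it to \<open>\<rho>(m) T\<^sup>i\<close>. This does not
  depend on the choice of \<open>i\<close> modulo \<open>p\<close> because \<open>T\<^sup>p = \<rho>(x\<^sup>p)\<close>.
\<close>

lemma extend_representation:
  assumes \<rho>: "representation H n \<rho>" and T: "T \<in> carrier_mat n n"
    and TM: "\<And>m. m \<in> M \<Longrightarrow> T * \<rho> m = \<rho> (x \<otimes> m \<otimes> inv x) * T" and Tp: "T ^\<^sub>m p = \<rho> (x [^] p)"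
  obtains \<rho>' where "representation G n \<rho>'" "\<And>m. m \<in> M \<Longrightarrow> \<rho>' m = \<rho> m"
    "\<And>g. g \<in> carrier G \<Longrightarrow> \<exists>m\<in>M. \<exists>i. \<rho>' g = \<rho> m * T ^\<^sub>m i"
proof -
  note rD = restrict_repD[OF \<rho>]
  have Tc: "T ^\<^sub>m i \<in> carrier_mat n n" for i using T by simp
  have Tconj: "T ^\<^sub>m i * \<rho> m = \<rho> (x [^] i \<otimes> m \<otimes> inv (x [^] i)) * T ^\<^sub>m i" if "m \<in> M" for i m
    using power_conjugation[OF \<rho> T TM that] .
  have xpq: "x [^] (p * q) \<in> M" for q
    unfolding M_def using lin_pow[OF \<mu> x] \<mu>_pow[OF x] by (simp add: power_mult)
  have Tpq: "T ^\<^sub>m (p * q) = \<rho> (x [^] (p * q))" for q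
  proof (induction q)
    case 0
    show ?case using T rD(3) by simp
  next
    case (Suc q)
    have "T ^\<^sub>m (p * Suc q) = T ^\<^sub>m p * T ^\<^sub>m (p * q)" using pow_mat_add[OF T] by simp
    also have "\<dots> = \<rho> (x [^] p \<otimes> x [^] (p * q))" unfolding Tp Suc using rD(2) xp_M xpq by simp
    finally show ?case by (simp add: nat_pow_mult)
  qed
  define W where "W g i = \<rho> (g \<otimes> inv (x [^] i)) * T ^\<^sub>m i" for g and i :: nat
  have \<mu>i: "\<mu> g = \<mu> x ^ i" if "g \<in> carrier G" "g \<otimes> inv (x [^] i) \<in> M" for g and i :: nat
    using that linD(3)[OF \<mu>] \<mu>_inv[of "x [^] i"] lin_pow[OF \<mu> x, of i] lin_inv(2)[OF \<mu> x]
    by (simp add: M_def field_simps)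
  have Wle: "W g i = W g j" if g: "g \<in> carrier G" and i: "g \<otimes> inv (x [^] i) \<in> M" and j: "g \<otimes> inv (x [^] j) \<in> M"
    and le: "i \<le> j" for g and i j :: nat
  proof -
    have "[j = i] (mod p)" using \<mu>i[OF g i] \<mu>i[OF g j] by (simp add: \<mu>x_eq_iff cong_sym)
    then obtain q where q: "j = p * q + i" using le by (metis cong_le_nat add.commute mult.commute)
    have e: "g \<otimes> inv (x [^] i) = (g \<otimes> inv (x [^] j)) \<otimes> x [^] (p * q)"
    proof -
      have "x [^] j = x [^] (p * q) \<otimes> x [^] i" unfolding q by (simp add: nat_pow_mult)
      then show ?thesis using g by (simp add: inv_mult_group m_assoc)
    qed
    have "W g i = \<rho> (g \<otimes> inv (x [^] j)) * T ^\<^sub>m (p * q) * T ^\<^sub>m i"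
      unfolding W_def e rD(2)[OF j xpq] Tpq ..
    also have "\<dots> = W g j"
      unfolding W_def q pow_mat_add[OF T] using rD(1)[OF j] Tc by (simp add: q assoc_mult_mat[of _ n n _ n _ n])
    finally show ?thesis .
  qed
  have Weq: "W g i = W g j" if "g \<in> carrier G" "g \<otimes> inv (x [^] i) \<in> M" "g \<otimes> inv (x [^] j) \<in> M" for g and i j :: nat
  proof (cases "i \<le> j")
    case True
    then show ?thesis by (rule Wle[OF that])
  next
    case False
    then show ?thesis using Wle[OF that(1,3,2)] by simp
  qed
  have Wmult: "W g i * W h j = W (g \<otimes> h) (i + j) \<and> (g \<otimes> h) \<otimes> inv (x [^] (i + j)) \<in> M"
    if g: "g \<in> carrier G" and i: "g \<otimes> inv (x [^] i) \<in> M" and h: "h \<in> carrier G" and j: "h \<otimes> inv (x [^] j) \<in> M"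
    for g h and i j :: nat
  proof -
    let ?m = "g \<otimes> inv (x [^] i)" and ?m' = "h \<otimes> inv (x [^] j)"
    let ?c = "x [^] i \<otimes> ?m' \<otimes> inv (x [^] i)"
    have c: "?c \<in> M" using M_conj[OF _ j] by simp
    have e: "?m \<otimes> ?c = (g \<otimes> h) \<otimes> inv (x [^] (i + j))"
    proof -
      have "x [^] (i + j) = x [^] i \<otimes> x [^] j" by (simp add: nat_pow_mult)
      then show ?thesis using g h by (simp add: m_assoc inv_mult_group inv_cancel)
    qed
    have "W g i * W h j = \<rho> ?m * (T ^\<^sub>m i * \<rho> ?m') * T ^\<^sub>m j"
      unfolding W_def using rD(1)[OF i] rD(1)[OF j] Tc mult_carrier_mat[OF Tc rD(1)[OF j]]
      by (simp add: assoc_mult_mat[of _ n n _ n _ n])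
    also have "\<dots> = (\<rho> ?m * \<rho> ?c) * (T ^\<^sub>m i * T ^\<^sub>m j)"
      unfolding Tconj[OF j] using rD(1)[OF i] rD(1)[OF c] Tc mult_carrier_mat[OF rD(1)[OF c] Tc] mult_carrier_mat[OF Tc Tc]
      by (simp add: assoc_mult_mat[of _ n n _ n _ n])
    also have "\<dots> = W (g \<otimes> h) (i + j)"
      unfolding W_def pow_mat_add[OF T] rD(2)[OF i c, symmetric] e ..
    finally show ?thesis using e M_mult[OF i c] by simp
  qed
  define \<rho>' where "\<rho>' g = W g (SOME i. g \<otimes> inv (x [^] i) \<in> M)" for g
  have some: "g \<otimes> inv (x [^] (SOME i::nat. g \<otimes> inv (x [^] i) \<in> M)) \<in> M" if "g \<in> carrier G" for g
    by (rule someI_ex[of "\<lambda>i::nat. g \<otimes> inv (x [^] i) \<in> M"]) (use coset_rep[OF that] in blast)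
  have \<rho>'_eq: "\<rho>' g = W g i" if "g \<in> carrier G" "g \<otimes> inv (x [^] i) \<in> M" for g and i :: nat
    unfolding \<rho>'_def using Weq[OF that(1) some[OF that(1)] that(2)] .
  have ext: "\<rho>' m = \<rho> m" if m: "m \<in> M" for m
  proof -
    have "\<rho>' m = W m 0" using \<rho>'_eq[of m 0] m M_G[OF m] by simp
    then show ?thesis using rD(1)[OF m] T M_G[OF m] by (simp add: W_def)
  qed
  have "representation G n \<rho>'"
    unfolding rep_iff
  proof (intro conjI ballI)
    show "\<rho>' \<one> = 1\<^sub>m n" using ext[OF M_one] rD(3) by simp
    fix g assume g: "g \<in> carrier G"
    show "\<rho>' g \<in> carrier_mat n n"
      unfolding \<rho>'_def W_def using rD(1)[OF some[OF g]] Tc by (rule mult_carrier_mat)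
    fix h assume h: "h \<in> carrier G"
    have "\<rho>' g * \<rho>' h = \<rho>' (g \<otimes> h)"
      using Wmult[OF g some[OF g] h some[OF h]]
        \<rho>'_eq[OF m_closed[OF g h] conjunct2[OF Wmult[OF g some[OF g] h some[OF h]]]]
      unfolding \<rho>'_def[of g] \<rho>'_def[of h] by simp
    then show "\<rho>' (g \<otimes> h) = \<rho>' g * \<rho>' h" by simp
  qed
  moreover have "\<exists>m\<in>M. \<exists>i. \<rho>' g = \<rho> m * T ^\<^sub>m i" if "g \<in> carrier G" for g
    using some[OF that] unfolding \<rho>'_def W_def by blast
  ultimately show ?thesis using that ext by blast
qed

lemma conjugate_irreducible:
  assumes \<rho>: "irreducible_representation H n \<rho>"
  shows "irreducible_representation H n (\<lambda>m. \<rho> (x \<otimes> m \<otimes> inv x))"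
proof -
  interpret H: fin_group H by (rule H_group)
  note rD = restrict_repD[OF H.irr_rep[OF \<rho>]]
  have cm: "x \<otimes> (m \<otimes> m') \<otimes> inv x = (x \<otimes> m \<otimes> inv x) \<otimes> (x \<otimes> m' \<otimes> inv x)" if "m \<in> M" "m' \<in> M" for m m'
    using that M_G by (simp add: m_assoc inv_cancel)
  have r: "representation H n (\<lambda>m. \<rho> (x \<otimes> m \<otimes> inv x))"
    unfolding H.rep_iff using rD M_conj[OF x] cm by auto
  show ?thesis
  proof (rule H.irreducible_if_commutant_scalar[OF r H.irr_pos[OF \<rho>]])
    fix E assume E: "E \<in> carrier_mat n n"
      and comm: "\<And>m. m \<in> carrier H \<Longrightarrow> \<rho> (x \<otimes> m \<otimes> inv x) * E = E * \<rho> (x \<otimes> m \<otimes> inv x)"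
    have "\<rho> m * E = E * \<rho> m" if m: "m \<in> M" for m
    proof -
      have "inv x \<otimes> m \<otimes> x \<in> M" using M_conj[of "inv x" m] m by simp
      moreover have "x \<otimes> (inv x \<otimes> m \<otimes> x) \<otimes> inv x = m"
        using M_G[OF m] by (simp add: m_assoc inv_cancel)
      ultimately show ?thesis using comm[of "inv x \<otimes> m \<otimes> x"] by simp
    qed
    then obtain c where "E = c \<cdot>\<^sub>m 1\<^sub>m n" using H.schur_scalar[OF \<rho> E] by auto
    then show "\<exists>c. E = c \<cdot>\<^sub>m 1\<^sub>m n" by blast
  qed
qed

text \<open>
  An invariant irreducible representation \<open>\<rho>\<close> of \<open>M\<close> admits \<open>T\<close> with \<open>T \<rho>(m) T\<^sup>-\<^sup>1 = \<rho>(x m x\<^sup>-\<^sup>1)\<close>. By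
  Schur's lemma \<open>T\<^sup>p\<close> is a multiple of \<open>\<rho>(x\<^sup>p)\<close>, and \<open>T\<close> can be rescaled to make them equal. Then
  \<open>det(T)\<^sup>k\<close> is a \<open>p\<close>-th root of unity, which the remaining freedom of a \<open>p\<close>-th root of unity
  normalises to \<open>1\<close>.
\<close>

theorem extension:
  assumes pk: "\<not> p dvd k" and \<theta>: "\<theta> \<in> Irr_det p k H" and inv: "\<And>m. m \<in> M \<Longrightarrow> \<theta> (x \<otimes> m \<otimes> inv x) = \<theta> m"
  obtains \<chi> where "\<chi> \<in> Irr_det p k G" "restrict \<chi> M = \<theta>"
proof -
  interpret H: fin_group H by (rule H_group)
  obtain n \<rho> where r: "irreducible_representation H n \<rho>" "\<theta> = character_of H \<rho>" "\<not> p dvd n"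
    "\<And>g. g \<in> carrier H \<Longrightarrow> det (\<rho> g) ^ k = 1" using H.Irr_detE[OF \<theta>] by metis
  note rD = restrict_repD[OF H.irr_rep[OF r(1)]]
  have n: "0 < n" using H.irr_pos[OF r(1)] .
  have "character_of H (\<lambda>m. \<rho> (x \<otimes> m \<otimes> inv x)) = character_of H \<rho>"
    unfolding H.character_of_eq_iff
  proof
    fix m assume m: "m \<in> carrier H"
    then show "mat_trace (\<rho> (x \<otimes> m \<otimes> inv x)) = mat_trace (\<rho> m)"
      using inv[of m] M_conj[OF x, of m] by (simp add: r(2))
  qed
  then obtain T where "H.equivalent_by n T (\<lambda>m. \<rho> (x \<otimes> m \<otimes> inv x)) \<rho>"
    using H.equivalent_if_same_character[OF conjugate_irreducible[OF r(1)] r(1)] by blast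
  then have T: "T \<in> carrier_mat n n" "det T \<noteq> 0" and TM: "\<And>m. m \<in> M \<Longrightarrow> T * \<rho> m = \<rho> (x \<otimes> m \<otimes> inv x) * T"
    unfolding H.equivalent_by_def by auto
  have Tpow: "T ^\<^sub>m i * \<rho> m = \<rho> (x [^] i \<otimes> m \<otimes> inv (x [^] i)) * T ^\<^sub>m i" if "m \<in> M" for i m
    using power_conjugation[OF H.irr_rep[OF r(1)] T(1) TM that] .
  let ?y = "x [^] p"
  have y: "?y \<in> M" "inv ?y \<in> M" using xp_M M_inv by auto
  have cy: "\<rho> ?y \<in> carrier_mat n n" "\<rho> (inv ?y) \<in> carrier_mat n n" using rD(1) y by auto
  have yy: "\<rho> ?y * \<rho> (inv ?y) = 1\<^sub>m n" "\<rho> (inv ?y) * \<rho> ?y = 1\<^sub>m n"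
    using rD(2)[of ?y "inv ?y"] rD(2)[of "inv ?y" ?y] y rD(3) by simp_all
  have Tpc: "T ^\<^sub>m p \<in> carrier_mat n n" using T by simp
  have "\<rho> m * (\<rho> (inv ?y) * T ^\<^sub>m p) = (\<rho> (inv ?y) * T ^\<^sub>m p) * \<rho> m" if m: "m \<in> carrier H" for m
  proof -
    have mM: "m \<in> M" using m by simp
    let ?c = "?y \<otimes> m \<otimes> inv ?y"
    have cM: "?c \<in> M" using M_conj[OF _ mM] by simp
    have c: "\<rho> m \<in> carrier_mat n n" "\<rho> ?c \<in> carrier_mat n n" using rD(1) mM cM by auto
    have "(\<rho> (inv ?y) * T ^\<^sub>m p) * \<rho> m = \<rho> (inv ?y) * (\<rho> ?c * T ^\<^sub>m p)"
      using assoc_mult_mat[OF cy(2) Tpc c(1)] Tpow[OF mM] by simp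
    also have "\<dots> = \<rho> (inv ?y \<otimes> ?c) * T ^\<^sub>m p"
      using assoc_mult_mat[OF cy(2) c(2) Tpc] rD(2)[OF y(2) cM] by simp
    also have "inv ?y \<otimes> ?c = m \<otimes> inv ?y"
      using M_G[OF mM] by (simp add: m_assoc inv_cancel)
    also have "\<rho> (m \<otimes> inv ?y) * T ^\<^sub>m p = \<rho> m * (\<rho> (inv ?y) * T ^\<^sub>m p)"
      unfolding rD(2)[OF mM y(2)] using c(1) cy(2) Tpc by (rule assoc_mult_mat)
    finally show ?thesis by simp
  qed
  then obtain c where c: "\<rho> (inv ?y) * T ^\<^sub>m p = c \<cdot>\<^sub>m 1\<^sub>m n"
    using H.schur_scalar[OF r(1), of "\<rho> (inv ?y) * T ^\<^sub>m p"] cy(2) Tpc by auto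
  have Tp: "T ^\<^sub>m p = c \<cdot>\<^sub>m \<rho> ?y"
  proof -
    have "T ^\<^sub>m p = \<rho> ?y * (\<rho> (inv ?y) * T ^\<^sub>m p)"
      using assoc_mult_mat[OF cy Tpc] yy(1) left_mult_one_mat[OF Tpc] by simp
    then show ?thesis unfolding c using mult_smult_one(1)[OF cy(1)] by simp
  qed
  have "det (T ^\<^sub>m p) \<noteq> 0" using T by (simp add: det_pow_mat)
  then have c0: "c \<noteq> 0" using n cy(1) unfolding Tp by auto
  obtain s where s: "s ^ p = 1 / c" using complex_root_exists[OF p_pos] .
  \<comment> \<open>First rescaling: the \<open>p\<close>-th power becomes \<open>\<rho>(x\<^sup>p)\<close>.\<close>
  define T1 where "T1 = s \<cdot>\<^sub>m T"
  have T1: "T1 \<in> carrier_mat n n" using T by (simp add: T1_def)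
  have T1p: "T1 ^\<^sub>m p = \<rho> ?y"
    unfolding T1_def smult_pow_mat[OF T(1)] Tp s using c0 by (simp add: smult_smult_mat one_smult_mat)
  define d where "d = det T1 ^ k"
  have dp: "d ^ p = 1"
  proof -
    have "d ^ p = det (T1 ^\<^sub>m p) ^ k" unfolding d_def det_pow_mat[OF T1] by (simp add: power_mult[symmetric] mult.commute)
    then show ?thesis unfolding T1p using r(4)[of ?y] y(1) by simp
  qed
  have "coprime (n * k) p" using p pk r(3) by (meson coprime_commute prime_dvd_mult_iff prime_imp_coprime)
  then obtain t where t: "[n * k * t = 1] (mod p)" using cong_solve_coprime_nat[of "n * k" p] by auto
  define \<omega> where "\<omega> = inverse d ^ t"
  have \<omega>p: "\<omega> ^ p = 1"
  proof -
    have "\<omega> ^ p = inverse (d ^ p) ^ t" unfolding \<omega>_def by (simp add: power_mult[symmetric] mult.commute power_inverse)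
    then show ?thesis using dp by simp
  qed
  have \<omega>d: "\<omega> ^ (n * k) * d = 1"
  proof -
    have "1 < p" using p prime_gt_1_nat by blast
    then have "(n * k * t) mod p = 1" using t unfolding cong_def by (metis mod_less)
    then have e: "n * k * t = p * ((n * k * t) div p) + 1" by (metis mult_div_mod_eq)
    have "\<omega> ^ (n * k) = inverse (d ^ (n * k * t))" unfolding \<omega>_def by (simp add: power_mult[symmetric] mult_ac power_inverse)
    also have "d ^ (n * k * t) = (d ^ p) ^ ((n * k * t) div p) * d"
      using e by (metis power_add power_mult power_one_right)
    also have "\<dots> = d" using dp by simp
    finally show ?thesis using dp p_pos by (metis left_inverse power_eq_0_iff zero_neq_one)
  qed
  \<comment> \<open>Second rescaling, by a \<open>p\<close>-th root of unity: the determinant is normalised.\<close>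
  define T2 where "T2 = \<omega> \<cdot>\<^sub>m T1"
  have T2: "T2 \<in> carrier_mat n n" using T1 by (simp add: T2_def)
  have T2p: "T2 ^\<^sub>m p = \<rho> ?y" unfolding T2_def smult_pow_mat[OF T1] T1p \<omega>p by (simp add: one_smult_mat)
  have T2d: "det T2 ^ k = 1"
  proof -
    have "det T2 ^ k = \<omega> ^ (n * k) * d" unfolding T2_def d_def using T1 by (simp add: power_mult_distrib power_mult)
    then show ?thesis using \<omega>d by simp
  qed
  have T2M: "T2 * \<rho> m = \<rho> (x \<otimes> m \<otimes> inv x) * T2" if m: "m \<in> M" for m
    unfolding T2_def T1_def smult_smult_mat
    using mult_smult_assoc_mat[OF T(1) rD(1)[OF m]] mult_smult_distrib[OF rD(1)[OF M_conj[OF x m]] T(1)] TM[OF m] by simp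
  obtain \<rho>' where e: "representation G n \<rho>'" "\<And>m. m \<in> M \<Longrightarrow> \<rho>' m = \<rho> m"
    "\<And>g. g \<in> carrier G \<Longrightarrow> \<exists>m\<in>M. \<exists>i. \<rho>' g = \<rho> m * T2 ^\<^sub>m i"
    using extend_representation[OF H.irr_rep[OF r(1)] T2 T2M T2p] by blast
  have irr: "irreducible_representation G n \<rho>'"
  proof (rule irreducible_if_commutant_scalar[OF e(1) n])
    fix E assume E: "E \<in> carrier_mat n n" and comm: "\<And>g. g \<in> carrier G \<Longrightarrow> \<rho>' g * E = E * \<rho>' g"
    have "\<rho> m * E = E * \<rho> m" if "m \<in> carrier H" for m
      using comm[of m] e(2)[of m] that M_G[of m] by simp
    then obtain c where "E = c \<cdot>\<^sub>m 1\<^sub>m n" using H.schur_scalar[OF r(1) E] by blast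
    then show "\<exists>c. E = c \<cdot>\<^sub>m 1\<^sub>m n" by blast
  qed
  have "det (\<rho>' g) ^ k = 1" if g: "g \<in> carrier G" for g
  proof -
    obtain m i where mi: "m \<in> M" "\<rho>' g = \<rho> m * T2 ^\<^sub>m i" using e(3)[OF g] by blast
    have "det (\<rho>' g) ^ k = det (\<rho> m) ^ k * (det T2 ^ k) ^ i"
      unfolding mi(2) using det_mult[OF rD(1)[OF mi(1)], of "T2 ^\<^sub>m i"] T2
      by (simp add: det_pow_mat power_mult_distrib power_mult[symmetric] mult.commute)
    then show ?thesis using r(4)[of m] mi(1) T2d by simp
  qed
  then have "character_of G \<rho>' \<in> Irr_det p k G" by (rule Irr_detI[OF irr r(3)])
  moreover have "restrict (character_of G \<rho>') M = \<theta>"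
    unfolding restrict_character r(2) H.character_of_eq_iff using e(2) by simp
  ultimately show ?thesis using that by blast
qed

lemma char_degree_restrict: "char_degree H (restrict \<chi> M) = char_degree G \<chi>"
  using M_one by (simp add: char_degree_def)

text \<open>
  Restriction is a bijection from the characters counted on the left to the fixed points of
  conjugation by \<open>x\<close> on those counted on the right. This conjugation has order dividing \<open>p\<close>,
  because \<open>x\<^sup>p \<in> M\<close> and characters are class functions.
\<close>

theorem degree_square_sum_restriction:
  assumes pk: "\<not> p dvd k"
  shows "[degree_square_sum G (Irr_det p k G) = degree_square_sum H (Irr_det p k H)] (mod p)"
proof -
  interpret H: fin_group H by (rule H_group)
  define f where "f \<theta> = (\<lambda>m\<in>M. \<theta> (x \<otimes> m \<otimes> inv x) :: complex)" for \<theta>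
  let ?S = "Irr_det p k H"
  have fS: "f \<theta> \<in> ?S \<and> char_degree H (f \<theta>) = char_degree H \<theta>" if \<theta>: "\<theta> \<in> ?S" for \<theta>
  proof -
    obtain n \<rho> where r: "irreducible_representation H n \<rho>" "\<theta> = character_of H \<rho>" "\<not> p dvd n"
      "\<And>g. g \<in> carrier H \<Longrightarrow> det (\<rho> g) ^ k = 1" using H.Irr_detE[OF \<theta>] by metis
    have "f \<theta> = character_of H (\<lambda>m. \<rho> (x \<otimes> m \<otimes> inv x))"
      unfolding f_def r(2) character_of_def using M_conj[OF x] by (auto intro!: restrict_ext)
    then show ?thesis
      using H.Irr_detI[OF conjugate_irreducible[OF r(1)] r(3)] r(4) M_conj[OF x] r(2)
        H.char_degree_character_of[OF H.irr_rep[OF r(1)]]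
        H.char_degree_character_of[OF H.irr_rep[OF conjugate_irreducible[OF r(1)]]] by simp
  qed
  have fpow: "(f ^^ i) \<theta> = (\<lambda>m\<in>M. \<theta> (x [^] i \<otimes> m \<otimes> inv (x [^] i)))" if \<theta>: "\<theta> \<in> ?S" for \<theta> i
  proof (induction i)
    case 0
    obtain \<rho> where "\<theta> = character_of H \<rho>" using H.Irr_detE[OF \<theta>] by metis
    then show ?case using M_G by (auto simp: character_of_def restrict_def fun_eq_iff)
  next
    case (Suc i)
    have "x [^] i \<otimes> (x \<otimes> m \<otimes> inv x) \<otimes> inv (x [^] i) = x [^] Suc i \<otimes> m \<otimes> inv (x [^] Suc i)" if "m \<in> M" for m
      using M_G[OF that] by (simp add: m_assoc inv_mult_group)
    moreover have "(f ^^ Suc i) \<theta> = (\<lambda>m\<in>M. \<theta> (x [^] i \<otimes> (x \<otimes> m \<otimes> inv x) \<otimes> inv (x [^] i)))"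
      unfolding funpow.simps o_apply Suc unfolding f_def using M_conj[OF x] by (intro restrict_ext) simp
    ultimately show ?case by (auto intro!: restrict_ext)
  qed
  have "[(\<Sum>\<theta>\<in>?S. (char_degree H \<theta>)\<^sup>2) = (\<Sum>\<theta>\<in>{\<theta> \<in> ?S. f \<theta> = \<theta>}. (char_degree H \<theta>)\<^sup>2)] (mod p)"
  proof (rule fixed_points_mod_prime[OF p H.finite_Irr_det])
    show "f ` ?S \<subseteq> ?S" using fS by blast
    show "(char_degree H (f \<theta>))\<^sup>2 = (char_degree H \<theta>)\<^sup>2" if "\<theta> \<in> ?S" for \<theta> using fS[OF that] by simp
    fix \<theta> assume \<theta>: "\<theta> \<in> ?S"
    obtain n \<rho> where r: "irreducible_representation H n \<rho>" "\<theta> = character_of H \<rho>" using H.Irr_detE[OF \<theta>] by metis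
    have "\<theta> (x [^] p \<otimes> m \<otimes> inv (x [^] p)) = \<theta> m" if m: "m \<in> M" for m
      using H.trace_conjugate[OF H.irr_rep[OF r(1)], of "x [^] p" m] xp_M m M_conj[of "x [^] p" m]
      by (simp add: r(2) m_inv_consistent[OF M_subgroup])
    then show "(f ^^ p) \<theta> = \<theta>"
      unfolding fpow[OF \<theta>] by (auto simp: r(2) character_of_def restrict_def fun_eq_iff)
  qed
  moreover have "(\<lambda>\<chi>. restrict \<chi> M) ` Irr_det p k G = {\<theta> \<in> ?S. f \<theta> = \<theta>}"
  proof
    show "(\<lambda>\<chi>. restrict \<chi> M) ` Irr_det p k G \<subseteq> {\<theta> \<in> ?S. f \<theta> = \<theta>}"
    proof (rule image_subsetI)
      fix \<chi> assume \<chi>: "\<chi> \<in> Irr_det p k G"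
      obtain n \<rho> where r: "irreducible_representation G n \<rho>" "\<chi> = character_of G \<rho>" using Irr_detE[OF \<chi>] by metis
      have "f (restrict \<chi> M) = restrict \<chi> M"
        unfolding f_def r(2)
        using trace_conjugate[OF irr_rep[OF r(1)] x] M_conj[OF x] M_G by (auto intro!: restrict_ext)
      then show "restrict \<chi> M \<in> {\<theta> \<in> ?S. f \<theta> = \<theta>}" using restrict_Irr_det[OF \<chi>] by simp
    qed
    show "{\<theta> \<in> ?S. f \<theta> = \<theta>} \<subseteq> (\<lambda>\<chi>. restrict \<chi> M) ` Irr_det p k G"
    proof
      fix \<theta> assume "\<theta> \<in> {\<theta> \<in> ?S. f \<theta> = \<theta>}"
      then have \<theta>: "\<theta> \<in> ?S" "f \<theta> = \<theta>" by auto
      have "\<theta> (x \<otimes> m \<otimes> inv x) = \<theta> m" if "m \<in> M" for m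
        using fun_cong[OF \<theta>(2), of m] that by (simp add: f_def)
      then obtain \<chi> where "\<chi> \<in> Irr_det p k G" "restrict \<chi> M = \<theta>" using extension[OF pk \<theta>(1)] by blast
      then show "\<theta> \<in> (\<lambda>\<chi>. restrict \<chi> M) ` Irr_det p k G" by blast
    qed
  qed
  ultimately have "[(\<Sum>\<theta>\<in>?S. (char_degree H \<theta>)\<^sup>2) = (\<Sum>\<theta>\<in>(\<lambda>\<chi>. restrict \<chi> M) ` Irr_det p k G. (char_degree H \<theta>)\<^sup>2)] (mod p)"
    by simp
  also have "(\<Sum>\<theta>\<in>(\<lambda>\<chi>. restrict \<chi> M) ` Irr_det p k G. (char_degree H \<theta>)\<^sup>2) = degree_square_sum G (Irr_det p k G)"
    by (simp add: sum.reindex[OF restriction_inj[OF pk]] char_degree_restrict degree_square_sum_def)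
  finally show ?thesis by (simp add: degree_square_sum_def cong_sym)
qed

end


section \<open>Descent to the last term of the chain\<close>

text \<open>
  All determinants have order prime to \<open>p\<close> here, so the sum runs over all degrees prime to \<open>p\<close>, and
  the other degrees contribute multiples of \<open>p\<close> to \<open>|G|\<close>.
\<close>

lemma descent_base:
  fixes G :: "('a, 'b) monoid_scheme"
  assumes p: "prime p" and G: "fin_group G" and card: "card (carrier G) = k * p ^ c" and lin: "\<not> p dvd card (linear_characters G)"
  shows "\<exists>N b. subgroup N G \<and> {g \<in> carrier G. g [^]\<^bsub>G\<^esub> k = \<one>\<^bsub>G\<^esub>} \<subseteq> N \<and> card N = k * p ^ b \<and>
      \<not> p dvd card (linear_characters (G\<lparr>carrier := N\<rparr>)) \<and>
      [degree_square_sum G (Irr_det p k G) = card N] (mod p) \<and>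
      inj_on (\<lambda>\<chi>. restrict \<chi> N) (Irr_det p k G) \<and>
      (\<lambda>\<chi>. restrict \<chi> N) ` Irr_det p k G \<subseteq> Irr_det p k (G\<lparr>carrier := N\<rparr>)"
proof -
  interpret fin_group G by (rule G)
  let ?l = "card (linear_characters G)"
  have "?l dvd k * p ^ c" using card_linear_characters card by (metis dvd_triv_left)
  moreover have "coprime ?l (p ^ c)" using lin p by (metis coprime_commute coprime_power_left_iff prime_imp_coprime)
  ultimately have lk: "?l dvd k" by (simp add: coprime_dvd_mult_left_iff)
  have eq: "Irr_det p k G = {\<chi> \<in> Irr G. \<not> p dvd char_degree G \<chi>}"
  proof
    show "Irr_det p k G \<subseteq> {\<chi> \<in> Irr G. \<not> p dvd char_degree G \<chi>}"
    proof
      fix \<chi> assume \<chi>: "\<chi> \<in> Irr_det p k G"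
      obtain n \<rho> where "irreducible_representation G n \<rho>" "\<chi> = character_of G \<rho>" "\<not> p dvd n"
        using Irr_detE[OF \<chi>] by metis
      then show "\<chi> \<in> {\<chi> \<in> Irr G. \<not> p dvd char_degree G \<chi>}"
        using IrrI char_degree_character_of[OF irr_rep] by simp
    qed
    show "{\<chi> \<in> Irr G. \<not> p dvd char_degree G \<chi>} \<subseteq> Irr_det p k G"
    proof
      fix \<chi> assume \<chi>: "\<chi> \<in> {\<chi> \<in> Irr G. \<not> p dvd char_degree G \<chi>}"
      then obtain n \<rho> where r: "irreducible_representation G n \<rho>" "\<chi> = character_of G \<rho>" using IrrE by blast
      have "\<not> p dvd n" using \<chi> r char_degree_character_of[OF irr_rep[OF r(1)]] by simp
      moreover have "det (\<rho> g) ^ k = 1" if g: "g \<in> carrier G" for g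
      proof -
        have "det (\<rho> g) ^ ?l = 1"
          using lin_pow_card[OF det_linear_character[OF irr_rep[OF r(1)]] g] g by simp
        then show ?thesis using lk by (auto simp: power_mult)
      qed
      ultimately show "\<chi> \<in> Irr_det p k G" unfolding r(2) by (intro Irr_detI[OF r(1)])
    qed
  qed
  have "(\<Sum>\<chi>\<in>Irr G. (char_degree G \<chi>)\<^sup>2) = degree_square_sum G (Irr_det p k G) +
      (\<Sum>\<chi>\<in>{\<chi> \<in> Irr G. p dvd char_degree G \<chi>}. (char_degree G \<chi>)\<^sup>2)"
    unfolding degree_square_sum_def eq
    by (subst sum.union_disjoint[symmetric]) (auto simp: finite_Irr intro!: sum.cong)
  moreover have "p dvd (\<Sum>\<chi>\<in>{\<chi> \<in> Irr G. p dvd char_degree G \<chi>}. (char_degree G \<chi>)\<^sup>2)"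
    by (intro dvd_sum) (auto simp: power2_eq_square)
  ultimately have "[degree_square_sum G (Irr_det p k G) = card (carrier G)] (mod p)"
    unfolding sum_squared_degrees by (auto simp: cong_def)
  moreover have rs: "restrict \<chi> (carrier G) = \<chi>" if \<chi>: "\<chi> \<in> Irr_det p k G" for \<chi>
  proof -
    obtain n \<rho> where "\<chi> = character_of G \<rho>" using Irr_detE[OF \<chi>] by metis
    then show ?thesis by (simp add: character_of_def)
  qed
  moreover have "inj_on (\<lambda>\<chi>. restrict \<chi> (carrier G)) (Irr_det p k G)"
    using rs by (intro inj_onI) metis
  ultimately show ?thesis
    using card lin subgroup_self by (intro exI[of _ "carrier G"] exI[of _ c]) auto
qed

text \<open>
  Iterating the passage to a normal subgroup of index \<open>p\<close> ends at a subgroup \<open>N\<close> (in fact at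
  \<open>O\<^sup>p(G)\<close>) without a linear character of order \<open>p\<close>. There the determinant condition is void, and
  the sum of all squared degrees is \<open>|N|\<close>.
\<close>

theorem descent:
  assumes p: "prime p" and pk: "\<not> p dvd k"
  shows "fin_group G \<Longrightarrow> card (carrier G) = k * p ^ c \<Longrightarrow>
    \<exists>N b. subgroup N G \<and> {g \<in> carrier G. g [^]\<^bsub>G\<^esub> k = \<one>\<^bsub>G\<^esub>} \<subseteq> N \<and> card N = k * p ^ b \<and>
      \<not> p dvd card (linear_characters (G\<lparr>carrier := N\<rparr>)) \<and>
      [degree_square_sum G (Irr_det p k G) = card N] (mod p) \<and>
      inj_on (\<lambda>\<chi>. restrict \<chi> N) (Irr_det p k G) \<and>
      (\<lambda>\<chi>. restrict \<chi> N) ` Irr_det p k G \<subseteq> Irr_det p k (G\<lparr>carrier := N\<rparr>)"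
proof (induction c arbitrary: G)
  case 0
  then interpret fin_group G by blast
  have "\<not> p dvd card (linear_characters G)"
    using card_linear_characters 0(2) pk by (metis dvd_mult2 mult.right_neutral power_0)
  then show ?case using descent_base[OF p 0] by blast
next
  case (Suc c G)
  interpret fin_group G by (rule Suc.prems(1))
  show ?case
  proof (cases "p dvd card (linear_characters G)")
    case False
    then show ?thesis using descent_base[OF p Suc.prems] by blast
  next
    case True
    obtain \<mu> x where \<mu>: "\<mu> \<in> linear_characters G" "\<And>g. g \<in> carrier G \<Longrightarrow> \<mu> g ^ p = 1" "x \<in> carrier G" "\<mu> x \<noteq> 1"
      using lin_of_prime_order[OF p True] by blast
    interpret K: prime_kernel G p \<mu> x by unfold_locales (use p \<mu> in auto)
    let ?H = "G\<lparr>carrier := K.M\<rparr>"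
    have "card K.M = k * p ^ c" using K.card_G Suc.prems(2) K.p_pos by simp
    then have "card (carrier ?H) = k * p ^ c" by simp
    then obtain N b where N: "subgroup N ?H" "{g \<in> carrier ?H. g [^]\<^bsub>?H\<^esub> k = \<one>\<^bsub>?H\<^esub>} \<subseteq> N" "card N = k * p ^ b"
      "\<not> p dvd card (linear_characters (?H\<lparr>carrier := N\<rparr>))"
      "[degree_square_sum ?H (Irr_det p k ?H) = card N] (mod p)"
      "inj_on (\<lambda>\<chi>. restrict \<chi> N) (Irr_det p k ?H)"
      "(\<lambda>\<chi>. restrict \<chi> N) ` Irr_det p k ?H \<subseteq> Irr_det p k (?H\<lparr>carrier := N\<rparr>)"
      using Suc.IH[OF K.H_group] by blast
    have NM: "N \<subseteq> K.M" using subgroup.subset[OF N(1)] by simp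
    have rr: "restrict \<chi> N = restrict (restrict \<chi> K.M) N" for \<chi> :: "'a \<Rightarrow> complex"
      using NM by (auto simp: restrict_def fun_eq_iff)
    have 1: "subgroup N G" using incl_subgroup[OF K.M_subgroup N(1)] .
    have 2: "{g \<in> carrier G. g [^]\<^bsub>G\<^esub> k = \<one>\<^bsub>G\<^esub>} \<subseteq> N"
    proof
      fix g assume "g \<in> {g \<in> carrier G. g [^]\<^bsub>G\<^esub> k = \<one>\<^bsub>G\<^esub>}"
      then have g: "g \<in> carrier G" "g [^]\<^bsub>G\<^esub> k = \<one>\<^bsub>G\<^esub>" by auto
      have "\<mu> g ^ k = 1" using lin_pow[OF \<mu>(1) g(1), of k] g(2) linD(2)[OF \<mu>(1)] by simp
      moreover have "coprime k p" using p pk by (metis coprime_commute prime_imp_coprime)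
      ultimately have "\<mu> g = 1" using coprime_powers_eq_one[OF _ \<mu>(2)[OF g(1)]] by blast
      then have "g \<in> K.M" using g(1) by (simp add: K.M_def)
      then show "g \<in> N" using N(2) g(2) nat_pow_consistent[of g k K.M] by auto
    qed
    have 3: "[degree_square_sum G (Irr_det p k G) = card N] (mod p)"
      using K.degree_square_sum_restriction[OF pk] N(5) cong_trans by blast
    have 4: "inj_on (\<lambda>\<chi>. restrict \<chi> N) (Irr_det p k G)"
    proof (rule inj_onI)
      fix \<chi> \<psi> assume *: "\<chi> \<in> Irr_det p k G" "\<psi> \<in> Irr_det p k G" "restrict \<chi> N = restrict \<psi> N"
      have "restrict \<chi> K.M = restrict \<psi> K.M"
        using inj_onD[OF N(6)] *(3) K.restrict_Irr_det *(1,2) rr by metis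
      then show "\<chi> = \<psi>" using inj_onD[OF K.restriction_inj[OF pk]] *(1,2) by metis
    qed
    have 5: "(\<lambda>\<chi>. restrict \<chi> N) ` Irr_det p k G \<subseteq> Irr_det p k (G\<lparr>carrier := N\<rparr>)"
    proof (rule image_subsetI)
      fix \<chi> assume "\<chi> \<in> Irr_det p k G"
      then have "restrict (restrict \<chi> K.M) N \<in> Irr_det p k (?H\<lparr>carrier := N\<rparr>)"
        using N(7) K.restrict_Irr_det by blast
      moreover have "?H\<lparr>carrier := N\<rparr> = G\<lparr>carrier := N\<rparr>" by simp
      ultimately show "restrict \<chi> N \<in> Irr_det p k (G\<lparr>carrier := N\<rparr>)" by (metis rr)
    qed
    have 6: "\<not> p dvd card (linear_characters (G\<lparr>carrier := N\<rparr>))" using N(4) by simp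
    show ?thesis using 1 2 N(3) 6 3 4 5 by blast
  qed
qed


section \<open>Automorphisms preserving all conjugacy classes\<close>

context fin_group
begin

text \<open>
  Count the pairs \<open>(a, q)\<close> with \<open>a q a\<^sup>-\<^sup>1 \<in> C\<close>. There are \<open>|G| |C|\<close> of them, each \<open>q\<close> occurs at least
  \<open>|C|\<close> times because \<open>C\<close> acts freely on the admissible \<open>a\<close>, but the identity occurs \<open>|G|\<close> times.
\<close>

lemma subgroup_meeting_all_classes:
  assumes C: "subgroup C G" and meet: "\<And>q. q \<in> carrier G \<Longrightarrow> \<exists>a\<in>carrier G. a \<otimes> q \<otimes> inv a \<in> C"
  shows "C = carrier G"
proof -
  have CG: "C \<subseteq> carrier G" using subgroup.subset[OF C] .
  have fC: "finite C" using finite_subset[OF CG fin] .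
  let ?D = "\<lambda>q. {a \<in> carrier G. a \<otimes> q \<otimes> inv a \<in> C}"
  have D_ge: "card C \<le> card (?D q)" if q: "q \<in> carrier G" for q
  proof -
    obtain a where a: "a \<in> carrier G" "a \<otimes> q \<otimes> inv a \<in> C" using meet[OF q] by blast
    have "(\<lambda>b. b \<otimes> a) ` C \<subseteq> ?D q"
    proof (rule image_subsetI)
      fix b assume b: "b \<in> C"
      have bG: "b \<in> carrier G" using b CG by blast
      have "b \<otimes> a \<otimes> q \<otimes> inv (b \<otimes> a) = b \<otimes> (a \<otimes> q \<otimes> inv a) \<otimes> inv b"
        using bG a(1) q by (simp add: m_assoc inv_mult_group)
      then show "b \<otimes> a \<in> ?D q"
        using bG a b subgroup.m_closed[OF C] subgroup.m_inv_closed[OF C] by simp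
    qed
    moreover have "inj_on (\<lambda>b. b \<otimes> a) C" using a(1) CG by (intro inj_onI) (simp add: subset_iff)
    ultimately show ?thesis using card_inj_on_le[of "\<lambda>b. b \<otimes> a" C "?D q"] by simp
  qed
  have "(\<Sum>q\<in>carrier G. card (?D q)) = (\<Sum>q\<in>carrier G. \<Sum>a\<in>carrier G. if a \<otimes> q \<otimes> inv a \<in> C then 1 else 0)"
    by (simp add: sum.If_cases Int_def)
  also have "\<dots> = (\<Sum>a\<in>carrier G. \<Sum>q\<in>carrier G. if a \<otimes> q \<otimes> inv a \<in> C then 1 else 0)" by (rule sum.swap)
  also have "\<dots> = (\<Sum>a\<in>carrier G. card C)"
  proof (intro sum.cong refl)
    fix a assume a: "a \<in> carrier G"
    have bij: "bij_betw (\<lambda>q. a \<otimes> q \<otimes> inv a) (carrier G) (carrier G)"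
      using a by (intro bij_betwI[where g = "\<lambda>q. inv a \<otimes> q \<otimes> a"]) (auto simp: m_assoc inv_cancel)
    have "(\<Sum>q\<in>carrier G. if a \<otimes> q \<otimes> inv a \<in> C then 1 else 0) = (\<Sum>q\<in>carrier G. if q \<in> C then 1 else (0::nat))"
      by (rule sum.reindex_bij_betw[OF bij, of "\<lambda>q. if q \<in> C then 1 else 0"])
    also have "\<dots> = card C" using CG by (simp add: sum.If_cases Int_absorb1)
    finally show "(\<Sum>q\<in>carrier G. if a \<otimes> q \<otimes> inv a \<in> C then 1 else 0) = card C" .
  qed
  finally have tot: "(\<Sum>q\<in>carrier G. card (?D q)) = card (carrier G) * card C" by simp
  have "?D \<one> = carrier G" using subgroup.one_closed[OF C] by auto
  then have "(\<Sum>q\<in>carrier G. card (?D q)) = card (carrier G) + (\<Sum>q\<in>carrier G - {\<one>}. card (?D q))"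
    by (subst sum.remove[of _ \<one>]) auto
  moreover have "(\<Sum>q\<in>carrier G - {\<one>}. card C) \<le> (\<Sum>q\<in>carrier G - {\<one>}. card (?D q))"
    by (intro sum_mono D_ge) auto
  moreover have "(\<Sum>q\<in>carrier G - {\<one>}. card C) = (card (carrier G) - 1) * card C" by simp
  ultimately have "card (carrier G) + (card (carrier G) - 1) * card C \<le> card (carrier G) * card C" using tot by simp
  moreover have "card (carrier G) * card C = (card (carrier G) - 1) * card C + card C"
    using ord_G_nonzero(2) by (cases "card (carrier G)") auto
  ultimately have "card (carrier G) \<le> card C" by simp
  then show ?thesis using card_seteq[OF fin CG] by simp
qed

text \<open>
  The automorphism permutes each conjugacy class. Weighting each point \<open>y\<close> of the class of \<open>q\<close> by
  the number of \<open>a\<close> with \<open>a q a\<^sup>-\<^sup>1 = y\<close> gives total weight \<open>|G|\<close>, which is prime to \<open>p\<close>, so the class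
  contains a fixed point. Hence the fixed subgroup meets every class.
\<close>

theorem class_preserving_automorphism_trivial:
  assumes p: "prime p" and pG: "\<not> p dvd card (carrier G)" and hom: "f \<in> hom G G"
    and cls: "\<And>q. q \<in> carrier G \<Longrightarrow> \<exists>a\<in>carrier G. f q = a \<otimes> q \<otimes> inv a"
    and per: "\<And>q. q \<in> carrier G \<Longrightarrow> (f ^^ (p ^ c)) q = q" and q: "q \<in> carrier G"
  shows "f q = q"
proof -
  let ?C = "{q \<in> carrier G. f q = q}"
  interpret f: group_hom G G f by unfold_locales (rule hom)
  have C: "subgroup ?C G"
    by (intro subgroupI) (auto simp: f.hom_mult f.hom_inv intro!: exI[of _ \<one>])
  have "\<exists>a\<in>carrier G. a \<otimes> q \<otimes> inv a \<in> ?C" if q: "q \<in> carrier G" for q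
  proof -
    let ?X = "(\<lambda>a. a \<otimes> q \<otimes> inv a) ` carrier G"
    let ?w = "\<lambda>y. card {a \<in> carrier G. a \<otimes> q \<otimes> inv a = y}"
    have XG: "?X \<subseteq> carrier G" using q by auto
    have w: "?w (d \<otimes> q \<otimes> inv d) = ?w q" if d: "d \<in> carrier G" for d
    proof -
      have "bij_betw (\<lambda>a. d \<otimes> a) {a \<in> carrier G. a \<otimes> q \<otimes> inv a = q} {a \<in> carrier G. a \<otimes> q \<otimes> inv a = d \<otimes> q \<otimes> inv d}"
      proof (intro bij_betwI[where g = "\<lambda>a. inv d \<otimes> a"])
        show "(\<lambda>a. d \<otimes> a) \<in> {a \<in> carrier G. a \<otimes> q \<otimes> inv a = q} \<rightarrow> {a \<in> carrier G. a \<otimes> q \<otimes> inv a = d \<otimes> q \<otimes> inv d}"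
        proof
          fix a assume "a \<in> {a \<in> carrier G. a \<otimes> q \<otimes> inv a = q}"
          then have a: "a \<in> carrier G" "a \<otimes> q \<otimes> inv a = q" by auto
          have "d \<otimes> a \<otimes> q \<otimes> inv (d \<otimes> a) = d \<otimes> (a \<otimes> q \<otimes> inv a) \<otimes> inv d"
            using a(1) d q by (simp add: m_assoc inv_mult_group)
          then show "d \<otimes> a \<in> {a \<in> carrier G. a \<otimes> q \<otimes> inv a = d \<otimes> q \<otimes> inv d}" using a d by simp
        qed
        show "(\<lambda>a. inv d \<otimes> a) \<in> {a \<in> carrier G. a \<otimes> q \<otimes> inv a = d \<otimes> q \<otimes> inv d} \<rightarrow> {a \<in> carrier G. a \<otimes> q \<otimes> inv a = q}"
        proof
          fix a assume "a \<in> {a \<in> carrier G. a \<otimes> q \<otimes> inv a = d \<otimes> q \<otimes> inv d}"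
          then have a: "a \<in> carrier G" "a \<otimes> q \<otimes> inv a = d \<otimes> q \<otimes> inv d" by auto
          have "inv d \<otimes> a \<otimes> q \<otimes> inv (inv d \<otimes> a) = inv d \<otimes> (a \<otimes> q \<otimes> inv a) \<otimes> d"
            using a(1) d q by (simp add: m_assoc inv_mult_group)
          also have "\<dots> = q" unfolding a(2) using d q by (simp add: m_assoc inv_cancel)
          finally show "inv d \<otimes> a \<in> {a \<in> carrier G. a \<otimes> q \<otimes> inv a = q}" using a(1) d by simp
        qed
      qed (use d in \<open>auto simp: inv_cancel\<close>)
      then show ?thesis by (rule bij_betw_same_card[symmetric])
    qed
    have fX: "f ` ?X \<subseteq> ?X"
    proof (rule image_subsetI)
      fix y assume "y \<in> ?X"
      then obtain a where a: "a \<in> carrier G" "y = a \<otimes> q \<otimes> inv a" by blast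
      then have "y \<in> carrier G" using q by simp
      then obtain b where b: "b \<in> carrier G" "f y = b \<otimes> y \<otimes> inv b" using cls by blast
      have "b \<otimes> y \<otimes> inv b = (b \<otimes> a) \<otimes> q \<otimes> inv (b \<otimes> a)"
        unfolding a(2) using a(1) b(1) q by (simp add: m_assoc inv_mult_group)
      then show "f y \<in> ?X" unfolding b(2) using a(1) b(1) by (intro image_eqI[of _ _ "b \<otimes> a"]) simp_all
    qed
    have "[(\<Sum>y\<in>?X. ?w y) = (\<Sum>y\<in>{y \<in> ?X. f y = y}. ?w y)] (mod p)"
    proof (rule fixed_points_mod_prime_power[OF p _ fX])
      show "(f ^^ (p ^ c)) y = y" if "y \<in> ?X" for y using per that XG by blast
      fix y assume y: "y \<in> ?X"
      then obtain d where d: "d \<in> carrier G" "y = d \<otimes> q \<otimes> inv d" by blast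
      obtain e where e: "e \<in> carrier G" "f y = e \<otimes> q \<otimes> inv e" using fX y by blast
      show "?w (f y) = ?w y" using w[OF e(1), folded e(2)] w[OF d(1), folded d(2)] by simp
    qed simp
    moreover have "(\<Sum>y\<in>?X. ?w y) = card (carrier G)"
      using sum.image_gen[OF fin, of "\<lambda>_. 1 :: nat" "\<lambda>a. a \<otimes> q \<otimes> inv a"] by simp
    ultimately have cg: "[card (carrier G) = (\<Sum>y\<in>{y \<in> ?X. f y = y}. ?w y)] (mod p)" by simp
    have "{y \<in> ?X. f y = y} \<noteq> {}"
    proof
      assume empty: "{y \<in> ?X. f y = y} = {}"
      have "[card (carrier G) = 0] (mod p)" using cg unfolding empty by simp
      then show False using pG by (simp add: cong_0_iff)
    qed
    then show ?thesis using XG by blast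
  qed
  then have "?C = carrier G" by (rule subgroup_meeting_all_classes[OF C])
  then show ?thesis using q by blast
qed

lemma subgroup_pow_card:
  assumes S: "subgroup S G" and g: "g \<in> S"
  shows "g [^] card S = \<one>"
proof -
  interpret S: group "G\<lparr>carrier := S\<rparr>" by (rule subgroup_imp_group[OF S])
  show ?thesis using S.pow_order_eq_1[of g] g nat_pow_consistent[of g "card S" S] by (simp add: Coset.order_def)
qed

lemma pow_cong:
  assumes "g \<in> carrier G" "g [^] (m::nat) = \<one>" "[e = e'] (mod m)"
  shows "g [^] e = g [^] e'"
proof -
  have "g [^] e = g [^] (e mod m)" for e
  proof -
    have "g [^] e = g [^] (m * (e div m) + e mod m)" by simp
    also have "\<dots> = (g [^] m) [^] (e div m) \<otimes> g [^] (e mod m)"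
      using assms(1) by (simp only: nat_pow_mult[symmetric] nat_pow_pow nat_pow_closed)
    finally show ?thesis using assms by simp
  qed
  then show ?thesis using assms(3) unfolding cong_def by metis
qed

lemma coprime_pow_one:
  assumes "g \<in> carrier G" "g [^] (m::nat) = \<one>" "g [^] (n::nat) = \<one>" "coprime m n"
  shows "g = \<one>"
proof -
  obtain e where "[e = 1] (mod m)" "[e = 0] (mod n)"
    using binary_chinese_remainder_nat[OF assms(4)] by blast
  then show ?thesis using pow_cong[OF assms(1,2), of e 1] pow_cong[OF assms(1,3), of e 0] assms(1) by simp
qed

lemma subgroup_product_card:
  assumes A: "subgroup A G" and B: "subgroup B G" and AB: "A \<inter> B = {\<one>}"
  shows "card (A <#> B) = card A * card B"
proof -
  have AG: "A \<subseteq> carrier G" and BG: "B \<subseteq> carrier G" using A B subgroup.subset by auto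
  have "inj_on (\<lambda>(a, b). a \<otimes> b) (A \<times> B)"
  proof (rule inj_onI, clarify)
    fix a b a' b' assume a: "a \<in> A" "a' \<in> A" and b: "b \<in> B" "b' \<in> B" and eq: "a \<otimes> b = a' \<otimes> b'"
    have G: "a \<in> carrier G" "a' \<in> carrier G" "b \<in> carrier G" "b' \<in> carrier G" using a b AG BG by auto
    have "inv a' \<otimes> a = b' \<otimes> inv b"
    proof -
      have "inv a' \<otimes> a = inv a' \<otimes> (a \<otimes> b) \<otimes> inv b" using G by (simp add: m_assoc)
      also have "\<dots> = b' \<otimes> inv b" unfolding eq using G by (simp add: m_assoc[symmetric])
      finally show ?thesis .
    qed
    moreover have "inv a' \<otimes> a \<in> A" using a subgroup.m_closed[OF A] subgroup.m_inv_closed[OF A] by simp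
    moreover have "b' \<otimes> inv b \<in> B" using b subgroup.m_closed[OF B] subgroup.m_inv_closed[OF B] by simp
    ultimately have "inv a' \<otimes> a = \<one>" "b' \<otimes> inv b = \<one>" using AB by auto
    then show "a = a' \<and> b = b'" using G by (metis inv_equality inv_inv inv_closed)
  qed
  moreover have "A <#> B = (\<lambda>(a, b). a \<otimes> b) ` (A \<times> B)" by (auto simp: set_mult_def)
  ultimately show ?thesis by (simp add: card_image card_cartesian_product)
qed

text \<open>
  Degrees divide the order, so those of nonlinear characters are divisible by \<open>p\<close>, and so is
  \<open>|G|\<close>, the sum of all squared degrees.
\<close>

lemma p_group_linear_characters:
  assumes p: "prime p" and card: "card (carrier G) = p ^ j" and j: "0 < j"
  shows "p dvd card (linear_characters G)"
proof -
  have deg: "char_degree G \<chi> = 1 \<longleftrightarrow> \<chi> \<in> linear_characters G" if \<chi>: "\<chi> \<in> Irr G" for \<chi>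
  proof
    assume *: "char_degree G \<chi> = 1"
    obtain n \<rho> where r: "irreducible_representation G n \<rho>" "\<chi> = character_of G \<rho>" using IrrE[OF \<chi>] .
    have "n = 1" using * char_degree_character_of[OF irr_rep[OF r(1)]] r(2) by simp
    then show "\<chi> \<in> linear_characters G" using degree_one_character(1) irr_rep[OF r(1)] r(2) by blast
  next
    assume "\<chi> \<in> linear_characters G"
    then show "char_degree G \<chi> = 1" using linD(2) by (intro char_degree_eqI) simp
  qed
  have "(\<Sum>\<chi>\<in>Irr G. (char_degree G \<chi>)\<^sup>2) =
      (\<Sum>\<chi>\<in>Irr G - linear_characters G. (char_degree G \<chi>)\<^sup>2) + (\<Sum>\<chi>\<in>linear_characters G. (char_degree G \<chi>)\<^sup>2)"
    by (rule sum.subset_diff[OF lin_in_Irr finite_Irr])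
  moreover have "(\<Sum>\<chi>\<in>linear_characters G. (char_degree G \<chi>)\<^sup>2) = card (linear_characters G)"
  proof -
    have "(char_degree G \<chi>)\<^sup>2 = 1" if "\<chi> \<in> linear_characters G" for \<chi>
      using deg[of \<chi>] that lin_in_Irr by auto
    then show ?thesis by simp
  qed
  moreover have "p dvd (\<Sum>\<chi>\<in>Irr G - linear_characters G. (char_degree G \<chi>)\<^sup>2)"
  proof (rule dvd_sum)
    fix \<chi> assume \<chi>: "\<chi> \<in> Irr G - linear_characters G"
    obtain n \<rho> where r: "irreducible_representation G n \<rho>" "\<chi> = character_of G \<rho>" using IrrE \<chi> by blast
    have n: "char_degree G \<chi> = n" using char_degree_character_of[OF irr_rep[OF r(1)]] r(2) by simp
    have "n dvd p ^ j" using degree_dvd_order[OF r(1)] card by simp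
    then obtain i where "n = p ^ i" using divides_primepow_nat[OF p] by blast
    moreover have "n \<noteq> 1" using deg[of \<chi>] \<chi> n by auto
    ultimately have "p dvd n" by (cases i) auto
    then show "p dvd (char_degree G \<chi>)\<^sup>2" unfolding n by (simp add: power2_eq_square)
  qed
  moreover have "p dvd p ^ j" using j by simp
  ultimately show ?thesis using sum_squared_degrees card by (metis dvd_add_right_iff)
qed

end


section \<open>The two implications\<close>

context fin_group
begin

text \<open>
  If \<open>s = k\<close> then \<open>|N| \<equiv> k\<close> modulo \<open>p\<close> forces \<open>|N| = k\<close>, so \<open>N\<close> is a normal \<open>p\<close>-complement, and
  counting squared degrees shows that restriction is onto \<open>Irr N\<close>. Hence \<open>G\<close> fixes all irreducible
  characters, and so all conjugacy classes, of \<open>N\<close>.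
\<close>

theorem direct_product_if_degree_square_sum:
  assumes p: "prime p" and pk: "\<not> p dvd k" and card: "card (carrier G) = k * p ^ c"
    and s: "degree_square_sum G (Irr_det p k G) = k"
  shows "\<exists>P Q. internal_direct_product G P Q \<and> p_group p (G\<lparr>carrier := P\<rparr>) \<and> pprime_group p (G\<lparr>carrier := Q\<rparr>)"
proof -
  have fg: "fin_group G" by unfold_locales
  obtain N b where N: "subgroup N G" "{g \<in> carrier G. g [^] k = \<one>} \<subseteq> N" "card N = k * p ^ b"
      "[degree_square_sum G (Irr_det p k G) = card N] (mod p)"
      "inj_on (\<lambda>\<chi>. restrict \<chi> N) (Irr_det p k G)"
      "(\<lambda>\<chi>. restrict \<chi> N) ` Irr_det p k G \<subseteq> Irr_det p k (G\<lparr>carrier := N\<rparr>)"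
    using descent[OF p pk fg card] by blast
  have "b = 0"
  proof (rule ccontr)
    assume "b \<noteq> 0"
    then have "p dvd card N" using N(3) by simp
    then have "p dvd k" using N(4) s cong_dvd_iff by metis
    then show False using pk by simp
  qed
  then have cN: "card N = k" using N(3) by simp
  have NG: "N \<subseteq> carrier G" using subgroup.subset[OF N(1)] .
  have Neq: "N = {g \<in> carrier G. g [^] k = \<one>}"
    using N(2) NG subgroup_pow_card[OF N(1)] cN by auto
  have conj_pow: "(g \<otimes> h \<otimes> inv g) [^] (i::nat) = g \<otimes> h [^] i \<otimes> inv g" if "g \<in> carrier G" "h \<in> carrier G" for g h i
    using that by (induction i) (auto simp: nat_pow_Suc m_assoc inv_cancel)
  have Nconj: "g \<otimes> h \<otimes> inv g \<in> N" if "g \<in> carrier G" "h \<in> N" for g h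
    using that conj_pow[of g h k] unfolding Neq by simp
  have Nnormal: "N \<lhd> G"
    using N(1) Nconj by (simp add: normal_inv_iff)
  let ?H = "G\<lparr>carrier := N\<rparr>"
  have finN: "finite N" using finite_subset[OF NG fin] .
  interpret H: fin_group ?H
    using subgroup_imp_group[OF N(1)] finN by (simp add: fin_group_def fin_group_axioms_def)
  let ?R = "(\<lambda>\<chi>. restrict \<chi> N) ` Irr_det p k G"
  have RI: "?R \<subseteq> Irr ?H" using N(6) H.Irr_det_subset by blast
  have deg: "char_degree ?H (restrict \<chi> N) = char_degree G \<chi>" for \<chi>
    using subgroup.one_closed[OF N(1)] by (simp add: char_degree_def)
  have sR: "(\<Sum>\<theta>\<in>?R. (char_degree ?H \<theta>)\<^sup>2) = k"
    using s by (simp add: sum.reindex[OF N(5)] deg degree_square_sum_def)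
  have "Irr ?H - ?R = {}"
  proof (rule ccontr)
    assume ne: "Irr ?H - ?R \<noteq> {}"
    have "0 < (\<Sum>\<theta>\<in>Irr ?H - ?R. (char_degree ?H \<theta>)\<^sup>2)"
    proof (rule sum_pos)
      fix \<theta> assume "\<theta> \<in> Irr ?H - ?R"
      then obtain n \<rho> where r: "irreducible_representation ?H n \<rho>" "\<theta> = character_of ?H \<rho>" using H.IrrE by blast
      then show "0 < (char_degree ?H \<theta>)\<^sup>2"
        using H.char_degree_character_of[OF H.irr_rep[OF r(1)]] H.irr_pos[OF r(1)] by simp
    qed (use ne H.finite_Irr in auto)
    moreover have "(\<Sum>\<theta>\<in>Irr ?H. (char_degree ?H \<theta>)\<^sup>2) =
        (\<Sum>\<theta>\<in>Irr ?H - ?R. (char_degree ?H \<theta>)\<^sup>2) + (\<Sum>\<theta>\<in>?R. (char_degree ?H \<theta>)\<^sup>2)"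
      by (rule sum.subset_diff[OF RI H.finite_Irr])
    ultimately show False using H.sum_squared_degrees sR cN by simp
  qed
  then have onto: "Irr ?H \<subseteq> ?R" by blast
  have invariant: "\<theta> (g \<otimes> q \<otimes> inv g) = \<theta> q" if \<theta>: "\<theta> \<in> Irr ?H" and g: "g \<in> carrier G" and q: "q \<in> N" for \<theta> g q
  proof -
    obtain \<chi> where \<chi>: "\<chi> \<in> Irr_det p k G" "\<theta> = restrict \<chi> N" using onto \<theta> by blast
    obtain n \<rho> where r: "irreducible_representation G n \<rho>" "\<chi> = character_of G \<rho>" using Irr_detE[OF \<chi>(1)] by metis
    have "mat_trace (\<rho> (g \<otimes> q \<otimes> inv g)) = mat_trace (\<rho> q)"
      using trace_conjugate[OF irr_rep[OF r(1)] g] q NG by blast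
    then show ?thesis using Nconj[OF g q] g q NG unfolding \<chi>(2) r(2) by (auto simp: subset_iff)
  qed
  obtain P where P: "subgroup P G" "card P = p ^ c"
    using sylow_thm[OF p is_group, of c k] card by (auto simp: Coset.order_def mult.commute)
  have PG: "P \<subseteq> carrier G" using subgroup.subset[OF P(1)] .
  have comm: "x \<otimes> q \<otimes> inv x = q" if x: "x \<in> P" and q: "q \<in> N" for x q
  proof -
    have xG: "x \<in> carrier G" using x PG by blast
    let ?f = "\<lambda>q. x \<otimes> q \<otimes> inv x"
    show ?thesis
    proof (rule H.class_preserving_automorphism_trivial[OF p, of ?f c])
      show "\<not> p dvd card (carrier ?H)" using pk cN by simp
      show "?f \<in> hom ?H ?H"
        unfolding hom_def using Nconj[OF xG] NG xG by (auto simp: m_assoc inv_cancel subset_iff)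
      show "\<exists>a\<in>carrier ?H. ?f q = a \<otimes>\<^bsub>?H\<^esub> q \<otimes>\<^bsub>?H\<^esub> inv\<^bsub>?H\<^esub> a" if "q \<in> carrier ?H" for q
      proof -
        have qN: "q \<in> N" using that by simp
        obtain a where "a \<in> carrier ?H" "?f q = a \<otimes>\<^bsub>?H\<^esub> q \<otimes>\<^bsub>?H\<^esub> inv\<^bsub>?H\<^esub> a"
          using H.conjugate_if_characters_agree[of "?f q" q] invariant[OF _ xG qN] Nconj[OF xG qN] qN by auto
        then show ?thesis by blast
      qed
      show "(?f ^^ (p ^ c)) q = q" if "q \<in> carrier ?H" for q
      proof -
        have qG: "q \<in> carrier G" using that NG by auto
        have "(?f ^^ i) q = x [^] i \<otimes> q \<otimes> inv (x [^] i)" for i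
        proof (induction i)
          case (Suc i)
          have "x [^] Suc i = x \<otimes> x [^] i" using nat_pow_Suc2[OF xG] .
          then show ?case using Suc xG qG by (simp add: m_assoc inv_mult_group del: nat_pow_Suc)
        qed (use qG in simp)
        then show ?thesis using subgroup_pow_card[OF P(1) x] P(2) qG by simp
      qed
    qed (use q in simp)
  qed
  have comm': "q \<otimes> x = x \<otimes> q" if "x \<in> P" "q \<in> N" for x q
  proof -
    have G: "x \<in> carrier G" "q \<in> carrier G" using that PG NG by auto
    have "q \<otimes> x = (x \<otimes> q \<otimes> inv x) \<otimes> x" using comm[OF that] by simp
    then show ?thesis using G by (simp add: m_assoc)
  qed
  have cop: "coprime (p ^ c) k" using p pk prime_imp_coprime by (simp add: prime_imp_coprime)
  have PN: "P \<inter> N = {\<one>}"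
  proof
    show "P \<inter> N \<subseteq> {\<one>}"
    proof
      fix g assume g: "g \<in> P \<inter> N"
      then show "g \<in> {\<one>}"
        using coprime_pow_one[OF _ _ _ cop, of g] subgroup_pow_card[OF P(1), of g] subgroup_pow_card[OF N(1), of g]
          P(2) cN PG by auto
    qed
    show "{\<one>} \<subseteq> P \<inter> N" using subgroup.one_closed[OF P(1)] subgroup.one_closed[OF N(1)] by simp
  qed
  have "P <#> N \<subseteq> carrier G" using PG NG by (auto simp: set_mult_def)
  moreover have "card (P <#> N) = card (carrier G)"
    using subgroup_product_card[OF P(1) N(1) PN] P(2) cN card by simp
  ultimately have prod: "P <#> N = carrier G" by (intro card_subset_eq) auto
  have Pnormal: "P \<lhd> G"
    unfolding normal_inv_iff
  proof (intro conjI ballI P(1))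
    fix g h assume g: "g \<in> carrier G" and h: "h \<in> P"
    obtain a b where ab: "a \<in> P" "b \<in> N" "g = a \<otimes> b" using g unfolding prod[symmetric] set_mult_def by blast
    have G: "a \<in> carrier G" "b \<in> carrier G" "h \<in> carrier G" using ab h PG NG by auto
    have "g \<otimes> h \<otimes> inv g = a \<otimes> (b \<otimes> h) \<otimes> inv b \<otimes> inv a" unfolding ab(3) using G by (simp add: m_assoc inv_mult_group)
    also have "\<dots> = a \<otimes> h \<otimes> inv a" unfolding comm'[OF h ab(2)] using G by (simp add: m_assoc)
    finally show "g \<otimes> h \<otimes> inv g \<in> P"
      using ab(1) h subgroup.m_closed[OF P(1)] subgroup.m_inv_closed[OF P(1)] by simp
  qed
  have "internal_direct_product G P N"
    unfolding internal_direct_product_def using Pnormal Nnormal prod PN by blast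
  moreover have "p_group p (G\<lparr>carrier := P\<rparr>)"
    unfolding p_group_def using subgroup_imp_group[OF P(1)] finite_subset[OF PG fin] P(2)
    by (auto simp: Coset.order_def)
  moreover have "pprime_group p ?H"
    unfolding pprime_group_def using H.is_group finN cN p pk
    by (auto simp: Coset.order_def coprime_commute intro: prime_imp_coprime)
  ultimately show ?thesis by blast
qed

text \<open>
  For a direct product the last term \<open>N\<close> of the chain is \<open>Q\<close>, because a nontrivial \<open>p\<close>-group has a
  linear character of order \<open>p\<close>, which extends along the projection \<open>N \<rightarrow> N \<inter> P\<close>. Characters of \<open>Q\<close>
  extend along the projection \<open>G \<rightarrow> Q\<close>. Both projections are power maps.
\<close>

theorem degree_square_sum_direct_product:
  assumes p: "prime p" and pk: "\<not> p dvd k" and PQ: "internal_direct_product G P Q"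
    and cP: "card P = p ^ c" and cQ: "card Q = k"
  shows "degree_square_sum G (Irr_det p k G) = k"
proof -
  have nP: "P \<lhd> G" and nQ: "Q \<lhd> G" and prod: "P <#> Q = carrier G" and PiQ: "P \<inter> Q = {\<one>}"
    using PQ unfolding internal_direct_product_def by auto
  have P: "subgroup P G" and Q: "subgroup Q G" using nP nQ normal_imp_subgroup by auto
  have PG: "P \<subseteq> carrier G" and QG: "Q \<subseteq> carrier G" using P Q subgroup.subset by auto
  have card: "card (carrier G) = k * p ^ c"
    using subgroup_product_card[OF P Q PiQ] prod cP cQ by simp
  have comm: "a \<otimes> q = q \<otimes> a" if a: "a \<in> P" and q: "q \<in> Q" for a q
  proof -
    have G: "a \<in> carrier G" "q \<in> carrier G" using a q PG QG by auto
    have "a \<otimes> q \<otimes> inv a \<in> Q" using nQ G(1) q unfolding normal_inv_iff by blast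
    then have 1: "a \<otimes> q \<otimes> inv a \<otimes> inv q \<in> Q" using q subgroup.m_closed[OF Q] subgroup.m_inv_closed[OF Q] by simp
    have "q \<otimes> inv a \<otimes> inv q \<in> P"
      using nP G(2) subgroup.m_inv_closed[OF P a] unfolding normal_inv_iff by blast
    then have "a \<otimes> (q \<otimes> inv a \<otimes> inv q) \<in> P" using a subgroup.m_closed[OF P] by simp
    then have "a \<otimes> q \<otimes> inv a \<otimes> inv q \<in> P" using G by (simp add: m_assoc)
    then have "a \<otimes> q \<otimes> inv a \<otimes> inv q = \<one>" using 1 PiQ by blast
    then have "a \<otimes> q \<otimes> inv (q \<otimes> a) = \<one>" using G by (simp add: m_assoc inv_mult_group)
    then show ?thesis using G by (metis inv_equality inv_inv inv_closed m_closed)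
  qed
  have split: "\<exists>a\<in>P. \<exists>q\<in>Q. g = a \<otimes> q" if "g \<in> carrier G" for g
    using that unfolding prod[symmetric] set_mult_def by blast
  have cop: "coprime (p ^ c) k" using p pk by (simp add: prime_imp_coprime)
  have Ppow: "a [^] (p ^ c) = \<one>" if "a \<in> P" for a using subgroup_pow_card[OF P that] cP by simp
  have Qpow: "q [^] k = \<one>" if "q \<in> Q" for q using subgroup_pow_card[OF Q that] cQ by simp
  have powaq: "(a \<otimes> q) [^] (i::nat) = a [^] i \<otimes> q [^] i" if "a \<in> P" "q \<in> Q" for a q i
    using pow_mult_distrib[OF comm[OF that]] that PG QG by blast
  \<comment> \<open>The power maps with exponents \<open>e\<close> and \<open>e'\<close> are the projections to \<open>P\<close> and \<open>Q\<close>.\<close>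
  obtain e where e: "[e = 1] (mod p ^ c)" "[e = 0] (mod k)" using binary_chinese_remainder_nat[OF cop] by blast
  obtain e' where e': "[e' = 0] (mod p ^ c)" "[e' = 1] (mod k)" using binary_chinese_remainder_nat[OF cop] by blast
  have eP: "(a \<otimes> q) [^] e = a" and eQ: "(a \<otimes> q) [^] e' = q" if "a \<in> P" "q \<in> Q" for a q
  proof -
    have G: "a \<in> carrier G" "q \<in> carrier G" using that PG QG by auto
    show "(a \<otimes> q) [^] e = a"
      using powaq[OF that, of e] pow_cong[OF G(1) Ppow[OF that(1)] e(1)] pow_cong[OF G(2) Qpow[OF that(2)] e(2)] G by simp
    show "(a \<otimes> q) [^] e' = q"
      using powaq[OF that, of e'] pow_cong[OF G(1) Ppow[OF that(1)] e'(1)] pow_cong[OF G(2) Qpow[OF that(2)] e'(2)] G by simp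
  qed
  have prodaq: "(a \<otimes> q) \<otimes> (a' \<otimes> q') = (a \<otimes> a') \<otimes> (q \<otimes> q')" if "a \<in> P" "q \<in> Q" "a' \<in> P" "q' \<in> Q" for a q a' q'
  proof -
    have G: "a \<in> carrier G" "q \<in> carrier G" "a' \<in> carrier G" "q' \<in> carrier G" using that PG QG by auto
    have "(a \<otimes> q) \<otimes> (a' \<otimes> q') = a \<otimes> (q \<otimes> a') \<otimes> q'" using G by (simp add: m_assoc)
    then show ?thesis unfolding comm[OF that(3,2), symmetric] using G by (simp add: m_assoc)
  qed
  have e_hom: "(g \<otimes> h) [^] e = g [^] e \<otimes> h [^] e" "(g \<otimes> h) [^] e' = g [^] e' \<otimes> h [^] e'" "g [^] e \<in> P" "g [^] e' \<in> Q"
    if gh: "g \<in> carrier G" "h \<in> carrier G" for g h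
  proof -
    obtain a q where aq: "a \<in> P" "q \<in> Q" "g = a \<otimes> q" using split[OF gh(1)] by blast
    obtain a' q' where aq': "a' \<in> P" "q' \<in> Q" "h = a' \<otimes> q'" using split[OF gh(2)] by blast
    have m: "a \<otimes> a' \<in> P" "q \<otimes> q' \<in> Q" using aq aq' subgroup.m_closed[OF P] subgroup.m_closed[OF Q] by auto
    show "(g \<otimes> h) [^] e = g [^] e \<otimes> h [^] e" "(g \<otimes> h) [^] e' = g [^] e' \<otimes> h [^] e'"
      unfolding aq(3) aq'(3) prodaq[OF aq(1,2) aq'(1,2)]
      using eP[OF m] eQ[OF m] eP[OF aq(1,2)] eP[OF aq'(1,2)] eQ[OF aq(1,2)] eQ[OF aq'(1,2)] by simp_all
    show "g [^] e \<in> P" "g [^] e' \<in> Q" unfolding aq(3) using eP[OF aq(1,2)] eQ[OF aq(1,2)] aq by simp_all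
  qed
  have e_fix: "a [^] e = a" if "a \<in> P" for a
    using eP[OF that subgroup.one_closed[OF Q]] that PG by auto
  have e'_fix: "q [^] e' = q" if "q \<in> Q" for q
    using eQ[OF subgroup.one_closed[OF P] that] that QG by auto
  have fg: "fin_group G" by unfold_locales
  obtain N b where N: "subgroup N G" "{g \<in> carrier G. g [^] k = \<one>} \<subseteq> N" "card N = k * p ^ b"
      "\<not> p dvd card (linear_characters (G\<lparr>carrier := N\<rparr>))"
      "inj_on (\<lambda>\<chi>. restrict \<chi> N) (Irr_det p k G)"
      "(\<lambda>\<chi>. restrict \<chi> N) ` Irr_det p k G \<subseteq> Irr_det p k (G\<lparr>carrier := N\<rparr>)"
    using descent[OF p pk fg card] by blast
  have NG: "N \<subseteq> carrier G" using subgroup.subset[OF N(1)] .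
  have finN: "finite N" using finite_subset[OF NG fin] .
  have QN: "Q \<subseteq> N" using N(2) QG Qpow by auto
  have powN: "g [^] (i::nat) \<in> N" if "g \<in> N" for g i
    using that subgroup.m_closed[OF N(1)] subgroup.one_closed[OF N(1)] by (induction i) auto
  have "N \<inter> P = {\<one>}"
  proof (rule ccontr)
    assume ne: "N \<inter> P \<noteq> {\<one>}"
    let ?P = "N \<inter> P"
    have sP: "subgroup ?P G" using subgroups_Inter_pair[OF N(1) P] .
    interpret P0: fin_group "G\<lparr>carrier := ?P\<rparr>"
      using subgroup_imp_group[OF sP] finN by (simp add: fin_group_def fin_group_axioms_def)
    interpret N0: fin_group "G\<lparr>carrier := N\<rparr>"
      using subgroup_imp_group[OF N(1)] finN by (simp add: fin_group_def fin_group_axioms_def)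
    have "card ?P dvd p ^ c"
    proof -
      interpret PP: group "G\<lparr>carrier := P\<rparr>" by (rule subgroup_imp_group[OF P])
      have "subgroup ?P (G\<lparr>carrier := P\<rparr>)"
        by (rule subgroup_incl[OF sP P]) simp
      then have "card (rcosets\<^bsub>G\<lparr>carrier := P\<rparr>\<^esub> ?P) * card ?P = card P"
        using PP.lagrange by (simp add: Coset.order_def)
      then show ?thesis using cP by (metis dvd_triv_right)
    qed
    then obtain j where j: "card ?P = p ^ j" using divides_primepow_nat[OF p] by blast
    have "j \<noteq> 0"
    proof
      assume "j = 0"
      then have "card ?P = 1" using j by simp
      then obtain z where "?P = {z}" by (rule card_1_singletonE)
      then show False using ne subgroup.one_closed[OF sP] by auto
    qed
    then have "p dvd card (linear_characters (G\<lparr>carrier := ?P\<rparr>))"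
      using P0.p_group_linear_characters[OF p, of j] j by simp
    then obtain \<mu> x where \<mu>: "\<mu> \<in> linear_characters (G\<lparr>carrier := ?P\<rparr>)"
      "\<And>g. g \<in> ?P \<Longrightarrow> \<mu> g ^ p = 1" "x \<in> ?P" "\<mu> x \<noteq> 1"
      using P0.lin_of_prime_order[OF p] by auto
    define \<nu> where "\<nu> = (\<lambda>g\<in>N. \<mu> (g [^] e))"
    have eN: "g [^] e \<in> ?P" if "g \<in> N" for g using e_hom(3)[of g g] powN[OF that] that NG by auto
    have "\<nu> \<in> linear_characters (G\<lparr>carrier := N\<rparr>)"
    proof (rule N0.linI)
      show "\<nu> \<one>\<^bsub>G\<lparr>carrier := N\<rparr>\<^esub> = 1"
        using subgroup.one_closed[OF N(1)] P0.linD(2)[OF \<mu>(1)] by (simp add: \<nu>_def)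
      fix g h assume "g \<in> carrier (G\<lparr>carrier := N\<rparr>)" "h \<in> carrier (G\<lparr>carrier := N\<rparr>)"
      then have gh: "g \<in> N" "h \<in> N" by auto
      then have "(g \<otimes> h) [^] e = g [^] e \<otimes> h [^] e" using e_hom(1) NG by blast
      then show "\<nu> (g \<otimes>\<^bsub>G\<lparr>carrier := N\<rparr>\<^esub> h) = \<nu> g * \<nu> h"
        using gh subgroup.m_closed[OF N(1) gh] P0.linD(3)[OF \<mu>(1), of "g [^] e" "h [^] e"] eN
        by (simp add: \<nu>_def)
    qed (simp add: \<nu>_def)
    moreover have "\<nu> x = \<mu> x" using \<mu>(3) e_fix[of x] by (simp add: \<nu>_def)
    ultimately have "p dvd card (linear_characters (G\<lparr>carrier := N\<rparr>))"
      using N0.prime_dvd_card_lin[OF p, of \<nu> x] \<mu>(2-4) by simp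
    then show False using N(4) by simp
  qed
  have NQ: "N = Q"
  proof
    show "N \<subseteq> Q"
    proof
      fix g assume g: "g \<in> N"
      obtain a q where aq: "a \<in> P" "q \<in> Q" "g = a \<otimes> q" using split g NG by blast
      have "a \<in> N" using powN[OF g, of e] eP[OF aq(1,2)] aq(3) by simp
      then have "a = \<one>" using aq(1) \<open>N \<inter> P = {\<one>}\<close> by blast
      then show "g \<in> Q" using aq QG by auto
    qed
  qed (rule QN)
  let ?H = "G\<lparr>carrier := Q\<rparr>"
  interpret H: fin_group ?H
    using subgroup_imp_group[OF Q] finite_subset[OF QG fin] by (simp add: fin_group_def fin_group_axioms_def)
  have "(\<lambda>\<chi>. restrict \<chi> Q) ` Irr_det p k G = Irr ?H"
  proof
    show "(\<lambda>\<chi>. restrict \<chi> Q) ` Irr_det p k G \<subseteq> Irr ?H" using N(6) H.Irr_det_subset NQ by blast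
    show "Irr ?H \<subseteq> (\<lambda>\<chi>. restrict \<chi> Q) ` Irr_det p k G"
    proof
      fix \<theta> assume "\<theta> \<in> Irr ?H"
      then obtain n \<rho> where r: "irreducible_representation ?H n \<rho>" "\<theta> = character_of ?H \<rho>" using H.IrrE by blast
      note rD = H.repD[OF H.irr_rep[OF r(1)], simplified]
      define \<rho>' where "\<rho>' g = \<rho> (g [^] e')" for g
      have rep: "representation G n \<rho>'"
        unfolding rep_iff \<rho>'_def using rD e_hom(2,4) by auto
      have irr: "irreducible_representation G n \<rho>'"
      proof (rule irreducible_if_commutant_scalar[OF rep H.irr_pos[OF r(1)]])
        fix E assume E: "E \<in> carrier_mat n n" and c: "\<And>g. g \<in> carrier G \<Longrightarrow> \<rho>' g * E = E * \<rho>' g"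
        have "\<rho> q * E = E * \<rho> q" if "q \<in> carrier ?H" for q
          using c[of q] e'_fix[of q] that QG by (auto simp: \<rho>'_def)
        then obtain z where "E = z \<cdot>\<^sub>m 1\<^sub>m n" using H.schur_scalar[OF r(1) E] by blast
        then show "\<exists>c. E = c \<cdot>\<^sub>m 1\<^sub>m n" by blast
      qed
      have "n dvd k" using H.degree_dvd_order[OF r(1)] cQ by simp
      then have pn: "\<not> p dvd n" using pk dvd_trans by blast
      have det: "det (\<rho>' g) ^ k = 1" if g: "g \<in> carrier G" for g
      proof -
        let ?q = "g [^] e'"
        have q: "?q \<in> Q" using e_hom(4)[OF g g] .
        have "\<rho> (?q [^]\<^bsub>?H\<^esub> k) = \<rho> ?q ^\<^sub>m k" using H.rep_pow[OF H.irr_rep[OF r(1)], of ?q k] q by simp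
        moreover have "?q [^]\<^bsub>?H\<^esub> k = \<one>" using Qpow[OF q] nat_pow_consistent[of ?q k Q] by simp
        ultimately have "\<rho> ?q ^\<^sub>m k = 1\<^sub>m n" using rD(3) by simp
        then have "det (\<rho> ?q) ^ k = 1" using det_pow_mat[OF rD(1)[OF q], of k] by simp
        then show ?thesis by (simp add: \<rho>'_def)
      qed
      have "character_of G \<rho>' \<in> Irr_det p k G" by (rule Irr_detI[OF irr pn det])
      moreover have "restrict (character_of G \<rho>') Q = \<theta>"
        unfolding r(2) using QG e'_fix by (auto simp: character_of_def \<rho>'_def restrict_def fun_eq_iff)
      ultimately show "\<theta> \<in> (\<lambda>\<chi>. restrict \<chi> Q) ` Irr_det p k G" by blast
    qed
  qed
  moreover have "char_degree ?H (restrict \<chi> Q) = char_degree G \<chi>" for \<chi>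
    using subgroup.one_closed[OF Q] by (simp add: char_degree_def)
  moreover have "(\<Sum>\<theta>\<in>(\<lambda>\<chi>. restrict \<chi> Q) ` Irr_det p k G. (char_degree ?H \<theta>)\<^sup>2) =
      (\<Sum>\<chi>\<in>Irr_det p k G. (char_degree ?H (restrict \<chi> Q))\<^sup>2)"
    using N(5) unfolding NQ by (subst sum.reindex) auto
  ultimately show ?thesis using H.sum_squared_degrees cQ by (simp add: degree_square_sum_def)
qed

end

text \<open>
  The factor \<open>|G : G'|\<^bsub>p\<^esub>\<close> is the order of the Sylow \<open>p\<close>-subgroup of the group of linear characters and
  cancels against the same factor of \<open>u\<^bsub>p'\<^esub>(G)\<close>, so the equation says that the sum over the characters
  with normalised determinant is \<open>k = |G|\<^bsub>p'\<^esub>\<close>.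
\<close>

theorem theorem2p1:
  fixes G :: "('a, 'b) monoid_scheme" and p :: nat
  assumes "group G" and "finite (carrier G)" and "prime p"
  shows "(\<exists>P Q. internal_direct_product G P Q \<and>
            p_group p (G\<lparr>carrier := P\<rparr>) \<and> pprime_group p (G\<lparr>carrier := Q\<rparr>))
         \<longleftrightarrow> u_pprime p G =
               pprime_part p (Coset.order G) * p_part p (subgroup_index G (derived G (carrier G)))"
proof -
  interpret fin_group G using assms by (simp add: fin_group_def fin_group_axioms_def)
  note p = assms(3)
  have np: "\<not> is_unit p" using p by auto
  define c where "c = multiplicity p (card (carrier G))"
  define k where "k = pprime_part p (Coset.order G)"
  have k: "card (carrier G) = k * p ^ c" "\<not> p dvd k"
  proof -
    have "p ^ c dvd card (carrier G)" unfolding c_def by (rule multiplicity_dvd)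
    then show "card (carrier G) = k * p ^ c"
      unfolding k_def pprime_part_def p_part_def Coset.order_def c_def by simp
    show "\<not> p dvd k"
      unfolding k_def pprime_part_def p_part_def Coset.order_def
      using multiplicity_decompose[OF ord_G_nonzero(2) np] by simp
  qed
  define l where "l = card (linear_characters G)"
  have l0: "l \<noteq> 0" using card_lin_pos by (simp add: l_def)
  define a where "a = multiplicity p l"
  define m where "m = l div p ^ a"
  have m: "l = p ^ a * m" "\<not> p dvd m"
  proof -
    have "p ^ a dvd l" unfolding a_def by (rule multiplicity_dvd)
    then show "l = p ^ a * m" unfolding m_def by simp
    show "\<not> p dvd m" unfolding m_def a_def using multiplicity_decompose[OF l0 np] by simp
  qed
  have "m dvd k * p ^ c"
    using card_linear_characters m(1) k(1) unfolding l_def by (metis dvd_mult2 dvd_triv_right)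
  moreover have "coprime m (p ^ c)" using m(2) p by (metis coprime_commute coprime_power_left_iff prime_imp_coprime)
  ultimately have mk: "m dvd k" by (simp add: coprime_dvd_mult_left_iff)
  have u: "u_pprime p G = p ^ a * degree_square_sum G (Irr_det p k G)"
    by (rule u_pprime_factorisation[OF p _ mk k(2)]) (use m(1) l_def in simp)
  have "p_part p (subgroup_index G (derived G (carrier G))) = p ^ a"
    unfolding subgroup_index_derived p_part_def a_def l_def ..
  then have rhs: "u_pprime p G = pprime_part p (Coset.order G) * p_part p (subgroup_index G (derived G (carrier G)))
      \<longleftrightarrow> degree_square_sum G (Irr_det p k G) = k"
    unfolding u using prime_gt_0_nat[OF p] by (simp add: k_def[symmetric])
  show ?thesis
    unfolding rhs
  proof
    assume "\<exists>P Q. internal_direct_product G P Q \<and> p_group p (G\<lparr>carrier := P\<rparr>) \<and> pprime_group p (G\<lparr>carrier := Q\<rparr>)"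
    then obtain P Q j where PQ: "internal_direct_product G P Q" and cP: "card P = p ^ j" and cQ: "coprime (card Q) p"
      unfolding p_group_def pprime_group_def by (auto simp: Coset.order_def)
    have sub: "subgroup P G" "subgroup Q G" "P <#>\<^bsub>G\<^esub> Q = carrier G" "P \<inter> Q = {\<one>\<^bsub>G\<^esub>}"
      using PQ normal_imp_subgroup unfolding internal_direct_product_def by auto
    have "card (carrier G) = p ^ j * card Q"
      using subgroup_product_card[OF sub(1,2,4)] sub(3) cP by simp
    moreover have pQ: "\<not> p dvd card Q" using cQ np by (metis coprime_common_divisor dvd_refl)
    ultimately have eq: "k * p ^ c = card Q * p ^ j" using k(1) by simp
    have kk: "coprime k (p ^ j)" "coprime (card Q) (p ^ c)"
      using k(2) cQ p by (metis coprime_commute coprime_power_left_iff prime_imp_coprime, simp)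
    have "k dvd card Q" using eq kk(1) by (metis coprime_dvd_mult_left_iff dvd_triv_left)
    moreover have "card Q dvd k" using eq kk(2) by (metis coprime_dvd_mult_left_iff dvd_triv_left)
    ultimately have "card Q = k" by (simp add: dvd_antisym)
    then show "degree_square_sum G (Irr_det p k G) = k"
      by (rule degree_square_sum_direct_product[OF p k(2) PQ cP])
  next
    assume "degree_square_sum G (Irr_det p k G) = k"
    then show "\<exists>P Q. internal_direct_product G P Q \<and> p_group p (G\<lparr>carrier := P\<rparr>) \<and> pprime_group p (G\<lparr>carrier := Q\<rparr>)"
      by (rule direct_product_if_degree_square_sum[OF p k(2,1)])
  qed
qed

end
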